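(* Fix $\beta>0$. For each of the following three families of random Jacobi matrices, let $L_n=\frac1n\sum_{i=1}^n\delta_{\lambda_i}$ be the empirical distribution of the eigenvalues $\lambda_1,\dots,\lambda_n$ of the $n\times n$ matrix. As $n\to\infty$, $L_n$ converges weakly, almost surely (that is, for every bounded continuous $f:\mathbb{R}\to\mathbb{R}$, $\frac1n\sum_{i=1}^n f(\lambda_i)\to\int f\,d\mu_\infty$ almost surely), to the same limit $\mu_\infty$ as the spectral measures $\mu_n$ of the matrices, namely: (G) for the Gaussian beta ensemble matrices $H_{n,\beta}$, $\mu_\infty$ is the semicircle distribution; (W) for the Wishart beta ensemble matrices $L_{m,n,\beta}$, with $m=m(n)>n-1$ and $n/m\to\gamma\in(0,1)$, $\mu_\infty$ is the Marchenko-Pastur distribution with parameter $\gamma$; (M) for the MANOVA beta ensemble matrices $J_{n,\beta}(a(n),b(n))$, with $a(n),b(n)>-1$, $a(n)=\frac{n\beta}{2}\kappa_a+o((n\beta)^{1/2})$ and $b(n)=\frac{n\beta}{2}\kappa_b+o((n\beta)^{1/2})$ for some $\kappa_a,\kappa_b\in[0,\infty)$, $\mu_\infty$ is the Kesten-McKey distribution with parameters $(u_-,u_+)$.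
   Context: $\mathcal{N}(\mu,\sigma^2)$ is the normal distribution with variance $\sigma^2$; $\chi_k$ is the chi distribution with $k>0$ (real) degrees of freedom; $\mathrm{Beta}(x,y)$ is the beta distribution. In each family the matrices for different $n$ are defined on a common probability space. A Jacobi matrix is a real symmetric tridiagonal matrix with diagonal entries $a_i$ and positive off-diagonal entries $b_i$ (in positions $(i,i+1)$ and $(i+1,i)$). The spectral measure of an $n\times n$ Jacobi matrix $J$ is the unique probability measure $\mu$ on $\mathbb{R}$ with $\int x^k d\mu=J^k(1,1)$ for all $k\ge0$. (G) $H_{n,\beta}$: the $n\times n$ symmetric tridiagonal matrix with independent entries $a_i$, $b_i$, $\sqrt{n\beta}\,a_i\sim\mathcal{N}(0,2)$ for $1\le i\le n$ and $\sqrt{n\beta}\,b_i\sim\chi_{(n-i)\beta}$ for $1\le i\le n-1$. Semicircle distribution: density $\frac1{2\pi}\sqrt{4-x^2}$ on $[-2,2]$. (W) $L_{m,n,\beta}=B_\beta B_\beta^t$, where $B_\beta$ is the $n\times n$ lower bidiagonal matrix with independent entries, diagonal entries $(B_\beta)_{i,i}\sim\frac{1}{\sqrt{m\beta}}\chi_{\beta(m-i+1)}$ ($1\le i\le n$) and subdiagonal entries $(B_\beta)_{i+1,i}\sim\frac1{\sqrt{m\beta}}\chi_{\beta(n-i)}$ ($1\le i\le n-1$). Marchenko-Pastur distribution with parameter $\gamma\in(0,1)$: density $\frac{1}{2\pi\gamma x}\sqrt{(\lambda_+-x)(x-\lambda_-)}$ on $(\lambda_-,\lambda_+)$, $\lambda_\pm=(1\pm\sqrt\gamma)^2$.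 (M) $J_{n,\beta}(a,b)$, $a,b>-1$: let $p_1,\dots,p_{2n-1}$ be independent with $p_k\sim\mathrm{Beta}\big(\frac{2n-k}{4}\beta,\frac{2n-k-2}{4}\beta+a+b+2\big)$ for $k$ even and $p_k\sim\mathrm{Beta}\big(\frac{2n-k-1}{4}\beta+a+1,\frac{2n-k-1}{4}\beta+b+1\big)$ for $k$ odd, and $p_{-1}=p_0=0$. Then $J_{n,\beta}(a,b)$ is the $n\times n$ Jacobi matrix with $a_k=p_{2k-2}(1-p_{2k-3})+p_{2k-1}(1-p_{2k-2})$ and $b_k=\sqrt{p_{2k-1}(1-p_{2k-2})p_{2k}(1-p_{2k-1})}$. Kesten-McKey distribution with parameters $(u_-,u_+)$: density $\frac{2+\kappa_a+\kappa_b}{2\pi}\frac{\sqrt{(x-u_-)(u_+-x)}}{x(1-x)}$ on $(u_-,u_+)$, where $u_\pm=\Big(\frac{\sqrt{(1+\kappa_a)(1+\kappa_a+\kappa_b)}\pm\sqrt{1+\kappa_b}}{2+\kappa_a+\kappa_b}\Big)^2$. *)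

theory Defs
  imports
    "HOL-Probability.Probability"
    "HOL-Library.Landau_Symbols"
    "Jordan_Normal_Form.Char_Poly"
begin

section \<open>Probability distributions\<close>

definition chi_density :: "real \<Rightarrow> real \<Rightarrow> real" where
  "chi_density k x =
     (if x > 0 then 2 powr (1 - k / 2) * x powr (k - 1) * exp (- x\<^sup>2 / 2) / Gamma (k / 2) else 0)"

definition beta_density :: "real \<Rightarrow> real \<Rightarrow> real \<Rightarrow> real" where
  "beta_density r s x =
     (if 0 < x \<and> x < 1 then x powr (r - 1) * (1 - x) powr (s - 1) / Beta r s else 0)"

definition semicircle_distribution :: "real measure" where
  "semicircle_distribution = density lborel (\<lambda>x. ennreal
     (if x \<in> {-2..2} then sqrt (4 - x\<^sup>2) / (2 * pi) else 0))"

definition marchenko_pastur_distribution :: "real \<Rightarrow> real measure" where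
  "marchenko_pastur_distribution \<gamma> =
     (let lm = (1 - sqrt \<gamma>)\<^sup>2; lp = (1 + sqrt \<gamma>)\<^sup>2 in
      density lborel (\<lambda>x. ennreal
        (if x \<in> {lm<..<lp} then sqrt ((lp - x) * (x - lm)) / (2 * pi * \<gamma> * x) else 0)))"

definition kesten_mckey_distribution :: "real \<Rightarrow> real \<Rightarrow> real measure" where
  "kesten_mckey_distribution \<kappa>a \<kappa>b =
     (let um = ((sqrt ((1 + \<kappa>a) * (1 + \<kappa>a + \<kappa>b)) - sqrt (1 + \<kappa>b)) / (2 + \<kappa>a + \<kappa>b))\<^sup>2;
          up = ((sqrt ((1 + \<kappa>a) * (1 + \<kappa>a + \<kappa>b)) + sqrt (1 + \<kappa>b)) / (2 + \<kappa>a + \<kappa>b))\<^sup>2 in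
      density lborel (\<lambda>x. ennreal
        (if x \<in> {um<..<up}
         then (2 + \<kappa>a + \<kappa>b) / (2 * pi) * (sqrt ((x - um) * (up - x)) / (x * (1 - x)))
         else 0)))"


section \<open>Matrices and their measures\<close>

text \<open>Matrix positions are counted from 0 in the library; the coefficient sequences below keep
  the customary numbering from 1.\<close>

definition jacobi_matrix :: "nat \<Rightarrow> (nat \<Rightarrow> real) \<Rightarrow> (nat \<Rightarrow> real) \<Rightarrow> real mat" where
  "jacobi_matrix n a b = Matrix.mat n n (\<lambda>(i, j).
     if i = j then a (i + 1)
     else if j = i + 1 then b (i + 1)
     else if i = j + 1 then b (j + 1)
     else 0)"

definition lower_bidiagonal_matrix :: "nat \<Rightarrow> (nat \<Rightarrow> real) \<Rightarrow> (nat \<Rightarrow> real) \<Rightarrow> real mat" where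
  "lower_bidiagonal_matrix n d s = Matrix.mat n n (\<lambda>(i, j).
     if i = j then d (i + 1) else if i = j + 1 then s (j + 1) else 0)"

text \<open>The eigenvalues are listed with algebraic multiplicity. For a real symmetric \<open>n \<times> n\<close> matrix
  there are exactly \<open>n\<close> of them, so each gets the weight \<open>1 / n\<close>. Transporting to
  \<^const>\<open>borel\<close> replaces the discrete sigma-algebra of a pmf.\<close>

definition eigenvalue_mset :: "real mat \<Rightarrow> real multiset" where
  "eigenvalue_mset A = proots (char_poly A)"

definition empirical_measure :: "real mat \<Rightarrow> real measure" where
  "empirical_measure A = distr (measure_pmf (pmf_of_multiset (eigenvalue_mset A))) borel (\<lambda>x. x)"

lemma sum_count_eq_sum_mset:
  fixes f :: "'a \<Rightarrow> real"
  assumes "finite S" "set_mset E \<subseteq> S"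
  shows "(\<Sum>x\<in>S. real (count E x) * f x) = (\<Sum>x\<in>#E. f x)"
  using assms(2)
proof (induction E)
  case (add y E)
  have "(\<Sum>x\<in>S. real (count (add_mset y E) x) * f x) =
        (\<Sum>x\<in>S. (if x = y then f x else 0) + real (count E x) * f x)"
    by (intro sum.cong) (auto simp: algebra_simps)
  also have "\<dots> = f y + (\<Sum>x\<in>S. real (count E x) * f x)"
    using add.prems assms(1) by (simp add: sum.distrib)
  finally show ?case using add by simp
qed simp

lemma integral_empirical_measure:
  assumes "size (eigenvalue_mset A) = n" "n > 0" "f \<in> borel_measurable borel"
  shows "(\<integral>x. f x \<partial>empirical_measure A) = (1 / real n) * (\<Sum>x\<in>#eigenvalue_mset A. f x)"
proof -
  let ?E = "eigenvalue_mset A"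
  have ne: "?E \<noteq> {#}" using assms by auto
  have "(\<integral>x. f x \<partial>empirical_measure A) = (\<integral>x. f x \<partial>measure_pmf (pmf_of_multiset ?E))"
    unfolding empirical_measure_def using assms(3) by (subst integral_distr) auto
  also have "\<dots> = (\<Sum>x\<in>set_mset ?E. f x * pmf (pmf_of_multiset ?E) x)"
    by (rule integral_measure_pmf_real[where A = "set_mset ?E"])
       (use ne in \<open>auto simp: set_pmf_of_multiset\<close>)
  also have "\<dots> = (1 / real n) * (\<Sum>x\<in>set_mset ?E. real (count ?E x) * f x)"
    using ne assms(1) by (simp add: sum_distrib_left mult_ac)
  also have "(\<Sum>x\<in>set_mset ?E. real (count ?E x) * f x) = (\<Sum>x\<in>#?E. f x)"
    by (rule sum_count_eq_sum_mset) auto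
  finally show ?thesis .
qed

text \<open>The integrability contained in \<^const>\<open>has_bochner_integral\<close> is needed, because the library
  integral of a non-integrable function is 0.\<close>

definition spectral_measure :: "real mat \<Rightarrow> real measure" where
  "spectral_measure J = (THE \<mu>. real_distribution \<mu> \<and>
     (\<forall>k. has_bochner_integral \<mu> (\<lambda>x. x ^ k) ((J ^\<^sub>m k) $$ (0, 0))))"

definition weakly_converges_almost_surely ::
    "'w measure \<Rightarrow> (nat \<Rightarrow> 'w \<Rightarrow> real measure) \<Rightarrow> real measure \<Rightarrow> bool" where
  "weakly_converges_almost_surely M \<nu> \<mu> \<longleftrightarrow>
     (\<forall>f :: real \<Rightarrow> real. continuous_on UNIV f \<and> bounded (range f) \<longrightarrow>
        (AE \<omega> in M. (\<lambda>n. \<integral>x. f x \<partial>\<nu> n \<omega>) \<longlonglongrightarrow> (\<integral>x. f x \<partial>\<mu>)))"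


section \<open>The three families of entries\<close>

text \<open>All sizes \<open>n \<ge> 1\<close> live on the same probability space \<open>M\<close>; independence is required only within
  each matrix, and nothing is assumed about the joint law for different \<open>n\<close>.\<close>

definition gaussian_beta_entries ::
    "'w measure \<Rightarrow> real \<Rightarrow> (nat \<Rightarrow> nat \<Rightarrow> 'w \<Rightarrow> real) \<Rightarrow> (nat \<Rightarrow> nat \<Rightarrow> 'w \<Rightarrow> real) \<Rightarrow> bool" where
  "gaussian_beta_entries M \<beta> a b \<longleftrightarrow> prob_space M \<and> (\<forall>n\<ge>1.
     prob_space.indep_vars M (\<lambda>_. borel) (case_sum (a n) (b n)) ({1..n} <+> {1..<n}) \<and>
     (\<forall>i\<in>{1..n}. distributed M lborel (\<lambda>\<omega>. sqrt (real n * \<beta>) * a n i \<omega>)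
        (normal_density 0 (sqrt 2))) \<and>
     (\<forall>i\<in>{1..<n}. distributed M lborel (\<lambda>\<omega>. sqrt (real n * \<beta>) * b n i \<omega>)
        (chi_density ((real n - real i) * \<beta>))))"

definition wishart_beta_entries ::
    "'w measure \<Rightarrow> real \<Rightarrow> (nat \<Rightarrow> real) \<Rightarrow> (nat \<Rightarrow> nat \<Rightarrow> 'w \<Rightarrow> real) \<Rightarrow> (nat \<Rightarrow> nat \<Rightarrow> 'w \<Rightarrow> real) \<Rightarrow> bool"
  where
  "wishart_beta_entries M \<beta> m d s \<longleftrightarrow> prob_space M \<and> (\<forall>n\<ge>1.
     prob_space.indep_vars M (\<lambda>_. borel) (case_sum (d n) (s n)) ({1..n} <+> {1..<n}) \<and>
     (\<forall>i\<in>{1..n}. distributed M lborel (\<lambda>\<omega>. sqrt (m n * \<beta>) * d n i \<omega>)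
        (chi_density (\<beta> * (m n - real i + 1)))) \<and>
     (\<forall>i\<in>{1..<n}. distributed M lborel (\<lambda>\<omega>. sqrt (m n * \<beta>) * s n i \<omega>)
        (chi_density (\<beta> * (real n - real i)))))"

definition wishart_matrix :: "nat \<Rightarrow> (nat \<Rightarrow> real) \<Rightarrow> (nat \<Rightarrow> real) \<Rightarrow> real mat" where
  "wishart_matrix n d s = lower_bidiagonal_matrix n d s * transpose_mat (lower_bidiagonal_matrix n d s)"

text \<open>The variables \<open>p n k\<close> are indexed by integers \<open>k\<close> because of \<open>p\<^sub>-\<^sub>1 = p\<^sub>0 = 0\<close>.\<close>

definition manova_beta_variables ::
    "'w measure \<Rightarrow> real \<Rightarrow> (nat \<Rightarrow> real) \<Rightarrow> (nat \<Rightarrow> real) \<Rightarrow> (nat \<Rightarrow> int \<Rightarrow> 'w \<Rightarrow> real) \<Rightarrow> bool" where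
  "manova_beta_variables M \<beta> a b p \<longleftrightarrow> prob_space M \<and> (\<forall>n\<ge>1.
     prob_space.indep_vars M (\<lambda>_. borel) (p n) {1..2 * int n - 1} \<and>
     (\<forall>k\<in>{1..2 * int n - 1}. distributed M lborel (p n k)
        (if even k
         then beta_density ((2 * real n - of_int k) / 4 * \<beta>)
                ((2 * real n - of_int k - 2) / 4 * \<beta> + a n + b n + 2)
         else beta_density ((2 * real n - of_int k - 1) / 4 * \<beta> + a n + 1)
                ((2 * real n - of_int k - 1) / 4 * \<beta> + b n + 1))) \<and>
     (\<forall>\<omega>. p n (-1) \<omega> = 0 \<and> p n 0 \<omega> = 0))"

definition manova_diag :: "(int \<Rightarrow> real) \<Rightarrow> nat \<Rightarrow> real" where
  "manova_diag p i = (let k = int i in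
     p (2*k - 2) * (1 - p (2*k - 3)) + p (2*k - 1) * (1 - p (2*k - 2)))"

definition manova_offdiag :: "(int \<Rightarrow> real) \<Rightarrow> nat \<Rightarrow> real" where
  "manova_offdiag p i = (let k = int i in
     sqrt (p (2*k - 1) * (1 - p (2*k - 2)) * p (2*k) * (1 - p (2*k - 1))))"

definition manova_matrix :: "nat \<Rightarrow> (int \<Rightarrow> real) \<Rightarrow> real mat" where
  "manova_matrix n p = jacobi_matrix n (manova_diag p) (manova_offdiag p)"

end

theory Submission
  imports Defs
begin

text \<open>
  Both limits are read off from moments. For a symmetric tridiagonal matrix \<open>J\<close> the \<open>k\<close>-th moment of
  the spectral measure is the corner entry \<open>J\<^sup>k(1,1)\<close>, and that of the eigenvalue distribution is
  the normalised trace of \<open>J\<^sup>k\<close>. Either is a sum over paths of length \<open>k\<close>, so it only sees the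
  coefficients near one row: the first row for the spectral measure, a uniformly chosen row for the
  eigenvalues. The limit laws have bounded support, so convergence of moments gives weak convergence
  (\<open>moments_imp_weak_convergence\<close>).

  The randomness disappears first. On the scale of the matrix size \<open>n\<close>, squared chi variables, normal
  variables and beta variables deviate from their means with exponentially small probability; this
  fails only for the beta variables that belong to the last rows, and those are bounded. So a union
  bound over the \<open>O(n)\<close> variables of a matrix and the Borel-Cantelli lemma (\<open>AE_uniformly_small\<close>) allow
  replacing the coefficients by functions of the means, almost surely. In row \<open>i\<close> with \<open>i / n\<close>
  close to \<open>t\<close> they are then close to constants \<open>A t\<close> and \<open>B t\<close>.

  Near such a row the matrix looks like the Jacobi matrix on the integers with constant coefficients
  \<open>A t\<close>, \<open>B t\<close>, whose diagonal moments are those of the arcsine law on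
  \<open>[A t - 2 B t, A t + 2 B t]\<close>. Averaging over \<open>t\<close> (\<open>trace_average_limit\<close>) shows that the eigenvalue
  distribution converges to a mixture of arcsine laws. In all three families this mixture has an
  explicit density: at a fixed \<open>x\<close> the arcsine density is, as a function of \<open>t\<close>, a constant times
  the derivative of the square root of a function \<open>\<phi>\<close> that decreases in \<open>t\<close>, and integrating over
  \<open>t\<close> leaves that constant times \<open>sqrt (\<phi> 0)\<close>. This is the semicircle, Marchenko-Pastur and
  Kesten-McKey density, respectively.

  Near the first row the matrix converges to a Jacobi matrix on the half line that has constant
  coefficients except in the first row. For constant coefficients the corner moments are those of a
  semicircle law, by expansion in \<open>sin (i \<theta>)\<close>. The Wishart matrix on the half line is \<open>L U\<close> with
  \<open>L\<close> and \<open>U\<close> bidiagonal and \<open>U L\<close> of constant coefficients, and the MANOVA matrix becomes one of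
  constant coefficients when this exchange is applied to it and then to its complement to the
  identity. On the side of the measures an exchange multiplies by \<open>x\<close> or by \<open>1 - x\<close>, and these are
  the denominators of the Marchenko-Pastur and of the Kesten-McKey density. Hence the spectral measures
  have the same limits as the eigenvalue distributions.
\<close>


section \<open>The spectral theorem for real symmetric matrices\<close>

text \<open>The reflection that exchanges \<open>u\<close> and the first basis vector. If they coincide, then \<open>c\<close> is a
quotient by zero, hence zero, and \<open>H\<close> is the identity, as it should be.\<close>

lemma householder_reflection:
  fixes u :: "real vec"
  assumes u: "u \<in> carrier_vec n" and n: "n > 0" and unit: "(\<Sum>i<n. (vec_index u i)\<^sup>2) = 1"
  obtains H where "H \<in> carrier_mat n n" "H\<^sup>T = H" "H * H = 1\<^sub>m n" "\<And>i. i < n \<Longrightarrow> H $$ (i, 0) = vec_index u i"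
proof -
  define w where "w i = vec_index u i - (if i = 0 then 1 else 0)" for i
  define c where "c = 2 / (\<Sum>i<n. (w i)\<^sup>2)"
  define H where "H = Matrix.mat n n (\<lambda>(i, j). (if i = j then 1 else 0) - c * w i * w j)"
  have H: "H \<in> carrier_mat n n" by (simp add: H_def)
  have sym: "H\<^sup>T = H" by (rule eq_matI) (auto simp: H_def)
  have ww: "(\<Sum>i<n. (w i)\<^sup>2) = 2 - 2 * vec_index u 0"
  proof -
    have "(\<Sum>i<n. (w i)\<^sup>2) = (\<Sum>i<n. (vec_index u i)\<^sup>2 + (if i = 0 then 1 - 2 * vec_index u 0 else 0))"
      by (rule sum.cong) (auto simp: w_def power2_eq_square algebra_simps)
    also have "\<dots> = 1 + (1 - 2 * vec_index u 0)"
      using n unit by (simp add: sum.distrib)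
    finally show ?thesis by simp
  qed
  have cc: "c * c * (\<Sum>i<n. (w i)\<^sup>2) = 2 * c"
    by (simp add: c_def)
  have "H * H = 1\<^sub>m n"
  proof (rule eq_matI)
    fix i j assume ij: "i < dim_row (1\<^sub>m n)" "j < dim_col (1\<^sub>m n)"
    have "(H * H) $$ (i, j) = (\<Sum>k<n. ((if i = k then 1 else 0) - c * w i * w k) *
            ((if k = j then 1 else 0) - c * w k * w j))"
      using ij by (simp add: H_def scalar_prod_def lessThan_atLeast0)
    also have "\<dots> = (\<Sum>k<n. (if k = i then (if i = j then 1 else 0) - c * w i * w j else 0)
         - (if k = j then c * w i * w j else 0) + (c * c) * (w k)\<^sup>2 * (w i * w j))"
      by (rule sum.cong) (auto simp: power2_eq_square algebra_simps)
    also have "\<dots> = (if i = j then 1 else 0) - c * w i * w j - c * w i * w j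
        + (c * c * (\<Sum>k<n. (w k)\<^sup>2)) * (w i * w j)"
      using ij by (simp add: sum.distrib sum_subtractf sum_distrib_left sum_distrib_right mult_ac)
    also have "\<dots> = (1\<^sub>m n) $$ (i, j)" unfolding cc using ij by simp
    finally show "(H * H) $$ (i, j) = (1\<^sub>m n) $$ (i, j)" .
  qed (auto simp: H_def)
  moreover have "H $$ (i, 0) = vec_index u i" if "i < n" for i
  proof (cases "vec_index u 0 = 1")
    case True
    then have "(\<Sum>i<n. (w i)\<^sup>2) = 0" using ww by simp
    then have "w i = 0" using that by (simp add: sum_nonneg_eq_0_iff)
    then show ?thesis using that n by (auto simp: H_def w_def split: if_splits)
  next
    case False
    moreover have "c = 2 / (2 - 2 * vec_index u 0)" by (simp add: c_def ww)
    ultimately have "c * w 0 = -1" by (simp add: w_def field_simps)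
    then have "c * w i * w 0 = - w i" by (metis mult.assoc mult.commute mult_minus1)
    then have "H $$ (i, 0) = (if i = 0 then 1 else 0) + w i"
      using that n by (simp add: H_def)
    then show ?thesis by (simp add: w_def)
  qed
  ultimately show ?thesis using that H sym by blast
qed

text \<open>For an eigenvector \<open>x\<close>, the number \<open>x\<^sup>* A x = z x\<^sup>* x\<close> equals its own conjugate.\<close>

lemma symmetric_real_root_char_poly_real:
  fixes A :: "real mat" and z :: complex
  assumes A: "A \<in> carrier_mat n n" and sym: "A\<^sup>T = A"
    and z: "poly (char_poly (map_mat of_real A)) z = 0"
  shows "z \<in> \<real>"
proof -
  define C where "C = map_mat complex_of_real A"
  have C: "C \<in> carrier_mat n n" using A by (simp add: C_def)
  have sC: "C $$ (i, j) = C $$ (j, i)" "cnj (C $$ (i, j)) = C $$ (i, j)" if "i < n" "j < n" for i j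
    using that A arg_cong[OF sym, of "\<lambda>M. M $$ (i, j)"] by (auto simp: C_def)
  from z obtain v where v: "v \<in> carrier_vec n" "v \<noteq> 0\<^sub>v n" "C *\<^sub>v v = z \<cdot>\<^sub>v v"
    using eigenvalue_root_char_poly[OF C] C unfolding C_def eigenvalue_def eigenvector_def by auto
  define x where "x i = vec_index v i" for i
  have ev: "(\<Sum>j<n. C $$ (i, j) * x j) = z * x i" if "i < n" for i
    using arg_cong[OF v(3), of "\<lambda>y. vec_index y i"] that v(1) C
    by (simp add: scalar_prod_def lessThan_atLeast0 x_def row_def)
  have "(\<Sum>i<n. cnj (x i) * (\<Sum>j<n. C $$ (i, j) * x j)) = (\<Sum>j<n. x j * cnj (\<Sum>i<n. C $$ (j, i) * x i))"
    unfolding sum_distrib_left cnj_sum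
    by (subst sum.swap) (auto intro!: sum.cong simp: sC mult_ac)
  also have "\<dots> = (\<Sum>j<n. x j * cnj (z * x j))"
    by (rule sum.cong) (simp_all only: ev lessThan_iff)
  also have "\<dots> = cnj z * (\<Sum>i<n. cnj (x i) * x i)"
    by (simp add: sum_distrib_left mult_ac)
  also have "(\<Sum>i<n. cnj (x i) * (\<Sum>j<n. C $$ (i, j) * x j)) = (\<Sum>i<n. cnj (x i) * (z * x i))"
    by (rule sum.cong) (simp_all only: ev lessThan_iff)
  also have "\<dots> = z * (\<Sum>i<n. cnj (x i) * x i)"
    by (simp add: sum_distrib_left mult_ac)
  finally have "z * (\<Sum>i<n. cnj (x i) * x i) = cnj z * (\<Sum>i<n. cnj (x i) * x i)" .
  moreover have "(\<Sum>i<n. cnj (x i) * x i) \<noteq> 0"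
  proof -
    have "(\<Sum>i<n. cnj (x i) * x i) = of_real (\<Sum>i<n. (cmod (x i))\<^sup>2)"
      unfolding of_real_sum complex_norm_square by (simp add: mult.commute)
    moreover obtain i where "i < n" "x i \<noteq> 0"
      using v(1,2) eq_vecI[of v "0\<^sub>v n"] by (auto simp: x_def)
    then have "(\<Sum>i<n. (cmod (x i))\<^sup>2) > 0" by (intro sum_pos2[of _ i]) auto
    ultimately show ?thesis by (metis of_real_eq_0_iff less_irrefl)
  qed
  ultimately show ?thesis by (simp add: Reals_cnj_iff)
qed

lemma symmetric_real_unit_eigenvector:
  fixes A :: "real mat"
  assumes A: "A \<in> carrier_mat n n" and sym: "A\<^sup>T = A" and n: "n > 0"
  obtains u l where "u \<in> carrier_vec n" "(\<Sum>i<n. (vec_index u i)\<^sup>2) = 1" "A *\<^sub>v u = l \<cdot>\<^sub>v u"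
proof -
  let ?C = "map_mat complex_of_real A"
  interpret hom: inj_comm_ring_hom complex_of_real by unfold_locales auto
  interpret hom': map_poly_inj_comm_ring_hom complex_of_real ..
  have C: "?C \<in> carrier_mat n n" using A by simp
  have "degree (char_poly ?C) = n" using degree_monic_char_poly[OF C] by simp
  then have "\<not> constant (poly (char_poly ?C))" using n by (simp add: constant_degree)
  then obtain z where z: "poly (char_poly ?C) z = 0" using fundamental_theorem_of_algebra by blast
  then obtain l where "z = of_real l" using symmetric_real_root_char_poly_real[OF A sym] by (auto elim: Reals_cases)
  then have "poly (char_poly A) l = 0" using z unfolding of_real_hom.char_poly_hom[OF A] by simp
  then obtain v where v: "v \<in> carrier_vec n" "v \<noteq> 0\<^sub>v n" "A *\<^sub>v v = l \<cdot>\<^sub>v v"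
    using eigenvalue_root_char_poly[OF A] A unfolding eigenvalue_def eigenvector_def by auto
  define s where "s = (\<Sum>i<n. (vec_index v i)\<^sup>2)"
  obtain i where "i < n" "vec_index v i \<noteq> 0"
    using v(1,2) eq_vecI[of v "0\<^sub>v n"] by auto
  then have s: "s > 0" unfolding s_def by (intro sum_pos2[of _ i]) auto
  define u where "u = (1 / sqrt s) \<cdot>\<^sub>v v"
  have "u \<in> carrier_vec n" using v by (simp add: u_def)
  moreover have "(\<Sum>i<n. (vec_index u i)\<^sup>2) = (\<Sum>i<n. (vec_index v i)\<^sup>2 / s)"
    using v s by (intro sum.cong) (auto simp: u_def power_divide)
  then have "(\<Sum>i<n. (vec_index u i)\<^sup>2) = 1"
    using s by (simp add: s_def sum_divide_distrib[symmetric])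
  moreover have "A *\<^sub>v u = l \<cdot>\<^sub>v u"
    unfolding u_def using v A by (subst mult_mat_vec[of _ n n]) (auto simp: smult_smult_assoc mult.commute)
  ultimately show ?thesis using that by blast
qed

text \<open>Induction on the size: the reflection that takes the first basis vector to a unit eigenvector splits
off a \<open>1 \<times> 1\<close> block, and symmetry makes the block above the rest vanish together with the one below.\<close>

theorem symmetric_real_diagonalisation:
  fixes A :: "real mat"
  assumes "A \<in> carrier_mat n n" "A\<^sup>T = A"
  shows "\<exists>P d. similar_mat_wit A (mat_diag n d) P P\<^sup>T"
  using assms
proof (induction n arbitrary: A)
  case 0
  then have "A = mat_diag 0 (\<lambda>_. 0)" by (auto intro!: eq_matI simp: mat_diag_def)
  with similar_mat_wit_refl[OF 0(1)] have "similar_mat_wit A (mat_diag 0 (\<lambda>_. 0)) (1\<^sub>m 0) (1\<^sub>m 0)\<^sup>T"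
    by simp
  then show ?case by blast
next
  case (Suc n)
  obtain u l where u: "u \<in> carrier_vec (Suc n)" "(\<Sum>i<Suc n. (vec_index u i)\<^sup>2) = 1" "A *\<^sub>v u = l \<cdot>\<^sub>v u"
    using symmetric_real_unit_eigenvector[OF Suc.prems] by blast
  obtain H where H: "H \<in> carrier_mat (Suc n) (Suc n)" "H\<^sup>T = H" "H * H = 1\<^sub>m (Suc n)"
    and Hu: "\<And>i. i < Suc n \<Longrightarrow> H $$ (i, 0) = vec_index u i"
    using householder_reflection[OF u(1) _ u(2)] by blast
  note A = Suc.prems(1)
  define B where "B = H * A * H"
  have B: "B \<in> carrier_mat (Suc n) (Suc n)" using H A by (simp add: B_def)
  have symB: "B\<^sup>T = B"
    unfolding B_def using H A Suc.prems(2)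
    by (subst transpose_mult[of _ "Suc n" "Suc n"], simp, simp)
       (subst transpose_mult[of _ "Suc n" "Suc n"], auto)
  have simAB: "similar_mat_wit A B H H"
  proof (rule similar_mat_witI)
    have "H * B * H = (H * H) * A * (H * H)"
      unfolding B_def using H(1) A by (simp add: assoc_mult_mat[of _ "Suc n" "Suc n" _ "Suc n" _ "Suc n"])
    then show "A = H * B * H" unfolding H(3) using A by simp
  qed (use H A B in auto)
  have colu: "col H 0 = u" using H Hu u by (intro eq_vecI) auto
  have "col B 0 = (H * A) *\<^sub>v col H 0" unfolding B_def using H A by (intro col_mult2) auto
  also have "\<dots> = H *\<^sub>v (l \<cdot>\<^sub>v u)" unfolding colu using H A u by (simp add: assoc_mult_mat_vec[of _ "Suc n" "Suc n" _ "Suc n"])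
  also have "\<dots> = l \<cdot>\<^sub>v col (H * H) 0"
    unfolding col_mult2[OF H(1) H(1) zero_less_Suc] colu using H(1) u(1) by (rule mult_mat_vec)
  finally have colB: "col B 0 = l \<cdot>\<^sub>v unit_vec (Suc n) 0" unfolding H(3) by simp
  define B' where "B' = Matrix.mat n n (\<lambda>(i, j). B $$ (Suc i, Suc j))"
  have Bi0: "B $$ (i, 0) = (if i = 0 then l else 0)" if "i < Suc n" for i
    using arg_cong[OF colB, of "\<lambda>v. vec_index v i"] that B by (simp split: if_splits)
  have B0i: "B $$ (0, i) = (if i = 0 then l else 0)" if "i < Suc n" for i
    using Bi0[OF that] arg_cong[OF symB, of "\<lambda>M. M $$ (i, 0)"] that B by simp
  have Bblock: "B = four_block_mat (mat_diag 1 (\<lambda>_. l)) (0\<^sub>m 1 n) (0\<^sub>m n 1) B'"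
    using B by (intro eq_matI) (auto simp: B'_def Bi0 B0i mat_diag_def)
  have "B $$ (i, j) = B $$ (j, i)" if "i < Suc n" "j < Suc n" for i j
    using arg_cong[OF symB, of "\<lambda>M. M $$ (i, j)"] B that by simp
  then have "B'\<^sup>T = B'"
    by (intro eq_matI) (auto simp: B'_def)
  then obtain P d where P: "similar_mat_wit B' (mat_diag n d) P P\<^sup>T"
    using Suc.IH[of B'] by (auto simp: B'_def)
  have Pc: "P \<in> carrier_mat n n" using similar_mat_witD2(6)[OF _ P, of n n] by (simp add: B'_def)
  define Q where "Q = four_block_mat (1\<^sub>m 1) (0\<^sub>m 1 n) (0\<^sub>m n 1) P"
  define e where "e i = (case i of 0 \<Rightarrow> l | Suc j \<Rightarrow> d j)" for i
  have QT: "Q\<^sup>T = four_block_mat (1\<^sub>m 1) (0\<^sub>m 1 n) (0\<^sub>m n 1) P\<^sup>T"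
    unfolding Q_def using Pc by (subst transpose_four_block_mat[of _ 1 1 _ n _ n]) auto
  have e: "mat_diag (Suc n) e = four_block_mat (mat_diag 1 (\<lambda>_. l)) (0\<^sub>m 1 n) (0\<^sub>m n 1) (mat_diag n d)"
    by (intro eq_matI) (auto simp: mat_diag_def e_def split: nat.splits)
  have "similar_mat_wit B (mat_diag (Suc n) e) Q Q\<^sup>T"
    unfolding QT Bblock e unfolding Q_def
    by (rule similar_mat_wit_four_block[OF similar_mat_wit_refl P])
       (use Pc in \<open>auto simp: B'_def mat_diag_def\<close>)
  from similar_mat_wit_trans[OF simAB this]
  have "similar_mat_wit A (mat_diag (Suc n) e) (H * Q) (Q\<^sup>T * H)" .
  moreover have "Q\<^sup>T * H = (H * Q)\<^sup>T"
    using H Pc by (subst transpose_mult[of _ "Suc n" "Suc n"]) (auto simp: Q_def)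
  ultimately show ?case by auto
qed


lemma mat_diag_pow: "mat_diag n d ^\<^sub>m k = mat_diag n (\<lambda>i. (d i :: real) ^ k)"
  by (induction k) (simp_all add: mult.commute, simp add: mat_diag_def)

lemma symmetric_real_spectral_decomposition:
  fixes A :: "real mat"
  assumes A: "A \<in> carrier_mat n n" and sym: "A\<^sup>T = A"
  obtains P :: "nat \<Rightarrow> nat \<Rightarrow> real" and d :: "nat \<Rightarrow> real" where
    "\<And>k i j. i < n \<Longrightarrow> j < n \<Longrightarrow> (A ^\<^sub>m k) $$ (i, j) = (\<Sum>l<n. P i l * P j l * d l ^ k)"
    "\<And>l. l < n \<Longrightarrow> (\<Sum>i<n. (P i l)\<^sup>2) = 1"
    "eigenvalue_mset A = image_mset d (mset_set {..<n})"
proof -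
  obtain P d where P: "similar_mat_wit A (mat_diag n d) P P\<^sup>T"
    using symmetric_real_diagonalisation[OF assms] by blast
  note W = similar_mat_witD2[OF A P]
  have "(A ^\<^sub>m k) $$ (i, j) = (\<Sum>l<n. P $$ (i, l) * P $$ (j, l) * d l ^ k)" if "i < n" "j < n" for k i j
  proof -
    have "(A ^\<^sub>m k) = P * mat_diag n (\<lambda>i. d i ^ k) * P\<^sup>T"
      using similar_mat_wit_pow_id[OF P] by (simp add: mat_diag_pow)
    then show ?thesis
      using that W(6) by (simp add: mat_diag_mult_right[of _ n] scalar_prod_def lessThan_atLeast0 mult_ac)
  qed
  moreover have "(\<Sum>i<n. (P $$ (i, l))\<^sup>2) = 1" if "l < n" for l
    using arg_cong[OF W(2), of "\<lambda>M. M $$ (l, l)"] that W(6)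
    by (simp add: scalar_prod_def lessThan_atLeast0 power2_eq_square)
  moreover have "eigenvalue_mset A = image_mset d (mset_set {..<n})"
  proof -
    have "similar_mat A (mat_diag n d)" using P unfolding similar_mat_def by blast
    from char_poly_similar[OF this]
    have "char_poly A = (\<Prod>a\<leftarrow>diag_mat (mat_diag n d). [:- a, 1:])"
      by (subst char_poly_upper_triangular[symmetric]) (auto simp: mat_diag_def)
    also have "diag_mat (mat_diag n d) = map d [0..<n]"
      by (rule nth_equalityI) (auto simp: diag_mat_def mat_diag_def)
    also have "(\<Prod>a\<leftarrow>map d [0..<n]. [:- a, 1:]) = (\<Prod>i<n. [:- d i, 1:])"
      by (induction n) (simp_all add: lessThan_Suc mult.commute)
    finally have "eigenvalue_mset A = (\<Sum>i<n. {#d i#})"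
      unfolding eigenvalue_mset_def by (simp add: proots_prod)
    also have "\<dots> = image_mset d (mset_set {..<n})" by (induction n) (simp_all add: lessThan_Suc)
    finally show ?thesis .
  qed
  ultimately show ?thesis by (rule that[of "\<lambda>i l. P $$ (i, l)" d])
qed

lemma size_eigenvalue_mset_symmetric:
  fixes A :: "real mat"
  assumes "A \<in> carrier_mat n n" "A\<^sup>T = A"
  shows "size (eigenvalue_mset A) = n"
  using assms by (rule symmetric_real_spectral_decomposition) simp

lemma eigenvalue_power_sum:
  fixes A :: "real mat"
  assumes "A \<in> carrier_mat n n" "A\<^sup>T = A"
  shows "(\<Sum>x\<in>#eigenvalue_mset A. x ^ k) = (\<Sum>i<n. (A ^\<^sub>m k) $$ (i, i))"
proof -
  obtain P d where
    pow: "\<And>k i j. i < n \<Longrightarrow> j < n \<Longrightarrow> (A ^\<^sub>m k) $$ (i, j) = (\<Sum>l<n. P i l * P j l * d l ^ k)"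
    and unit: "\<And>l. l < n \<Longrightarrow> (\<Sum>i<n. (P i l)\<^sup>2) = 1"
    and E: "eigenvalue_mset A = image_mset d (mset_set {..<n})"
    by (rule symmetric_real_spectral_decomposition[OF assms]) blast
  have "(\<Sum>i<n. (A ^\<^sub>m k) $$ (i, i)) = (\<Sum>i<n. \<Sum>l<n. (P i l)\<^sup>2 * d l ^ k)"
    by (simp add: pow power2_eq_square)
  also have "\<dots> = (\<Sum>l<n. (\<Sum>i<n. (P i l)\<^sup>2) * d l ^ k)"
    by (subst sum.swap) (simp add: sum_distrib_right)
  also have "\<dots> = (\<Sum>l<n. d l ^ k)" by (simp add: unit)
  also have "\<dots> = (\<Sum>x\<in>#eigenvalue_mset A. x ^ k)"
    by (simp add: E image_mset.compositionality comp_def sum_unfold_sum_mset)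
  finally show ?thesis by simp
qed

lemma empirical_measure_moments:
  fixes A :: "real mat"
  assumes A: "A \<in> carrier_mat n n" "A\<^sup>T = A" and n: "n > 0"
  shows "real_distribution (empirical_measure A)"
    and "integrable (empirical_measure A) (\<lambda>x. x ^ k)"
    and "(\<integral>x. x ^ k \<partial>empirical_measure A) = (\<Sum>i<n. (A ^\<^sub>m k) $$ (i, i)) / real n"
proof -
  note size = size_eigenvalue_mset_symmetric[OF A]
  show "real_distribution (empirical_measure A)"
    unfolding empirical_measure_def by (rule prob_space.real_distribution_distr) (auto intro: prob_space_measure_pmf)
  have "eigenvalue_mset A \<noteq> {#}" using size n by auto
  then show "integrable (empirical_measure A) (\<lambda>x. x ^ k)"
    unfolding empirical_measure_def
    by (subst integrable_distr_eq) (auto intro!: integrable_measure_pmf_finite simp: set_pmf_of_multiset)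
  show "(\<integral>x. x ^ k \<partial>empirical_measure A) = (\<Sum>i<n. (A ^\<^sub>m k) $$ (i, i)) / real n"
    by (subst integral_empirical_measure[OF size n]) (simp_all add: eigenvalue_power_sum[OF A])
qed

section \<open>Weak convergence from convergence of moments\<close>

text \<open>The approximation is uniform on \<open>[-R, R]\<close>. Outside, every polynomial is dominated by high powers of
\<open>x / R\<close>, which have a small integral under a law that lives on \<open>[-R / 2, R / 2]\<close>. The exponent
\<open>j\<close> is left free so that it can be chosen after the constant \<open>K\<close>.\<close>

lemma polynomial_approximation_with_growth:
  fixes f :: "real \<Rightarrow> real"
  assumes f: "continuous_on UNIV f" and C: "\<And>x. \<bar>f x\<bar> \<le> C" and R: "R \<ge> 1" and e: "e > 0"
  obtains a N K where "K \<ge> 0"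
    "\<And>j x. j \<ge> N \<Longrightarrow> \<bar>f x - (\<Sum>i\<le>N. a i * x ^ i)\<bar> \<le> e + K * (x / R) ^ (2 * j)"
proof -
  have "compact {-R..R}" "continuous_on {-R..R} f" using f continuous_on_subset by auto
  from Stone_Weierstrass_real_polynomial_function[OF this e]
  obtain g where g: "real_polynomial_function g" "\<And>x. x \<in> {-R..R} \<Longrightarrow> \<bar>f x - g x\<bar> < e" by blast
  obtain a N where ag: "g = (\<lambda>x. \<Sum>i\<le>N. a i * x ^ i)"
    using g(1) real_polynomial_function_iff_sum by blast
  define K where "K = C + (\<Sum>i\<le>N. \<bar>a i\<bar> * R ^ i)"
  have C0: "C \<ge> 0" using C[of 0] by linarith
  then have K: "K \<ge> 0" unfolding K_def using R by (intro add_nonneg_nonneg sum_nonneg mult_nonneg_nonneg) auto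
  have "\<bar>f x - g x\<bar> \<le> e + K * (x / R) ^ (2 * j)" if j: "j \<ge> N" for j x
  proof (cases "\<bar>x\<bar> \<le> R")
    case True
    then have "\<bar>f x - g x\<bar> < e" using g(2)[of x] by (simp add: abs_le_iff)
    moreover have "K * (x / R) ^ (2 * j) \<ge> 0" using K by (simp add: power_mult)
    ultimately show ?thesis by linarith
  next
    case False
    define y where "y = \<bar>x\<bar> / R"
    have y: "y \<ge> 1" and xy: "\<bar>x\<bar> = R * y" using False R by (auto simp: y_def field_simps)
    have "\<bar>g x\<bar> \<le> (\<Sum>i\<le>N. \<bar>a i * x ^ i\<bar>)" unfolding ag by (rule sum_abs)
    also have "\<dots> \<le> (\<Sum>i\<le>N. \<bar>a i\<bar> * R ^ i * y ^ (2 * j))"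
    proof (rule sum_mono)
      fix i assume "i \<in> {..N}"
      then have "y ^ i \<le> y ^ (2 * j)" using j y by (intro power_increasing) auto
      then show "\<bar>a i * x ^ i\<bar> \<le> \<bar>a i\<bar> * R ^ i * y ^ (2 * j)"
        using R by (simp add: abs_mult power_abs xy power_mult_distrib mult_left_mono mult.assoc)
    qed
    finally have "\<bar>g x\<bar> \<le> (\<Sum>i\<le>N. \<bar>a i\<bar> * R ^ i) * y ^ (2 * j)" by (simp add: sum_distrib_right)
    moreover have "\<bar>f x\<bar> \<le> C * y ^ (2 * j)"
      using C[of x] C0 one_le_power[OF y, of "2 * j"] mult_left_mono[of 1 "y ^ (2*j)" C] by linarith
    ultimately have "\<bar>f x - g x\<bar> \<le> K * y ^ (2 * j)" by (simp add: K_def algebra_simps)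
    also have "y ^ (2 * j) = (x / R) ^ (2 * j)" by (simp add: y_def power_mult power_divide)
    finally show ?thesis using e by linarith
  qed
  with K show ?thesis using that ag by metis
qed

definition converges_weakly :: "(nat \<Rightarrow> real measure) \<Rightarrow> real measure \<Rightarrow> bool" where
  "converges_weakly \<nu> \<mu> \<longleftrightarrow> (\<forall>f :: real \<Rightarrow> real. continuous_on UNIV f \<longrightarrow> bounded (range f) \<longrightarrow>
     (\<lambda>n. \<integral>x. f x \<partial>\<nu> n) \<longlonglongrightarrow> (\<integral>x. f x \<partial>\<mu>))"

text \<open>The laws \<open>\<nu> n\<close> may have unbounded support. Their mass far out is controlled by a single high moment,
which converges to a moment of \<open>\<mu>\<close> and is therefore small.\<close>

theorem moments_imp_weak_convergence:
  assumes \<nu>: "\<And>n. n > 0 \<Longrightarrow> real_distribution (\<nu> n)" and \<mu>: "real_distribution \<mu>"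
    and supp: "AE x in \<mu>. \<bar>x\<bar> \<le> S"
    and int: "\<And>n k. n > 0 \<Longrightarrow> integrable (\<nu> n) (\<lambda>x. x ^ k)"
    and mom: "\<And>k. (\<lambda>n. \<integral>x. x ^ k \<partial>\<nu> n) \<longlonglongrightarrow> (\<integral>x. x ^ k \<partial>\<mu>)"
  shows "converges_weakly \<nu> \<mu>"
  unfolding converges_weakly_def
proof (intro allI impI LIMSEQ_I)
  fix f :: "real \<Rightarrow> real" and r :: real
  assume f: "continuous_on UNIV f" and bf: "bounded (range f)" and r: "r > 0"
  define e where "e = r / 5"
  have e: "e > 0" using r by (simp add: e_def)
  obtain C where C: "\<And>x. \<bar>f x\<bar> \<le> C" using bf by (auto simp: bounded_iff)
  define R where "R = 2 * max 1 S"
  have R: "R \<ge> 1" by (simp add: R_def)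
  obtain a N K where K: "K \<ge> 0" and
    app: "\<And>j x. j \<ge> N \<Longrightarrow> \<bar>f x - (\<Sum>i\<le>N. a i * x ^ i)\<bar> \<le> e + K * (x / R) ^ (2 * j)"
    by (rule polynomial_approximation_with_growth[OF f C R e]) (rule that)
  have fm[measurable]: "f \<in> borel_measurable borel" using f by (rule borel_measurable_continuous_onI)
  interpret \<mu>: real_distribution \<mu> by fact
  have int\<mu>: "integrable \<mu> (\<lambda>x. x ^ k)" for k
  proof (rule \<mu>.integrable_const_bound[where B = "S ^ k"])
    show "AE x in \<mu>. norm (x ^ k) \<le> S ^ k"
      using supp by eventually_elim (simp add: power_abs power_mono)
  qed simp
  \<comment> \<open>Large enough for \<open>K / 4\<^sup>j < e\<close>, because \<open>K / e \<le> j < 4\<^sup>j\<close>.\<close>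
  define j where "j = N + nat \<lceil>K / e\<rceil>"
  have jN: "j \<ge> N" by (simp add: j_def)
  have Kj: "K * (1/4) ^ j < e"
  proof -
    have "K / e \<le> real j" unfolding j_def by linarith
    also have "real j < 2 ^ j" by (rule of_nat_less_two_power)
    also have "(2 :: real) ^ j \<le> 4 ^ j" by (rule power_mono) auto
    finally show ?thesis using e by (simp add: field_simps power_one_over)
  qed
  define p where "p x = (\<Sum>i\<le>N. a i * x ^ i)" for x
  define q where "q x = K * (x / R) ^ (2 * j)" for x :: real
  \<comment> \<open>The polynomial approximation costs at most \<open>e\<close> plus the tail integral of \<open>q\<close>.\<close>
  have key: "\<bar>(\<integral>x. f x \<partial>\<rho>) - (\<integral>x. p x \<partial>\<rho>)\<bar> \<le> e + (\<integral>x. q x \<partial>\<rho>)"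
    if \<rho>: "real_distribution \<rho>" and int: "\<And>k. integrable \<rho> (\<lambda>x. x ^ k)" for \<rho>
  proof -
    interpret \<rho>: real_distribution \<rho> by fact
    have fi: "integrable \<rho> f" using C by (intro \<rho>.integrable_const_bound[where B = C]) auto
    have pi: "integrable \<rho> p" unfolding p_def using int by auto
    have qi: "integrable \<rho> q" unfolding q_def power_divide using int by auto
    have "\<bar>(\<integral>x. f x \<partial>\<rho>) - (\<integral>x. p x \<partial>\<rho>)\<bar> = \<bar>\<integral>x. f x - p x \<partial>\<rho>\<bar>" using fi pi by simp
    also have "\<dots> \<le> (\<integral>x. \<bar>f x - p x\<bar> \<partial>\<rho>)" using integral_norm_bound[of \<rho> "\<lambda>x. f x - p x"] by simp
    also have "\<dots> \<le> (\<integral>x. e + q x \<partial>\<rho>)"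
    proof (rule integral_mono)
      show "integrable \<rho> (\<lambda>x. \<bar>f x - p x\<bar>)" using fi pi by simp
      show "integrable \<rho> (\<lambda>x. e + q x)" using qi by simp
    qed (use app[OF jN] in \<open>simp add: p_def q_def\<close>)
    also have "\<dots> = e + (\<integral>x. q x \<partial>\<rho>)" using qi by (simp add: \<rho>.prob_space[simplified])
    finally show ?thesis .
  qed
  have p_lim: "(\<lambda>n. \<integral>x. p x \<partial>\<nu> n) \<longlonglongrightarrow> (\<integral>x. p x \<partial>\<mu>)"
  proof -
    have "(\<lambda>n. \<Sum>i\<le>N. a i * (\<integral>x. x ^ i \<partial>\<nu> n)) \<longlonglongrightarrow> (\<Sum>i\<le>N. a i * (\<integral>x. x ^ i \<partial>\<mu>))"
      by (intro tendsto_intros mom)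
    moreover have "(\<Sum>i\<le>N. a i * (\<integral>x. x ^ i \<partial>\<mu>)) = (\<integral>x. p x \<partial>\<mu>)" using int\<mu> by (simp add: p_def)
    moreover have "\<forall>\<^sub>F n in sequentially. (\<Sum>i\<le>N. a i * (\<integral>x. x ^ i \<partial>\<nu> n)) = (\<integral>x. p x \<partial>\<nu> n)"
      using eventually_gt_at_top[of 0] by eventually_elim (simp add: p_def int)
    ultimately show ?thesis by (auto dest: Lim_transform_eventually)
  qed
  have q_lim: "(\<lambda>n. \<integral>x. q x \<partial>\<nu> n) \<longlonglongrightarrow> (\<integral>x. q x \<partial>\<mu>)"
    using tendsto_mult[OF tendsto_const[of "K / R ^ (2 * j)"] mom[of "2 * j"]] by (simp add: q_def power_divide)
  have q\<mu>: "(\<integral>x. q x \<partial>\<mu>) < e"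
  proof -
    have "AE x in \<mu>. q x \<le> K * (1/4) ^ j"
      using supp
    proof eventually_elim
      case (elim x)
      then have "\<bar>x / R\<bar> \<le> 1 / 2" by (auto simp: R_def field_simps)
      then have "\<bar>x / R\<bar> ^ 2 \<le> (1 / 2) ^ 2" by (rule power_mono) simp
      then have "(x / R) ^ 2 \<le> (1 / 2) ^ 2" by (simp only: power2_abs)
      then have "(x / R) ^ 2 \<le> 1 / 4" by (simp add: power_one_over del: power_divide)
      then have "((x / R) ^ 2) ^ j \<le> (1 / 4) ^ j" by (rule power_mono) simp
      then show ?case using K by (simp add: q_def power_mult mult_left_mono)
    qed
    moreover have "integrable \<mu> q" unfolding q_def power_divide using int\<mu> by auto
    ultimately have "(\<integral>x. q x \<partial>\<mu>) \<le> (\<integral>x. K * (1/4) ^ j \<partial>\<mu>)"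
      by (intro integral_mono_AE) auto
    then show ?thesis using Kj by (simp add: \<mu>.prob_space[simplified])
  qed
  have "\<forall>\<^sub>F n in sequentially. \<bar>(\<integral>x. p x \<partial>\<nu> n) - (\<integral>x. p x \<partial>\<mu>)\<bar> < e"
    using tendstoD[OF p_lim e] by (simp add: dist_real_def)
  moreover have "\<forall>\<^sub>F n in sequentially. (\<integral>x. q x \<partial>\<nu> n) < e" using q_lim q\<mu> by (rule order_tendstoD)
  ultimately have "\<forall>\<^sub>F n in sequentially. norm ((\<integral>x. f x \<partial>\<nu> n) - (\<integral>x. f x \<partial>\<mu>)) < r"
    using eventually_gt_at_top[of 0]
  proof eventually_elim
    case (elim n)
    then show ?case
      using key[OF \<nu>[of n] int[of n]] key[OF \<mu> int\<mu>] q\<mu> by (simp add: e_def abs_if split: if_splits)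
  qed
  then show "\<exists>no. \<forall>n\<ge>no. norm ((\<integral>x. f x \<partial>\<nu> n) - (\<integral>x. f x \<partial>\<mu>)) < r"
    by (simp add: eventually_sequentially)
qed

text \<open>The constant sequence \<open>\<nu>\<close> converges weakly to \<open>\<mu>\<close>, so the characteristic functions agree. This
is the uniqueness that the description of the spectral measure relies on.\<close>

corollary moments_determine_compact_distribution:
  assumes \<nu>: "real_distribution \<nu>" and \<mu>: "real_distribution \<mu>" and supp: "AE x in \<mu>. \<bar>x\<bar> \<le> S"
    and int: "\<And>k. integrable \<nu> (\<lambda>x. x ^ k)" and mom: "\<And>k. (\<integral>x. x ^ k \<partial>\<nu>) = (\<integral>x. x ^ k \<partial>\<mu>)"
  shows "\<nu> = \<mu>"
proof (rule Levy_uniqueness[OF \<nu> \<mu>], rule ext)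
  fix t :: real
  interpret \<nu>: real_distribution \<nu> by fact
  interpret \<mu>: real_distribution \<mu> by fact
  have eq: "(\<integral>x. f x \<partial>\<nu>) = (\<integral>x. f x \<partial>\<mu>)" if "continuous_on UNIV f" "bounded (range f)" for f :: "real \<Rightarrow> real"
    using moments_imp_weak_convergence[of "\<lambda>_. \<nu>", OF \<nu> \<mu> supp int] mom that
    by (simp add: converges_weakly_def LIMSEQ_const_iff)
  have "char \<rho> t = Complex (\<integral>x. cos (t * x) \<partial>\<rho>) (\<integral>x. sin (t * x) \<partial>\<rho>)"
    if "real_distribution \<rho>" for \<rho>
  proof -
    interpret \<rho>: real_distribution \<rho> by fact
    have "integrable \<rho> (\<lambda>x. iexp (t * x))" by (intro \<rho>.integrable_const_bound[where B = 1]) auto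
    then show ?thesis unfolding char_def
      by (intro complex_eqI) (simp_all add: Re_exp Im_exp flip: integral_Re integral_Im)
  qed
  moreover have "(\<integral>x. cos (t * x) \<partial>\<nu>) = (\<integral>x. cos (t * x) \<partial>\<mu>)" "(\<integral>x. sin (t * x) \<partial>\<nu>) = (\<integral>x. sin (t * x) \<partial>\<mu>)"
    by (intro eq continuous_intros boundedI[where B = 1], auto)+
  ultimately show "char \<nu> t = char \<mu> t" using \<nu> \<mu> by simp
qed

text \<open>With an orthogonal diagonalisation \<open>A = P D P\<^sup>T\<close>, the spectral measure puts mass \<open>(P 0 l)\<^sup>2\<close> on
the \<open>l\<close>-th eigenvalue.\<close>

lemma spectral_measure_moments:
  fixes A :: "real mat"
  assumes A: "A \<in> carrier_mat n n" "A\<^sup>T = A" and n: "n > 0"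
  shows "real_distribution (spectral_measure A)"
    and "integrable (spectral_measure A) (\<lambda>x. x ^ k)"
    and "(\<integral>x. x ^ k \<partial>spectral_measure A) = (A ^\<^sub>m k) $$ (0, 0)"
proof -
  obtain P d where
    pow: "\<And>k i j. i < n \<Longrightarrow> j < n \<Longrightarrow> (A ^\<^sub>m k) $$ (i, j) = (\<Sum>l<n. P i l * P j l * d l ^ k)"
    by (rule symmetric_real_spectral_decomposition[OF A]) blast
  define w where "w l = (P 0 l)\<^sup>2" for l
  have mom: "(A ^\<^sub>m k) $$ (0, 0) = (\<Sum>l<n. w l * d l ^ k)" for k
    using n by (simp add: pow w_def power2_eq_square)
  define N where "N = point_measure {..<n} (\<lambda>l. ennreal (w l))"
  have "emeasure N (space N) = ennreal (\<Sum>l<n. w l)"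
    unfolding N_def space_point_measure by (subst emeasure_point_measure_finite) (auto simp: w_def sum_ennreal)
  also have "(\<Sum>l<n. w l) = 1" using mom[of 0] A(1) n by (simp add: carrier_matD)
  finally interpret N: prob_space N by (intro prob_spaceI) simp
  define \<mu> where "\<mu> = distr N borel d"
  have dm[measurable]: "d \<in> borel_measurable N" by (simp add: N_def measurable_point_measure_eq1)
  have \<mu>: "real_distribution \<mu>" unfolding \<mu>_def by (rule N.real_distribution_distr) simp
  have supp: "AE x in \<mu>. \<bar>x\<bar> \<le> (\<Sum>l<n. \<bar>d l\<bar>)"
    unfolding \<mu>_def by (subst AE_distr_iff) (auto simp: N_def space_point_measure intro!: AE_I2 member_le_sum)
  have \<mu>_mom: "has_bochner_integral \<mu> (\<lambda>x. x ^ k) ((A ^\<^sub>m k) $$ (0, 0))" for k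
  proof -
    have "has_bochner_integral N (\<lambda>l. d l ^ k) (\<Sum>l<n. w l * d l ^ k)"
      unfolding N_def has_bochner_integral_iff
      by (auto simp: w_def lebesgue_integral_point_measure_finite integrable_point_measure_finite)
    then show ?thesis unfolding \<mu>_def mom by (subst has_bochner_integral_distr) auto
  qed
  have "spectral_measure A = \<mu>"
    unfolding spectral_measure_def
  proof (rule the_equality)
    fix \<nu> :: "real measure"
    assume \<nu>: "real_distribution \<nu> \<and> (\<forall>k. has_bochner_integral \<nu> (\<lambda>x. x ^ k) ((A ^\<^sub>m k) $$ (0, 0)))"
    show "\<nu> = \<mu>"
      using \<nu> \<mu>_mom by (intro moments_determine_compact_distribution[OF _ \<mu> supp])
        (auto simp: has_bochner_integral_iff)
  qed (use \<mu> \<mu>_mom in blast)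
  then show "real_distribution (spectral_measure A)" "integrable (spectral_measure A) (\<lambda>x. x ^ k)"
    "(\<integral>x. x ^ k \<partial>spectral_measure A) = (A ^\<^sub>m k) $$ (0, 0)"
    using \<mu> \<mu>_mom by (auto simp: has_bochner_integral_iff)
qed


lemma jacobi_matrix_carrier [simp]: "jacobi_matrix n a b \<in> carrier_mat n n"
  by (simp add: jacobi_matrix_def)

lemma dim_jacobi_matrix [simp]: "dim_row (jacobi_matrix n a b) = n" "dim_col (jacobi_matrix n a b) = n"
  by (simp_all add: jacobi_matrix_def)

lemma jacobi_matrix_symmetric: "(jacobi_matrix n a b)\<^sup>T = jacobi_matrix n a b"
  by (rule eq_matI) (auto simp: jacobi_matrix_def)

lemma jacobi_matrix_pow_Suc:
  assumes "l < n" "i < n"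
  shows "(jacobi_matrix n a b ^\<^sub>m Suc k) $$ (l, i) =
      a (i + 1) * (jacobi_matrix n a b ^\<^sub>m k) $$ (l, i)
    + (if i + 1 < n then b (i + 1) * (jacobi_matrix n a b ^\<^sub>m k) $$ (l, i + 1) else 0)
    + (if i > 0 then b i * (jacobi_matrix n a b ^\<^sub>m k) $$ (l, i - 1) else 0)"
proof -
  let ?J = "jacobi_matrix n a b"
  define f where "f m = (?J ^\<^sub>m k) $$ (l, m)" for m
  have c: "?J ^\<^sub>m k \<in> carrier_mat n n" by simp
  have "(?J ^\<^sub>m Suc k) $$ (l, i) = (\<Sum>m<n. f m * ?J $$ (m, i))"
    using assms carrier_matD[OF c] by (simp add: scalar_prod_def lessThan_atLeast0 f_def)
  also have "\<dots> = (\<Sum>m<n. (if m = i then a (i + 1) * f i else 0)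
      + (if m = i + 1 then b (i + 1) * f (i + 1) else 0)
      + (if i > 0 \<and> m = i - 1 then b i * f (i - 1) else 0))"
    using assms by (intro sum.cong) (auto simp: jacobi_matrix_def)
  also have "\<dots> = a (i + 1) * f i + (if i + 1 < n then b (i + 1) * f (i + 1) else 0)
      + (if i > 0 then b i * f (i - 1) else 0)"
    using assms by (cases "i = 0") (simp_all add: sum.distrib)
  finally show ?thesis by (simp add: f_def)
qed

text \<open>There are at most three steps to choose from at each stage of a path.\<close>

lemma jacobi_matrix_pow_bound:
  assumes K: "\<And>i. i \<in> {1..n} \<Longrightarrow> \<bar>a i\<bar> \<le> K" "\<And>i. i \<in> {1..<n} \<Longrightarrow> \<bar>b i\<bar> \<le> K"
    and "l < n" "i < n"
  shows "\<bar>(jacobi_matrix n a b ^\<^sub>m k) $$ (l, i)\<bar> \<le> (3 * K) ^ k"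
  using assms(4)
proof (induction k arbitrary: i)
  case 0
  then show ?case using \<open>l < n\<close> by (simp add: carrier_matD[OF jacobi_matrix_carrier])
next
  case (Suc k)
  have K0: "K \<ge> 0" using K(1)[of 1] Suc.prems by auto
  have step: "\<bar>c * (jacobi_matrix n a b ^\<^sub>m k) $$ (l, j)\<bar> \<le> K * (3 * K) ^ k"
    if "\<bar>c\<bar> \<le> K" "j < n" for c j
    using that Suc.IH[of j] K0 by (simp add: abs_mult mult_mono)
  have pos: "0 \<le> K * (3 * K) ^ k" using K0 by simp
  have "\<bar>a (i + 1) * (jacobi_matrix n a b ^\<^sub>m k) $$ (l, i)\<bar> \<le> K * (3 * K) ^ k"
    using K(1)[of "i + 1"] Suc.prems by (intro step) auto
  moreover have "\<bar>if i + 1 < n then b (i + 1) * (jacobi_matrix n a b ^\<^sub>m k) $$ (l, i + 1) else 0\<bar> \<le> K * (3 * K) ^ k"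
    using step[OF K(2)[of "i + 1"]] pos by auto
  moreover have "\<bar>if i > 0 then b i * (jacobi_matrix n a b ^\<^sub>m k) $$ (l, i - 1) else 0\<bar> \<le> K * (3 * K) ^ k"
    using step[OF K(2)[of i], of "i - 1"] pos Suc.prems by auto
  ultimately show ?case
    unfolding jacobi_matrix_pow_Suc[OF \<open>l < n\<close> Suc.prems] power_Suc by linarith
qed

text \<open>The infinite Jacobi matrix with rows counted from 0, so that row \<open>i\<close> has diagonal coefficient
\<open>a (i + 1)\<close>. Each row has finitely many entries, hence it acts on arbitrary sequences.\<close>

definition half_line_jacobi :: "(nat \<Rightarrow> real) \<Rightarrow> (nat \<Rightarrow> real) \<Rightarrow> (nat \<Rightarrow> real) \<Rightarrow> nat \<Rightarrow> real" where
  "half_line_jacobi a b f i =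
     a (i + 1) * f i + b (i + 1) * f (i + 1) + (if i > 0 then b i * f (i - 1) else 0)"

definition unit_seq :: "nat \<Rightarrow> real" where
  "unit_seq i = (if i = 0 then 1 else 0)"

text \<open>The entry \<open>(0, i)\<close> of the \<open>k\<close>-th power depends on the first \<open>i + k\<close> rows only.\<close>

lemma jacobi_pow_edge_limit:
  assumes a: "\<And>i. i \<ge> 1 \<Longrightarrow> (\<lambda>n. a n i) \<longlonglongrightarrow> \<alpha> i" and b: "\<And>i. i \<ge> 1 \<Longrightarrow> (\<lambda>n. b n i) \<longlonglongrightarrow> \<beta> i"
  shows "(\<lambda>n. (jacobi_matrix n (a n) (b n) ^\<^sub>m k) $$ (0, i)) \<longlonglongrightarrow> (half_line_jacobi \<alpha> \<beta> ^^ k) unit_seq i"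
proof (induction k arbitrary: i)
  case 0
  have "\<forall>\<^sub>F n in sequentially. (jacobi_matrix n (a n) (b n) ^\<^sub>m 0) $$ (0, i) = unit_seq i"
    using eventually_gt_at_top[of i]
    by eventually_elim (auto simp: unit_seq_def carrier_matD[OF jacobi_matrix_carrier])
  then show ?case by (simp add: tendsto_eventually)
next
  case (Suc k)
  define f where "f = (half_line_jacobi \<alpha> \<beta> ^^ k) unit_seq"
  let ?E = "\<lambda>n i. (jacobi_matrix n (a n) (b n) ^\<^sub>m k) $$ (0, i)"
  have "(\<lambda>n. a n (i + 1) * ?E n i + b n (i + 1) * ?E n (i + 1) + (if i > 0 then b n i * ?E n (i - 1) else 0))
      \<longlonglongrightarrow> half_line_jacobi \<alpha> \<beta> f i"
    unfolding half_line_jacobi_def using Suc.IH[folded f_def] a b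
    by (cases "i > 0") (auto intro!: tendsto_intros)
  moreover have "\<forall>\<^sub>F n in sequentially. a n (i + 1) * ?E n i + b n (i + 1) * ?E n (i + 1)
      + (if i > 0 then b n i * ?E n (i - 1) else 0) = (jacobi_matrix n (a n) (b n) ^\<^sub>m Suc k) $$ (0, i)"
    using eventually_gt_at_top[of "i + 1"]
    by eventually_elim (subst jacobi_matrix_pow_Suc, auto)
  ultimately show ?case by (auto simp: f_def dest: Lim_transform_eventually)
qed

section \<open>Interior rows: averages of arcsine laws\<close>

text \<open>The angle \<open>\<theta>\<close> in \<open>x = A + 2 B cos \<theta>\<close>. The interval \<open>[-\<pi>, 0]\<close> is taken because the map is
increasing there, as substitution in the integral requires.\<close>

definition phase :: "real measure" where
  "phase = uniform_measure lborel {-pi..0}"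

text \<open>The relative position \<open>t = i / n\<close> of a uniformly chosen row.\<close>

definition position :: "real measure" where
  "position = uniform_measure lborel {0<..<1}"

lemma sets_phase [simp, measurable_cong]: "sets phase = sets borel"
  and space_phase [simp]: "space phase = UNIV"
  and sets_position [simp, measurable_cong]: "sets position = sets borel"
  and space_position [simp]: "space position = UNIV"
  by (simp_all add: phase_def position_def)

lemma measurable_phase [simp]: "measurable phase N = measurable borel N"
  and measurable_position [simp]: "measurable position N = measurable borel N"
  by (simp_all cong: measurable_cong_sets)

lemma prob_space_phase: "prob_space phase"
  unfolding phase_def by (rule prob_space_uniform_measure) auto

lemma prob_space_position: "prob_space position"
  unfolding position_def by (rule prob_space_uniform_measure) auto

interpretation phase: prob_space phase by (rule prob_space_phase)
interpretation position: prob_space position by (rule prob_space_position)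

lemma integral_uniform_interval:
  fixes f :: "real \<Rightarrow> real"
  assumes S: "S \<in> sets borel" "measure lborel S > 0" "emeasure lborel S < \<infinity>" and [measurable]: "f \<in> borel_measurable borel"
  shows "(\<integral>x. f x \<partial>uniform_measure lborel S) = (\<integral>x. indicator S x * f x \<partial>lborel) / measure lborel S"
proof -
  have e: "emeasure lborel S = ennreal (measure lborel S)" using S by (simp add: emeasure_eq_ennreal_measure)
  have "uniform_measure lborel S = density lborel (\<lambda>x. ennreal (indicator S x / measure lborel S))"
    unfolding uniform_measure_def e
    using S by (intro density_cong) (auto simp: divide_ennreal[symmetric] indicator_def)
  then have "(\<integral>x. f x \<partial>uniform_measure lborel S) = (\<integral>x. (indicator S x / measure lborel S) * f x \<partial>lborel)"
    using S by (simp add: integral_density)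
  also have "\<dots> = (\<integral>x. (indicator S x * f x) / measure lborel S \<partial>lborel)" by simp
  also have "\<dots> = (\<integral>x. indicator S x * f x \<partial>lborel) / measure lborel S"
    by (rule integral_divide_zero)
  finally show ?thesis .
qed

lemma integrable_phase:
  fixes f :: "real \<Rightarrow> real"
  assumes "continuous_on UNIV f"
  shows "integrable phase f"
proof -
  have "compact (f ` {-pi..0})" using assms continuous_on_subset by (intro compact_continuous_image) auto
  then obtain B where "\<forall>y\<in>f ` {-pi..0}. \<bar>y\<bar> \<le> B"
    by (auto simp: bounded_iff simp del: ball_simps dest!: compact_imp_bounded)
  then have B: "\<And>x. x \<in> {-pi..0} \<Longrightarrow> \<bar>f x\<bar> \<le> B" by blast
  show ?thesis
  proof (rule phase.integrable_const_bound[where B = B])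
    show "AE x in phase. norm (f x) \<le> B"
      unfolding phase_def by (rule AE_uniform_measureI) (use B in auto)
  qed (use assms in \<open>auto intro: borel_measurable_continuous_onI\<close>)
qed

lemma integral_phase_cos:
  "(\<integral>\<theta>. cos (of_int j * \<theta>) \<partial>phase) = (if j = 0 then 1 else 0)"
proof (cases "j = 0")
  case True
  then show ?thesis by (simp add: phase.prob_space[simplified])
next
  case False
  have "(\<integral>\<theta>. cos (of_int j * \<theta>) * indicator {-pi..0} \<theta> \<partial>lborel) =
      sin (of_int j * 0) / of_int j - sin (of_int j * (-pi)) / of_int j"
    by (rule integral_FTC_Icc_real)
       (use False in \<open>auto intro!: derivative_eq_intros\<close>)
  also have "\<dots> = 0" using sin_int_times_real[of j] by (simp add: mult.commute sin_integer_2pi)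
  finally show ?thesis
    using False unfolding phase_def by (subst integral_uniform_interval) (auto simp: mult.commute)
qed

text \<open>The entry \<open>(0, j)\<close> of the \<open>k\<close>-th power of the Jacobi matrix on the integers with constant
coefficients \<open>A\<close> and \<open>B\<close>, written as a Fourier coefficient.\<close>

definition bulk_moment :: "real \<Rightarrow> real \<Rightarrow> nat \<Rightarrow> int \<Rightarrow> real" where
  "bulk_moment A B k j = (\<integral>\<theta>. (A + 2 * B * cos \<theta>) ^ k * cos (of_int j * \<theta>) \<partial>phase)"

lemma bulk_moment_0: "bulk_moment A B 0 j = (if j = 0 then 1 else 0)"
  by (simp add: bulk_moment_def integral_phase_cos)

text \<open>This is \<open>2 cos \<theta> cos (j \<theta>) = cos ((j + 1) \<theta>) + cos ((j - 1) \<theta>)\<close>.\<close>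

lemma bulk_moment_Suc:
  "bulk_moment A B (Suc k) j =
     A * bulk_moment A B k j + B * bulk_moment A B k (j + 1) + B * bulk_moment A B k (j - 1)"
proof -
  have *: "2 * cos \<theta> * cos (of_int j * \<theta>) = cos (of_int (j + 1) * \<theta>) + cos (of_int (j - 1) * \<theta>)" for \<theta> :: real
    by (simp add: algebra_simps cos_add cos_diff)
  have "(A + 2 * B * cos \<theta>) ^ Suc k * cos (of_int j * \<theta>) =
      A * ((A + 2 * B * cos \<theta>) ^ k * cos (of_int j * \<theta>))
      + B * ((A + 2 * B * cos \<theta>) ^ k * cos (of_int (j + 1) * \<theta>))
      + B * ((A + 2 * B * cos \<theta>) ^ k * cos (of_int (j - 1) * \<theta>))" for \<theta>
  proof -
    have "(A + 2 * B * cos \<theta>) ^ Suc k * cos (of_int j * \<theta>) =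
      (A + 2 * B * cos \<theta>) ^ k * (A * cos (of_int j * \<theta>) + B * (2 * cos \<theta> * cos (of_int j * \<theta>)))"
      by (simp add: algebra_simps)
    then show ?thesis unfolding * by (simp add: algebra_simps)
  qed
  moreover have "integrable phase (\<lambda>\<theta>. c * ((A + 2 * B * cos \<theta>) ^ k * cos (of_int i * \<theta>)))" for c and i :: int
    by (intro integrable_phase continuous_intros)
  ultimately show ?thesis
    unfolding bulk_moment_def by (simp only: Bochner_Integration.integral_add integral_mult_right_zero Bochner_Integration.integrable_add)
qed

text \<open>Quantifying over all index sequences with \<open>i n / n \<longlonglongrightarrow> t\<close> makes the property invariant under
bounded shifts of the index. The end points \<open>t = 0\<close> and \<open>t = 1\<close> are left out: the coefficients may
behave differently there, and this does not change averages over \<open>t\<close>.\<close>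

definition follows_profile :: "(nat \<Rightarrow> nat \<Rightarrow> real) \<Rightarrow> (real \<Rightarrow> real) \<Rightarrow> bool" where
  "follows_profile x X \<longleftrightarrow> (\<forall>t\<in>{0<..<1}. \<forall>i. (\<lambda>n. real (i n) / real n) \<longlonglongrightarrow> t \<longrightarrow> (\<lambda>n. x n (i n)) \<longlonglongrightarrow> X t)"

lemma follows_profileD:
  "follows_profile x X \<Longrightarrow> 0 < t \<Longrightarrow> t < 1 \<Longrightarrow> (\<lambda>n. real (i n) / real n) \<longlonglongrightarrow> t \<Longrightarrow> (\<lambda>n. x n (i n)) \<longlonglongrightarrow> X t"
  by (auto simp: follows_profile_def)

lemma floor_ratio_limit: "t \<ge> 0 \<Longrightarrow> (\<lambda>n. real (nat \<lfloor>t * real n\<rfloor>) / real n) \<longlonglongrightarrow> t"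
proof (rule real_tendsto_sandwich)
  assume t: "t \<ge> 0"
  have "t * real n - 1 \<le> real (nat \<lfloor>t * real n\<rfloor>)" "real (nat \<lfloor>t * real n\<rfloor>) \<le> t * real n" for n
    using t by (auto simp: of_nat_nat)
  then have "(t * real n - 1) / real n \<le> real (nat \<lfloor>t * real n\<rfloor>) / real n"
    "real (nat \<lfloor>t * real n\<rfloor>) / real n \<le> t * real n / real n" for n
    by (cases "n = 0"; auto intro: divide_right_mono simp: divide_le_eq)+
  then show "\<forall>\<^sub>F n in sequentially. (t * real n - 1) / real n \<le> real (nat \<lfloor>t * real n\<rfloor>) / real n"
    "\<forall>\<^sub>F n in sequentially. real (nat \<lfloor>t * real n\<rfloor>) / real n \<le> t * real n / real n" by auto
  show "(\<lambda>n. (t * real n - 1) / real n) \<longlonglongrightarrow> t" "(\<lambda>n. t * real n / real n) \<longlonglongrightarrow> t"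
    by real_asymp+
qed

lemma shifted_ratio:
  assumes l: "(\<lambda>n. real (l n) / real n) \<longlonglongrightarrow> t" and t: "0 < t" "t < 1"
  shows "(\<lambda>n. real (nat (int (l n) + j)) / real n) \<longlonglongrightarrow> t"
    and "\<forall>\<^sub>F n in sequentially. 0 < int (l n) + j \<and> int (l n) + j < int n"
proof -
  have "(\<lambda>n. real_of_int j / real n) \<longlonglongrightarrow> 0" by real_asymp
  from tendsto_add[OF l this] have lim: "(\<lambda>n. real_of_int (int (l n) + j) / real n) \<longlonglongrightarrow> t"
    by (simp add: add_divide_distrib)
  show ev: "\<forall>\<^sub>F n in sequentially. 0 < int (l n) + j \<and> int (l n) + j < int n"
    using order_tendstoD(1)[OF lim t(1)] order_tendstoD(2)[OF lim t(2)] eventually_gt_at_top[of 0]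
  proof eventually_elim
    case (elim n)
    then have "0 < real_of_int (int (l n) + j)" "real_of_int (int (l n) + j) < real_of_int (int n)"
      by (auto simp: zero_less_divide_iff divide_less_eq)
    then show ?case by linarith
  qed
  show "(\<lambda>n. real (nat (int (l n) + j)) / real n) \<longlonglongrightarrow> t"
    by (rule Lim_transform_eventually[OF lim]) (use ev in \<open>eventually_elim, auto simp: of_nat_nat\<close>)
qed

lemma jacobi_pow_bulk_limit:
  assumes a: "follows_profile a A" and b: "follows_profile b B"
    and l: "(\<lambda>n. real (l n) / real n) \<longlonglongrightarrow> t" and t: "0 < t" "t < 1"
  shows "(\<lambda>n. (jacobi_matrix n (a n) (b n) ^\<^sub>m k) $$ (l n, nat (int (l n) + j))) \<longlonglongrightarrow> bulk_moment (A t) (B t) k j"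
proof (induction k arbitrary: j)
  case 0
  have "\<forall>\<^sub>F n in sequentially. (jacobi_matrix n (a n) (b n) ^\<^sub>m 0) $$ (l n, nat (int (l n) + j)) = (if j = 0 then 1 else 0)"
    using shifted_ratio(2)[OF l t, of j] shifted_ratio(2)[OF l t, of 0] by eventually_elim auto
  then show ?case unfolding bulk_moment_0 by (rule tendsto_eventually)
next
  case (Suc k)
  let ?E = "\<lambda>n j. (jacobi_matrix n (a n) (b n) ^\<^sub>m k) $$ (l n, nat (int (l n) + j))"
  have "(\<lambda>n. a n (nat (int (l n) + (j + 1))) * ?E n j + b n (nat (int (l n) + (j + 1))) * ?E n (j + 1)
      + b n (nat (int (l n) + j)) * ?E n (j - 1)) \<longlonglongrightarrow> bulk_moment (A t) (B t) (Suc k) j"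
    unfolding bulk_moment_Suc
    by (intro tendsto_intros Suc.IH follows_profileD[OF a t] follows_profileD[OF b t] shifted_ratio(1)[OF l t])
  moreover have "\<forall>\<^sub>F n in sequentially. a n (nat (int (l n) + (j + 1))) * ?E n j
      + b n (nat (int (l n) + (j + 1))) * ?E n (j + 1) + b n (nat (int (l n) + j)) * ?E n (j - 1)
      = (jacobi_matrix n (a n) (b n) ^\<^sub>m Suc k) $$ (l n, nat (int (l n) + j))"
    using shifted_ratio(2)[OF l t, of j] shifted_ratio(2)[OF l t, of "j + 1"] shifted_ratio(2)[OF l t, of 0]
  proof eventually_elim
    case (elim n)
    define i where "i = nat (int (l n) + j)"
    have i: "nat (int (l n) + (j + 1)) = i + 1" "nat (int (l n) + (j - 1)) = i - 1" "i > 0" "i + 1 < n" "l n < n"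
      using elim by (auto simp: i_def)
    show ?case
      unfolding i(1,2) i_def[symmetric] using i(3-5) by (subst jacobi_matrix_pow_Suc) auto
  qed
  ultimately show ?case by (rule Lim_transform_eventually)
qed

text \<open>Written as an integral over \<open>t\<close>, the average over all rows is open to dominated convergence.\<close>

lemma average_eq_integral_position:
  assumes n: "n > 0"
  shows "(\<Sum>i<n. F i) / real n = (\<integral>t. F (nat \<lfloor>t * real n\<rfloor>) \<partial>position)"
proof -
  define I where "I i = {real i / real n..<(real i + 1) / real n}" for i
  have ind: "F (nat \<lfloor>t * real n\<rfloor>) = (\<Sum>i<n. F i * indicator (I i) t)" if t: "0 < t" "t < 1" for t
  proof -
    define m where "m = nat \<lfloor>t * real n\<rfloor>"
    have "t * real n < real n" using t n by simp
    then have m: "m < n" "real m \<le> t * real n" "t * real n < real m + 1"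
      using t n unfolding m_def by (auto simp: nat_less_iff floor_less_iff of_nat_nat)
    have "indicator (I i) t = (if i = m then 1 else 0 :: real)" if "i < n" for i
    proof -
      have "t \<in> I i \<longleftrightarrow> real i \<le> t * real n \<and> t * real n < real i + 1"
        using n by (simp add: I_def field_simps)
      also have "\<dots> \<longleftrightarrow> i = m" using m by auto
      finally show ?thesis by (simp add: indicator_def)
    qed
    then have "(\<Sum>i<n. F i * indicator (I i) t) = (\<Sum>i<n. if i = m then F m else 0)"
      by (intro sum.cong) auto
    then show ?thesis using m by (simp add: m_def)
  qed
  have meas: "measure position (I i) = 1 / real n" if "i < n" for i
  proof -
    have "I i \<subseteq> {0..<1}" using n that by (auto simp: I_def field_simps intro: order_trans[of _ "real i"])
    then have "{0<..<1} \<inter> I i = I i - {0}" by auto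
    moreover have "measure lborel (I i - {0}) = measure lborel (I i)"
      by (rule measure_Diff_null_set) (auto simp: I_def)
    ultimately show ?thesis
      unfolding position_def using n by (simp add: I_def field_simps)
  qed
  have "(\<integral>t. F (nat \<lfloor>t * real n\<rfloor>) \<partial>position) = (\<integral>t. (\<Sum>i<n. F i * indicator (I i) t) \<partial>position)"
  proof (rule integral_cong_AE)
    show "AE t in position. F (nat \<lfloor>t * real n\<rfloor>) = (\<Sum>i<n. F i * indicator (I i) t)"
      unfolding position_def by (rule AE_uniform_measureI) (use ind in auto)
    have [measurable]: "I i \<in> sets borel" for i by (simp add: I_def)
    show "(\<lambda>t. \<Sum>i<n. F i * indicator (I i) t) \<in> borel_measurable position"
      unfolding measurable_position by measurable
  qed simp
  also have "\<dots> = (\<Sum>i<n. F i * measure position (I i))"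
    by (subst Bochner_Integration.integral_sum) (auto simp: I_def less_top[symmetric])
  also have "\<dots> = (\<Sum>i<n. F i) / real n" by (simp add: meas sum_divide_distrib)
  finally show ?thesis by simp
qed

lemma trace_average_limit:
  assumes a: "follows_profile a A" and b: "follows_profile b B"
    and K: "\<forall>\<^sub>F n in sequentially. (\<forall>i\<in>{1..n}. \<bar>a n i\<bar> \<le> K) \<and> (\<forall>i\<in>{1..<n}. \<bar>b n i\<bar> \<le> K)"
    and meas: "(\<lambda>t. bulk_moment (A t) (B t) k 0) \<in> borel_measurable borel"
  shows "(\<lambda>n. (\<Sum>i<n. (jacobi_matrix n (a n) (b n) ^\<^sub>m k) $$ (i, i)) / real n)
     \<longlonglongrightarrow> (\<integral>t. bulk_moment (A t) (B t) k 0 \<partial>position)"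
proof -
  obtain N where N: "\<And>n i. n \<ge> N \<Longrightarrow> i \<in> {1..n} \<Longrightarrow> \<bar>a n i\<bar> \<le> K" "\<And>n i. n \<ge> N \<Longrightarrow> i \<in> {1..<n} \<Longrightarrow> \<bar>b n i\<bar> \<le> K"
    using K unfolding eventually_sequentially by blast
  define F where "F n i = (jacobi_matrix n (a n) (b n) ^\<^sub>m k) $$ (i, i)" for n i
  \<comment> \<open>The shift by \<open>M\<close> discards the sizes for which the bound \<open>K\<close> may fail.\<close>
  define M where "M = N + 1"
  have "(\<lambda>n. \<integral>t. F (n + M) (nat \<lfloor>t * real (n + M)\<rfloor>) \<partial>position) \<longlonglongrightarrow> (\<integral>t. bulk_moment (A t) (B t) k 0 \<partial>position)"
  proof (rule integral_dominated_convergence[where w = "\<lambda>_. (3 * K) ^ k"])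
    show "AE t in position. (\<lambda>n. F (n + M) (nat \<lfloor>t * real (n + M)\<rfloor>)) \<longlonglongrightarrow> bulk_moment (A t) (B t) k 0"
      unfolding position_def
    proof (rule AE_uniform_measureI, simp, rule AE_I2, rule impI)
      fix t :: real assume t: "t \<in> {0<..<1}"
      show "(\<lambda>n. F (n + M) (nat \<lfloor>t * real (n + M)\<rfloor>)) \<longlonglongrightarrow> bulk_moment (A t) (B t) k 0"
        using LIMSEQ_ignore_initial_segment[OF jacobi_pow_bulk_limit[OF a b floor_ratio_limit, of t k 0], of M] t
        by (simp add: F_def)
    qed
    show "AE t in position. norm (F (n + M) (nat \<lfloor>t * real (n + M)\<rfloor>)) \<le> (3 * K) ^ k" for n
      unfolding position_def
    proof (rule AE_uniform_measureI, simp, rule AE_I2, rule impI)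
      fix t :: real assume t: "t \<in> {0<..<1}"
      have "t * real (n + M) < 1 * real (n + M)" using t by (intro mult_strict_right_mono) (auto simp: M_def)
      then have "nat \<lfloor>t * real (n + M)\<rfloor> < n + M"
        using t by (simp add: nat_less_iff floor_less_iff)
      then show "norm (F (n + M) (nat \<lfloor>t * real (n + M)\<rfloor>)) \<le> (3 * K) ^ k"
        unfolding F_def real_norm_def by (intro jacobi_matrix_pow_bound N) (auto simp: M_def)
    qed
  qed (use meas in \<open>auto\<close>)
  then have "(\<lambda>n. (\<Sum>i<n + M. F (n + M) i) / real (n + M)) \<longlonglongrightarrow> (\<integral>t. bulk_moment (A t) (B t) k 0 \<partial>position)"
    by (subst average_eq_integral_position) (auto simp: M_def)
  then show ?thesis
    unfolding F_def by (rule LIMSEQ_offset)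
qed

section \<open>Arcsine mixtures as densities\<close>

text \<open>The density of \<open>A + 2 B cos \<theta>\<close> for a uniform angle \<open>\<theta>\<close>.\<close>

definition arcsine_density :: "real \<Rightarrow> real \<Rightarrow> real \<Rightarrow> real" where
  "arcsine_density A B x =
     (if 4 * B\<^sup>2 - (x - A)\<^sup>2 > 0 then 1 / (pi * sqrt (4 * B\<^sup>2 - (x - A)\<^sup>2)) else 0)"

lemma arcsine_density_nonneg: "arcsine_density A B x \<ge> 0"
  by (simp add: arcsine_density_def)

lemma arcsine_density_measurable [measurable]:
  assumes [measurable]: "A \<in> borel_measurable M" "B \<in> borel_measurable M" "h \<in> borel_measurable M"
  shows "(\<lambda>x. arcsine_density (A x) (B x) (h x)) \<in> borel_measurable M"
  unfolding arcsine_density_def by measurable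

lemma nn_integral_phase:
  assumes B: "B > 0" and [measurable]: "g \<in> borel_measurable borel"
  shows "(\<integral>\<^sup>+\<theta>. g (A + 2 * B * cos \<theta>) \<partial>phase) = (\<integral>\<^sup>+x. g x * ennreal (arcsine_density A B x) \<partial>lborel)"
proof -
  define h where "h \<theta> = A + 2 * B * cos \<theta>" for \<theta>
  define f where "f x = g x * ennreal (arcsine_density A B x)" for x
  have [measurable]: "f \<in> borel_measurable borel" unfolding f_def by measurable
  have sin_np: "sin \<theta> \<le> 0" if "-pi \<le> \<theta>" "\<theta> \<le> 0" for \<theta> :: real
    using sin_ge_zero[of "-\<theta>"] that by simp
  have "(\<integral>\<^sup>+x. f x \<partial>lborel) = (\<integral>\<^sup>+x. f x * indicator {h (-pi)..h 0} x \<partial>lborel)"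
  proof (rule nn_integral_cong)
    fix x :: real
    show "f x = f x * indicator {h (-pi)..h 0} x"
    proof (cases "4 * B\<^sup>2 - (x - A)\<^sup>2 > 0")
      case True
      then have "\<bar>x - A\<bar>\<^sup>2 < (2 * B)\<^sup>2" by (simp add: power_mult_distrib)
      then have "\<bar>x - A\<bar> < 2 * B" by (rule power2_less_imp_less) (use B in simp)
      then show ?thesis by (simp add: h_def abs_less_iff)
    qed (simp add: f_def arcsine_density_def)
  qed
  also have "\<dots> = (\<integral>\<^sup>+\<theta>. f (h \<theta>) * ennreal (- 2 * B * sin \<theta>) * indicator {-pi..0} \<theta> \<partial>lborel)"
    by (rule nn_integral_substitution_aux)
       (use B in \<open>auto simp: h_def intro!: derivative_eq_intros continuous_intros mult_nonneg_nonpos sin_np\<close>)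
  also have "\<dots> = (\<integral>\<^sup>+\<theta>. g (h \<theta>) * indicator {-pi..0} \<theta> * ennreal (1 / pi) \<partial>lborel)"
  proof (rule nn_integral_cong_AE)
    have "AE \<theta> in lborel. \<theta> \<noteq> -pi \<and> \<theta> \<noteq> (0 :: real)" using AE_lborel_singleton by auto
    then show "AE \<theta> in lborel. f (h \<theta>) * ennreal (- 2 * B * sin \<theta>) * indicator {-pi..0} \<theta>
        = g (h \<theta>) * indicator {-pi..0} \<theta> * ennreal (1 / pi)"
    proof eventually_elim
      case (elim \<theta>)
      show ?case
      proof (cases "\<theta> \<in> {-pi..0}")
        case True
        then have "sin (-\<theta>) > 0" using elim by (intro sin_gt_zero) auto
        then have s: "sin \<theta> < 0" by simp
        have R: "4 * B\<^sup>2 - (h \<theta> - A)\<^sup>2 = (- 2 * B * sin \<theta>)\<^sup>2"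
          by (simp add: h_def power_mult_distrib sin_squared_eq algebra_simps)
        define r where "r = - 2 * B * sin \<theta>"
        have r: "r > 0" using s B by (simp add: r_def mult_pos_neg)
        then have "arcsine_density A B (h \<theta>) = 1 / (pi * r)"
          unfolding arcsine_density_def R r_def[symmetric] by simp
        then have "ennreal (arcsine_density A B (h \<theta>)) * ennreal r = ennreal (1 / pi)"
          using r by (subst ennreal_mult'[symmetric]) auto
        then show ?thesis using True unfolding r_def by (simp add: f_def mult.assoc)
      qed simp
    qed
  qed
  also have "\<dots> = (\<integral>\<^sup>+\<theta>. g (h \<theta>) * indicator {-pi..0} \<theta> \<partial>lborel) * ennreal (1 / pi)"
    by (rule nn_integral_multc) (simp add: h_def)
  also have "\<dots> = (\<integral>\<^sup>+\<theta>. g (h \<theta>) \<partial>phase)"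
    unfolding phase_def
    by (subst nn_integral_uniform_measure)
       (auto simp: h_def divide_ennreal_def inverse_ennreal inverse_eq_divide)
  finally show ?thesis by (simp add: f_def h_def)
qed

definition arcsine_mixture :: "(real \<Rightarrow> real) \<Rightarrow> (real \<Rightarrow> real) \<Rightarrow> real measure" where
  "arcsine_mixture A B = distr (position \<Otimes>\<^sub>M phase) borel (\<lambda>(t, \<theta>). A t + 2 * B t * cos \<theta>)"

text \<open>Tonelli: the density of a mixture is the average of the densities.\<close>

lemma density_eq_arcsine_mixture:
  assumes [measurable]: "A \<in> borel_measurable borel" "B \<in> borel_measurable borel"
    and B: "\<And>t. 0 < t \<Longrightarrow> t < 1 \<Longrightarrow> B t > 0"
    and [measurable]: "f \<in> borel_measurable borel"
    and eq: "\<And>x. (\<integral>\<^sup>+t. ennreal (arcsine_density (A t) (B t) x) * indicator {0<..<1} t \<partial>lborel) = ennreal (f x)"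
  shows "density lborel (\<lambda>x. ennreal (f x)) = arcsine_mixture A B"
proof (rule measure_eqI)
  interpret pair_sigma_finite position phase ..
  fix X :: "real set" assume "X \<in> sets (density lborel (\<lambda>x. ennreal (f x)))"
  then have [measurable]: "X \<in> sets borel" by simp
  have "emeasure (arcsine_mixture A B) X = (\<integral>\<^sup>+p. indicator X (case p of (t, \<theta>) \<Rightarrow> A t + 2 * B t * cos \<theta>) \<partial>(position \<Otimes>\<^sub>M phase))"
  proof -
    have "(\<integral>\<^sup>+x. indicator X x \<partial>arcsine_mixture A B)
        = (\<integral>\<^sup>+p. indicator X (case p of (t, \<theta>) \<Rightarrow> A t + 2 * B t * cos \<theta>) \<partial>(position \<Otimes>\<^sub>M phase))"
      unfolding arcsine_mixture_def by (rule nn_integral_distr) measurable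
    then show ?thesis by (simp add: arcsine_mixture_def)
  qed
  also have "\<dots> = (\<integral>\<^sup>+t. (\<integral>\<^sup>+\<theta>. indicator X (A t + 2 * B t * cos \<theta>) \<partial>phase) \<partial>position)"
    by (subst phase.nn_integral_fst[symmetric]) auto
  also have "\<dots> = (\<integral>\<^sup>+t. (\<integral>\<^sup>+\<theta>. indicator X (A t + 2 * B t * cos \<theta>) \<partial>phase) * indicator {0<..<1} t \<partial>lborel)"
    unfolding position_def by (subst nn_integral_uniform_measure) (auto simp: divide_ennreal_def)
  also have "\<dots> = (\<integral>\<^sup>+t. (\<integral>\<^sup>+x. indicator X x * ennreal (arcsine_density (A t) (B t) x) * indicator {0<..<1} t \<partial>lborel) \<partial>lborel)"
  proof (rule nn_integral_cong)
    fix t :: real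
    show "(\<integral>\<^sup>+\<theta>. indicator X (A t + 2 * B t * cos \<theta>) \<partial>phase) * indicator {0<..<1} t
        = (\<integral>\<^sup>+x. indicator X x * ennreal (arcsine_density (A t) (B t) x) * indicator {0<..<1} t \<partial>lborel)"
      using nn_integral_phase[OF B, of t "indicator X" "A t"] by (cases "t \<in> {0<..<1}") simp_all
  qed
  also have "\<dots> = (\<integral>\<^sup>+x. (\<integral>\<^sup>+t. indicator X x * ennreal (arcsine_density (A t) (B t) x) * indicator {0<..<1} t \<partial>lborel) \<partial>lborel)"
    by (rule lborel_pair.Fubini') measurable
  also have "\<dots> = (\<integral>\<^sup>+x. indicator X x * ennreal (f x) \<partial>lborel)"
    by (simp add: mult.assoc nn_integral_cmult eq)
  also have "\<dots> = emeasure (density lborel (\<lambda>x. ennreal (f x))) X"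
    by (simp add: emeasure_density mult.commute)
  finally show "emeasure (density lborel (\<lambda>x. ennreal (f x))) X = emeasure (arcsine_mixture A B) X" by simp
qed (simp add: arcsine_mixture_def)

lemma arcsine_mixture_moments:
  assumes [measurable]: "A \<in> borel_measurable borel" "B \<in> borel_measurable borel"
    and C: "\<And>t. 0 < t \<Longrightarrow> t < 1 \<Longrightarrow> \<bar>A t\<bar> \<le> C \<and> \<bar>B t\<bar> \<le> C"
  shows "real_distribution (arcsine_mixture A B)"
    and "AE x in arcsine_mixture A B. \<bar>x\<bar> \<le> 3 * C"
    and "(\<lambda>t. bulk_moment (A t) (B t) k 0) \<in> borel_measurable borel"
    and "(\<integral>x. x ^ k \<partial>arcsine_mixture A B) = (\<integral>t. bulk_moment (A t) (B t) k 0 \<partial>position)"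
proof -
  interpret pair_sigma_finite position phase ..
  interpret P: pair_prob_space position phase ..
  show "real_distribution (arcsine_mixture A B)"
    unfolding arcsine_mixture_def by (rule P.real_distribution_distr) simp
  have bd: "AE p in position \<Otimes>\<^sub>M phase. \<bar>case p of (t, \<theta>) \<Rightarrow> A t + 2 * B t * cos \<theta>\<bar> \<le> 3 * C"
  proof (rule AE_pair_measure)
    show "AE t in position. AE \<theta> in phase. \<bar>case (t, \<theta>) of (t, \<theta>) \<Rightarrow> A t + 2 * B t * cos \<theta>\<bar> \<le> 3 * C"
      unfolding position_def
    proof (rule AE_uniform_measureI, simp, rule AE_I2, rule impI, rule AE_I2)
      fix t \<theta> :: real assume t: "t \<in> {0<..<1}"
      have "\<bar>B t * cos \<theta>\<bar> \<le> C * 1" unfolding abs_mult using C[of t] t by (intro mult_mono) auto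
      then show "\<bar>case (t, \<theta>) of (t, \<theta>) \<Rightarrow> A t + 2 * B t * cos \<theta>\<bar> \<le> 3 * C"
        using C[of t] t by auto
    qed
  qed measurable
  then show "AE x in arcsine_mixture A B. \<bar>x\<bar> \<le> 3 * C"
    unfolding arcsine_mixture_def by (subst AE_distr_iff) auto
  show "(\<lambda>t. bulk_moment (A t) (B t) k 0) \<in> borel_measurable borel"
    unfolding bulk_moment_def by measurable
  have "(\<integral>x. x ^ k \<partial>arcsine_mixture A B) = (\<integral>p. (case p of (t, \<theta>) \<Rightarrow> A t + 2 * B t * cos \<theta>) ^ k \<partial>(position \<Otimes>\<^sub>M phase))"
    unfolding arcsine_mixture_def by (subst integral_distr) auto
  also have "\<dots> = (\<integral>p. (case p of (t, \<theta>) \<Rightarrow> (A t + 2 * B t * cos \<theta>) ^ k) \<partial>(position \<Otimes>\<^sub>M phase))"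
    by (simp add: case_prod_beta)
  also have "\<dots> = (\<integral>t. (\<integral>\<theta>. (A t + 2 * B t * cos \<theta>) ^ k \<partial>phase) \<partial>position)"
  proof (rule integral_fst[symmetric], rule P.integrable_const_bound)
    show "AE p in position \<Otimes>\<^sub>M phase. norm (case p of (t, \<theta>) \<Rightarrow> (A t + 2 * B t * cos \<theta>) ^ k) \<le> (3 * C) ^ k"
      using bd
    proof eventually_elim
      case (elim p)
      from power_mono[OF this, of k] show ?case by (simp add: case_prod_beta power_abs)
    qed
  qed measurable
  finally show "(\<integral>x. x ^ k \<partial>arcsine_mixture A B) = (\<integral>t. bulk_moment (A t) (B t) k 0 \<partial>position)"
    by (simp add: bulk_moment_def)
qed

text \<open>The integrand is minus the derivative of \<open>sqrt (max 0 \<phi>)\<close>. It is unbounded where \<open>\<phi>\<close> vanishes, but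
strict monotonicity leaves at most one such point in the interior, and the fundamental theorem of
calculus allows finitely many exceptions.\<close>

lemma nn_integral_sqrt_derivative:
  fixes \<phi> \<phi>' :: "real \<Rightarrow> real"
  assumes deriv: "\<And>t. 0 \<le> t \<Longrightarrow> t \<le> 1 \<Longrightarrow> (\<phi> has_real_derivative \<phi>' t) (at t)"
    and neg: "\<And>t. 0 < t \<Longrightarrow> t < 1 \<Longrightarrow> \<phi>' t < 0"
    and end0: "\<phi> 1 \<le> 0"
    and [measurable]: "\<phi> \<in> borel_measurable borel" "\<phi>' \<in> borel_measurable borel"
  shows "(\<integral>\<^sup>+t. ennreal (if \<phi> t > 0 then - \<phi>' t / (2 * sqrt (\<phi> t)) else 0) * indicator {0<..<1} t \<partial>lborel)
     = ennreal (sqrt (max 0 (\<phi> 0)))"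
proof -
  define F where "F t = - sqrt (max 0 (\<phi> t))" for t
  define G where "G t = (if \<phi> t > 0 then - \<phi>' t / (2 * sqrt (\<phi> t)) else 0)" for t
  have cont: "isCont \<phi> t" if "0 \<le> t" "t \<le> 1" for t using deriv[OF that] DERIV_isCont by blast
  define Z where "Z = {t. 0 < t \<and> t < 1 \<and> \<phi> t = 0}"
  have decr: "\<phi> t < \<phi> s" if "0 < s" "s < t" "t < 1" for s t
  proof (rule DERIV_neg_imp_decreasing[OF that(2)])
    fix x assume "s \<le> x" "x \<le> t"
    then show "\<exists>y. (\<phi> has_real_derivative y) (at x) \<and> y < 0"
      using deriv[of x] neg[of x] that by (intro exI[of _ "\<phi>' x"]) auto
  qed
  have "finite Z"
  proof (cases "Z = {}")
    case False
    then obtain z where z: "z \<in> Z" by blast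
    have "Z \<subseteq> {z}"
    proof
      fix y assume "y \<in> Z"
      then show "y \<in> {z}" using decr[of y z] decr[of z y] z by (cases y z rule: linorder_cases) (auto simp: Z_def)
    qed
    then show ?thesis by (rule finite_subset) simp
  qed simp
  then have "(G has_integral (F 1 - F 0)) {0..1}"
  proof (rule fundamental_theorem_of_calculus_interior_strong)
    show "continuous_on {0..1} F"
      unfolding F_def by (intro continuous_intros continuous_at_imp_continuous_on ballI cont) auto
    fix t :: real assume "t \<in> {0<..<1} - Z"
    then have t: "0 < t" "t < 1" "\<phi> t \<noteq> 0" by (auto simp: Z_def)
    have "(F has_real_derivative G t) (at t)"
    proof (cases "\<phi> t > 0")
      case True
      have D: "((\<lambda>t. - sqrt (\<phi> t)) has_real_derivative G t) (at t)"
        using t True by (auto intro!: derivative_eq_intros deriv simp: G_def field_simps)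
      have "\<forall>\<^sub>F s in nhds t. \<phi> s > 0"
        using cont[of t] t True unfolding isCont_def tendsto_at_iff_tendsto_nhds by (intro order_tendstoD(1)[of \<phi> "\<phi> t" "nhds t" 0]) auto
      then have ev: "\<forall>\<^sub>F s in nhds t. F s = - sqrt (\<phi> s)" by eventually_elim (simp add: F_def)
      from D show ?thesis by (rule DERIV_cong_ev[OF refl ev refl, THEN iffD2])
    next
      case False
      then have "\<phi> t < 0" using t by simp
      then have "\<forall>\<^sub>F s in nhds t. \<phi> s < 0"
        using cont[of t] t unfolding isCont_def tendsto_at_iff_tendsto_nhds by (intro order_tendstoD(2)[of \<phi> "\<phi> t" "nhds t" 0]) auto
      then have ev: "\<forall>\<^sub>F s in nhds t. F s = 0" by eventually_elim (simp add: F_def)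
      have "((\<lambda>_. 0) has_real_derivative G t) (at t)" using False by (simp add: G_def)
      then show ?thesis by (rule DERIV_cong_ev[OF refl ev refl, THEN iffD2])
    qed
    then show "(F has_vector_derivative G t) (at t)" by (simp add: has_real_derivative_iff_has_vector_derivative)
  qed simp
  then have int: "(G has_integral (sqrt (max 0 (\<phi> 0)))) {0<..<1}"
    using end0 by (simp add: F_def has_integral_Icc_iff_Ioo)
  have "(\<integral>\<^sup>+t. ennreal (G t * indicator {0<..<1} t) \<partial>lborel) = ennreal (sqrt (max 0 (\<phi> 0)))"
  proof (rule nn_integral_has_integral_lborel)
    show "((\<lambda>t. G t * indicator {0<..<1} t) has_integral sqrt (max 0 (\<phi> 0))) UNIV"
    proof -
      have "(\<lambda>t. G t * indicator {0<..<1} t) = (\<lambda>t. if t \<in> {0<..<1} then G t else 0)"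
        by (auto simp: indicator_def)
      then show ?thesis using int by (simp only: has_integral_restrict_UNIV)
    qed
    show "0 \<le> G t * indicator {0<..<1} t" for t
      using neg[of t] by (auto simp: G_def indicator_def intro!: divide_nonpos_pos)
  qed (simp add: G_def)
  moreover have "ennreal (G t * indicator {0<..<1} t)
      = ennreal (if \<phi> t > 0 then - \<phi>' t / (2 * sqrt (\<phi> t)) else 0) * indicator {0<..<1} t" for t
    by (simp add: G_def indicator_def)
  ultimately show ?thesis by simp
qed

section \<open>The three limit laws are arcsine mixtures\<close>

text \<open>The common mechanism behind the three densities; the constant \<open>c\<close> may depend on \<open>x\<close>.\<close>

lemma nn_integral_arcsine_density:
  fixes \<phi> \<phi>' :: "real \<Rightarrow> real"
  assumes deriv: "\<And>t. 0 \<le> t \<Longrightarrow> t \<le> 1 \<Longrightarrow> (\<phi> has_real_derivative \<phi>' t) (at t)"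
    and neg: "\<And>t. 0 < t \<Longrightarrow> t < 1 \<Longrightarrow> \<phi>' t < 0"
    and end0: "\<phi> 1 \<le> 0"
    and [measurable]: "\<phi> \<in> borel_measurable borel" "\<phi>' \<in> borel_measurable borel"
    and c: "c \<ge> 0"
    and eq: "\<And>t. 0 < t \<Longrightarrow> t < 1 \<Longrightarrow>
      arcsine_density (A t) (B t) x = c * (if \<phi> t > 0 then - \<phi>' t / (2 * sqrt (\<phi> t)) else 0)"
  shows "(\<integral>\<^sup>+t. ennreal (arcsine_density (A t) (B t) x) * indicator {0<..<1} t \<partial>lborel)
     = ennreal (c * sqrt (max 0 (\<phi> 0)))"
proof -
  have "(\<integral>\<^sup>+t. ennreal (arcsine_density (A t) (B t) x) * indicator {0<..<1} t \<partial>lborel)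
      = (\<integral>\<^sup>+t. ennreal c * (ennreal (if \<phi> t > 0 then - \<phi>' t / (2 * sqrt (\<phi> t)) else 0) * indicator {0<..<1} t) \<partial>lborel)"
    by (rule nn_integral_cong) (simp only: mult.assoc[symmetric] ennreal_mult'[OF c, symmetric], auto simp: eq indicator_def)
  also have "\<dots> = ennreal c * ennreal (sqrt (max 0 (\<phi> 0)))"
    by (subst nn_integral_cmult, simp, subst nn_integral_sqrt_derivative[OF deriv neg end0]) auto
  finally show ?thesis by (simp add: ennreal_mult'[OF c])
qed

lemma nn_integral_arcsine_density_outside:
  assumes "\<And>t. 0 < t \<Longrightarrow> t < 1 \<Longrightarrow> 4 * (B t)\<^sup>2 - (x - A t)\<^sup>2 \<le> 0"
  shows "(\<integral>\<^sup>+t. ennreal (arcsine_density (A t) (B t) x) * indicator {0<..<1} t \<partial>lborel) = 0"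
proof -
  have "ennreal (arcsine_density (A t) (B t) x) * indicator {0<..<1} t = 0" for t
    using assms[of t] by (auto simp: arcsine_density_def indicator_def)
  then show ?thesis by (simp only: nn_integral_const mult_zero_left)
qed

text \<open>Here \<open>\<phi> t = 4 (1 - t) - x\<^sup>2\<close> is the discriminant \<open>4 B\<^sup>2 - (x - A)\<^sup>2\<close> itself.\<close>

lemma semicircle_eq_arcsine_mixture:
  "semicircle_distribution = arcsine_mixture (\<lambda>_. 0) (\<lambda>t. sqrt (1 - t))"
  unfolding semicircle_distribution_def
proof (rule density_eq_arcsine_mixture)
  fix x :: real
  define \<phi> where "\<phi> = (\<lambda>t. 4 * (1 - t) - x\<^sup>2)"
  have "(\<integral>\<^sup>+t. ennreal (arcsine_density 0 (sqrt (1 - t)) x) * indicator {0<..<1} t \<partial>lborel)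
      = ennreal (1 / (2 * pi) * sqrt (max 0 (\<phi> 0)))"
    by (rule nn_integral_arcsine_density[where \<phi> = \<phi> and \<phi>' = "\<lambda>_. -4"])
       (auto simp: \<phi>_def arcsine_density_def field_simps intro!: derivative_eq_intros)
  also have "1 / (2 * pi) * sqrt (max 0 (\<phi> 0)) = (if x \<in> {-2..2} then sqrt (4 - x\<^sup>2) / (2 * pi) else 0)"
  proof -
    have "x \<in> {-2..2} \<longleftrightarrow> x\<^sup>2 \<le> 2\<^sup>2" unfolding abs_le_square_iff[symmetric] by auto
    then show ?thesis by (auto simp: \<phi>_def max_def)
  qed
  finally show "(\<integral>\<^sup>+t. ennreal (arcsine_density 0 (sqrt (1 - t)) x) * indicator {0<..<1} t \<partial>lborel)
      = ennreal (if x \<in> {-2..2} then sqrt (4 - x\<^sup>2) / (2 * pi) else 0)" .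
qed auto

text \<open>The squared diagonal and subdiagonal entries of the bidiagonal factor are close to \<open>1 - g t\<close> and
\<open>g (1 - t)\<close>; these are the coefficients of the product of that factor with its transpose.\<close>

definition wishart_diag_profile :: "real \<Rightarrow> real \<Rightarrow> real" where
  "wishart_diag_profile g t = (1 - g * t) + g * (1 - t)"

definition wishart_offdiag_profile :: "real \<Rightarrow> real \<Rightarrow> real" where
  "wishart_offdiag_profile g t = sqrt ((1 - g * t) * (g * (1 - t)))"

lemma marchenko_pastur_discriminant:
  assumes "0 < g"
  shows "((1 + sqrt g)\<^sup>2 - x) * (x - (1 - sqrt g)\<^sup>2) = 4 * g * x - (x - 1 + g)\<^sup>2"
proof -
  define s where "s = sqrt g"
  have s: "sqrt g = s" "g = s\<^sup>2" using assms by (simp_all add: s_def)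
  show ?thesis unfolding s by (simp add: power2_eq_square algebra_simps)
qed

lemma mem_open_interval_iff:
  fixes l u x :: real
  assumes "l \<le> u"
  shows "x \<in> {l<..<u} \<longleftrightarrow> (u - x) * (x - l) > 0"
  using assms by (auto simp: zero_less_mult_iff)

text \<open>The discriminant is \<open>\<phi> t = 4 g (1 - t) x - (x - 1 + g)\<^sup>2\<close>, because the quadratic terms in \<open>t\<close> cancel.
It is decreasing for positive \<open>x\<close> and never positive for the other \<open>x\<close>.\<close>

lemma marchenko_pastur_eq_arcsine_mixture:
  assumes g: "0 < g" "g < 1"
  shows "marchenko_pastur_distribution g = arcsine_mixture (wishart_diag_profile g) (wishart_offdiag_profile g)"
  unfolding marchenko_pastur_distribution_def Let_def
proof (rule density_eq_arcsine_mixture)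
  show "wishart_diag_profile g \<in> borel_measurable borel" "wishart_offdiag_profile g \<in> borel_measurable borel"
    unfolding wishart_diag_profile_def wishart_offdiag_profile_def by measurable
  have pos: "(1 - g * t) * (g * (1 - t)) > 0" if "0 < t" "t < 1" for t
  proof -
    have "g * t < 1 * 1" using that g by (intro mult_strict_mono) auto
    then show ?thesis using that g by (intro mult_pos_pos) auto
  qed
  then show "wishart_offdiag_profile g t > 0" if "0 < t" "t < 1" for t
    using that by (simp add: wishart_offdiag_profile_def)
  fix x :: real
  define \<phi> where "\<phi> = (\<lambda>t. 4 * g * (1 - t) * x - (x - 1 + g)\<^sup>2)"
  have R: "4 * (wishart_offdiag_profile g t)\<^sup>2 - (x - wishart_diag_profile g t)\<^sup>2 = \<phi> t" if "0 < t" "t < 1" for t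
    using pos[OF that] by (simp add: wishart_offdiag_profile_def wishart_diag_profile_def \<phi>_def)
      (simp add: power2_eq_square algebra_simps)
  have \<phi>0: "((1 + sqrt g)\<^sup>2 - x) * (x - (1 - sqrt g)\<^sup>2) = \<phi> 0"
    unfolding marchenko_pastur_discriminant[OF g(1)] by (simp add: \<phi>_def)
  have mem: "x \<in> {(1 - sqrt g)\<^sup>2<..<(1 + sqrt g)\<^sup>2} \<longleftrightarrow> \<phi> 0 > 0"
    unfolding \<phi>0[symmetric] by (rule mem_open_interval_iff) (use g in \<open>simp add: power2_eq_square algebra_simps\<close>)
  show "(\<integral>\<^sup>+t. ennreal (arcsine_density (wishart_diag_profile g t) (wishart_offdiag_profile g t) x) * indicator {0<..<1} t \<partial>lborel)
      = ennreal (if x \<in> {(1 - sqrt g)\<^sup>2<..<(1 + sqrt g)\<^sup>2}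
          then sqrt (((1 + sqrt g)\<^sup>2 - x) * (x - (1 - sqrt g)\<^sup>2)) / (2 * pi * g * x) else 0)"
  proof (cases "x > 0")
    case True
    have "(\<integral>\<^sup>+t. ennreal (arcsine_density (wishart_diag_profile g t) (wishart_offdiag_profile g t) x) * indicator {0<..<1} t \<partial>lborel)
      = ennreal (1 / (2 * pi * g * x) * sqrt (max 0 (\<phi> 0)))"
    proof (rule nn_integral_arcsine_density[where \<phi> = \<phi> and \<phi>' = "\<lambda>_. - 4 * g * x"])
      show "\<phi> \<in> borel_measurable borel" unfolding \<phi>_def by measurable
      show "arcsine_density (wishart_diag_profile g t) (wishart_offdiag_profile g t) x =
        1 / (2 * pi * g * x) * (if \<phi> t > 0 then - (- 4 * g * x) / (2 * sqrt (\<phi> t)) else 0)"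
        if "0 < t" "t < 1" for t
        using True g unfolding arcsine_density_def R[OF that] by (simp add: field_simps)
    qed (use True g in \<open>auto simp: \<phi>_def intro!: derivative_eq_intros\<close>)
    then show ?thesis unfolding mem \<phi>0 by simp
  next
    case False
    have np: "\<phi> t \<le> 0" if "t \<le> 1" for t
    proof -
      have "4 * g * (1 - t) * x \<le> 0" using False that g by (intro mult_nonneg_nonpos) auto
      then show ?thesis unfolding \<phi>_def using zero_le_power2[of "x - 1 + g"] by linarith
    qed
    have "\<not> \<phi> 0 > 0" using np[of 0] by simp
    then show ?thesis unfolding mem
      by (subst nn_integral_arcsine_density_outside) (auto simp: R np)
  qed
qed measurable

text \<open>The functions \<open>q\<close> and \<open>r\<close> are the limiting means of the odd and the even beta variables at position
\<open>t\<close>, with common denominator \<open>D\<close>; the coefficients of the matrix are formed from them.\<close>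

locale manova_parameters =
  fixes ka kb :: real
  assumes ka: "ka \<ge> 0" and kb: "kb \<ge> 0"
begin

definition D :: "real \<Rightarrow> real" where "D t = 2 * (1 - t) + ka + kb"
definition q :: "real \<Rightarrow> real" where "q t = ((1 - t) + ka) / D t"
definition r :: "real \<Rightarrow> real" where "r t = (1 - t) / D t"
definition diag :: "real \<Rightarrow> real" where "diag t = q t * (1 - r t) + r t * (1 - q t)"
definition offdiag :: "real \<Rightarrow> real" where "offdiag t = sqrt (q t * (1 - r t) * (r t * (1 - q t)))"

lemma D_pos: "t < 1 \<Longrightarrow> D t > 0"
  using ka kb by (simp add: D_def)

lemma complements: "t < 1 \<Longrightarrow> 1 - q t = ((1 - t) + kb) / D t" "t < 1 \<Longrightarrow> 1 - r t = ((1 - t) + ka + kb) / D t"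
  using D_pos[of t] by (auto simp: q_def r_def field_simps) (auto simp: D_def)

lemma offdiag_square_pos: "t < 1 \<Longrightarrow> q t * (1 - r t) * (r t * (1 - q t)) > 0"
  using D_pos[of t] ka kb by (simp add: complements) (simp add: q_def r_def)

lemma measurable_profiles [measurable]:
  "D \<in> borel_measurable borel" "diag \<in> borel_measurable borel" "offdiag \<in> borel_measurable borel"
  unfolding diag_def offdiag_def q_def r_def D_def by measurable

definition \<phi> :: "real \<Rightarrow> real \<Rightarrow> real" where
  "\<phi> x t = (D t)\<^sup>2 * (x * (1 - x)) - ka\<^sup>2 * (1 - x) - kb\<^sup>2 * x"

text \<open>With \<open>P = (1 - t + ka) (1 - t + ka + kb)\<close> and \<open>Q = (1 - t) (1 - t + kb)\<close> the coefficients are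
\<open>diag = (P + Q) / D\<^sup>2\<close> and \<open>offdiag\<^sup>2 = P Q / D\<^sup>4\<close>. Two identities make the discriminant simple:
\<open>P - Q = ka D\<close> and \<open>2 (P + Q) = D\<^sup>2 + ka\<^sup>2 - kb\<^sup>2\<close>. After multiplication with \<open>D\<^sup>2\<close> the only
dependence on \<open>t\<close> that is left is through \<open>D\<^sup>2\<close>.\<close>

lemma discriminant:
  assumes "t < 1"
  shows "4 * (offdiag t)\<^sup>2 - (x - diag t)\<^sup>2 = \<phi> x t / (D t)\<^sup>2"
proof -
  define s d where "s = 1 - t" and "d = D t"
  have d: "d > 0" "d = 2 * s + ka + kb" using D_pos[OF assms] by (auto simp: s_def d_def D_def)
  define P Q where "P = (s + ka) * (s + ka + kb)" and "Q = s * (s + kb)"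
  have "(offdiag t)\<^sup>2 = q t * (1 - r t) * (r t * (1 - q t))"
    using offdiag_square_pos[OF assms] by (simp add: offdiag_def)
  also have "\<dots> = P * Q / d ^ 4"
    unfolding complements[OF assms] by (simp add: q_def r_def P_def Q_def s_def d_def power4_eq_xxxx)
  finally have B: "(offdiag t)\<^sup>2 = P * Q / d ^ 4" .
  have A: "diag t = (P + Q) / d\<^sup>2"
    unfolding diag_def complements[OF assms] by (simp add: q_def r_def P_def Q_def s_def d_def power2_eq_square flip: add_divide_distrib)
  have PQ: "P - Q = ka * d" "2 * (P + Q) = d\<^sup>2 + ka\<^sup>2 - kb\<^sup>2"
    by (simp_all add: P_def Q_def d(2) power2_eq_square algebra_simps)
  have "d ^ 4 * (4 * (offdiag t)\<^sup>2 - (x - diag t)\<^sup>2) = 4 * P * Q - (x * d\<^sup>2 - (P + Q))\<^sup>2"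
    unfolding A B using d(1) by (simp add: field_simps power2_eq_square power4_eq_xxxx)
  also have "\<dots> = d\<^sup>2 * x * (2 * (P + Q)) - d ^ 4 * x\<^sup>2 - (P - Q)\<^sup>2"
    by (simp add: field_simps power2_eq_square power4_eq_xxxx)
  also have "\<dots> = d\<^sup>2 * \<phi> x t"
    unfolding PQ by (simp add: \<phi>_def d_def[symmetric] power2_eq_square power4_eq_xxxx algebra_simps)
  finally have "d\<^sup>2 * (d\<^sup>2 * (4 * (offdiag t)\<^sup>2 - (x - diag t)\<^sup>2)) = d\<^sup>2 * \<phi> x t"
    by (simp add: power2_eq_square power4_eq_xxxx mult.assoc)
  then have "d\<^sup>2 * (4 * (offdiag t)\<^sup>2 - (x - diag t)\<^sup>2) = \<phi> x t"
    using d(1) by (simp only: mult_cancel_left) simp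
  then show ?thesis
    unfolding d_def[symmetric] using d(1) by (subst nonzero_eq_divide_eq) (simp_all add: mult.commute)
qed

lemma \<phi>_nonpos_outside:
  assumes "x \<le> 0 \<or> 1 \<le> x" "t \<le> 1"
  shows "\<phi> x t \<le> 0"
proof -
  have D: "0 \<le> ka" "ka \<le> D t" "0 \<le> kb" "kb \<le> D t" using ka kb assms(2) by (auto simp: D_def)
  have "ka\<^sup>2 \<le> (D t)\<^sup>2" "kb\<^sup>2 \<le> (D t)\<^sup>2" using D by (auto intro: power_mono)
  from assms(1) show ?thesis
  proof
    assume x: "x \<le> 0"
    have "\<phi> x t = x * (((D t)\<^sup>2 - kb\<^sup>2) + (D t)\<^sup>2 * (- x)) - ka\<^sup>2 * (1 - x)"
      by (simp add: \<phi>_def algebra_simps)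
    moreover have "x * (((D t)\<^sup>2 - kb\<^sup>2) + (D t)\<^sup>2 * (- x)) \<le> 0"
      using x \<open>kb\<^sup>2 \<le> (D t)\<^sup>2\<close> by (intro mult_nonpos_nonneg add_nonneg_nonneg mult_nonneg_nonneg) auto
    moreover have "ka\<^sup>2 * (1 - x) \<ge> 0" using x by simp
    ultimately show ?thesis by linarith
  next
    assume x: "1 \<le> x"
    have "\<phi> x t = (1 - x) * (((D t)\<^sup>2 - ka\<^sup>2) + (D t)\<^sup>2 * (x - 1)) - kb\<^sup>2 * x"
      by (simp add: \<phi>_def algebra_simps)
    moreover have "(1 - x) * (((D t)\<^sup>2 - ka\<^sup>2) + (D t)\<^sup>2 * (x - 1)) \<le> 0"
      using x \<open>ka\<^sup>2 \<le> (D t)\<^sup>2\<close> by (intro mult_nonpos_nonneg add_nonneg_nonneg mult_nonneg_nonneg) auto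
    moreover have "kb\<^sup>2 * x \<ge> 0" using x by simp
    ultimately show ?thesis by linarith
  qed
qed

definition edge_lo where "edge_lo = ((sqrt ((1 + ka) * (1 + ka + kb)) - sqrt (1 + kb)) / (2 + ka + kb))\<^sup>2"
definition edge_hi where "edge_hi = ((sqrt ((1 + ka) * (1 + ka + kb)) + sqrt (1 + kb)) / (2 + ka + kb))\<^sup>2"

text \<open>The same two identities at \<open>t = 0\<close>, now with square roots: \<open>v\<^sup>2\<close> is \<open>P\<close> and \<open>w\<^sup>2\<close> is \<open>Q\<close>.\<close>

lemma edges_discriminant: "(2 + ka + kb)\<^sup>2 * ((x - edge_lo) * (edge_hi - x)) = \<phi> x 0"
proof -
  define n where "n = 2 + ka + kb"
  have n: "n > 0" using ka kb by (simp add: n_def)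
  obtain v where v: "sqrt ((1 + ka) * (1 + ka + kb)) = v" "v\<^sup>2 = (1 + ka) * (1 + ka + kb)"
    using ka kb by simp
  obtain w where w: "sqrt (1 + kb) = w" "w\<^sup>2 = 1 + kb" using kb by simp
  have "n\<^sup>2 * (n\<^sup>2 * ((x - edge_lo) * (edge_hi - x))) = (n\<^sup>2 * x - (v - w)\<^sup>2) * ((v + w)\<^sup>2 - n\<^sup>2 * x)"
    using n unfolding edge_lo_def edge_hi_def v(1) w(1) n_def[symmetric] by (simp add: power_divide field_simps)
  also have "\<dots> = n\<^sup>2 * x * (2 * (v\<^sup>2 + w\<^sup>2)) - n\<^sup>2 * x * (n\<^sup>2 * x) - (v\<^sup>2 - w\<^sup>2)\<^sup>2"
    by (simp add: power2_eq_square algebra_simps)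
  also have "v\<^sup>2 - w\<^sup>2 = ka * n" unfolding v w by (simp add: n_def algebra_simps power2_eq_square)
  also have "2 * (v\<^sup>2 + w\<^sup>2) = n\<^sup>2 + ka\<^sup>2 - kb\<^sup>2"
    unfolding v w by (simp add: n_def algebra_simps power2_eq_square)
  also have "n\<^sup>2 * x * (n\<^sup>2 + ka\<^sup>2 - kb\<^sup>2) - n\<^sup>2 * x * (n\<^sup>2 * x) - (ka * n)\<^sup>2 = n\<^sup>2 * \<phi> x 0"
    by (simp add: \<phi>_def D_def n_def[symmetric] add.assoc[symmetric]) (simp add: power2_eq_square algebra_simps)
  finally have "n\<^sup>2 * ((x - edge_lo) * (edge_hi - x)) = \<phi> x 0"
    using n by (simp only: mult_cancel_left) simp
  then show ?thesis by (simp only: n_def)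
qed

lemma edges_le: "edge_lo \<le> edge_hi"
  unfolding edge_lo_def edge_hi_def power_divide
  using ka kb by (intro divide_right_mono) (auto simp: power2_eq_square algebra_simps)

lemma kesten_mckey_eq_arcsine_mixture:
  "kesten_mckey_distribution ka kb = arcsine_mixture diag offdiag"
  unfolding kesten_mckey_distribution_def Let_def edge_lo_def[symmetric] edge_hi_def[symmetric]
proof (rule density_eq_arcsine_mixture)
  show "offdiag t > 0" if "t < 1" for t
    using offdiag_square_pos[OF that] by (simp add: offdiag_def)
  fix x :: real
  define n where "n = 2 + ka + kb"
  have n: "n > 0" using ka kb by (simp add: n_def)
  have \<phi>0: "\<phi> x 0 = n\<^sup>2 * ((x - edge_lo) * (edge_hi - x))" by (simp add: edges_discriminant n_def)
  have mem: "x \<in> {edge_lo<..<edge_hi} \<longleftrightarrow> \<phi> x 0 > 0"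
    unfolding mem_open_interval_iff[OF edges_le] \<phi>0 using n by (simp add: zero_less_mult_iff mult.commute)
  show "(\<integral>\<^sup>+t. ennreal (arcsine_density (diag t) (offdiag t) x) * indicator {0<..<1} t \<partial>lborel) =
      ennreal (if x \<in> {edge_lo<..<edge_hi} then (2 + ka + kb) / (2 * pi) * (sqrt ((x - edge_lo) * (edge_hi - x)) / (x * (1 - x))) else 0)"
  proof (cases "x \<le> 0 \<or> 1 \<le> x")
    case True
    have "4 * (offdiag t)\<^sup>2 - (x - diag t)\<^sup>2 \<le> 0" if "t < 1" for t
      unfolding discriminant[OF that] using \<phi>_nonpos_outside[OF True, of t] that
      by (simp add: divide_le_0_iff)
    then show ?thesis unfolding mem using \<phi>_nonpos_outside[OF True, of 0]
      by (subst nn_integral_arcsine_density_outside) auto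
  next
    case False
    then have x: "x * (1 - x) > 0" by simp
    have "(\<integral>\<^sup>+t. ennreal (arcsine_density (diag t) (offdiag t) x) * indicator {0<..<1} t \<partial>lborel)
        = ennreal (1 / (2 * pi * (x * (1 - x))) * sqrt (max 0 (\<phi> x 0)))"
    proof (rule nn_integral_arcsine_density[where \<phi> = "\<phi> x" and \<phi>' = "\<lambda>t. - 4 * D t * (x * (1 - x))"])
      show "(\<phi> x has_real_derivative - 4 * D t * (x * (1 - x))) (at t)" for t
        unfolding \<phi>_def[abs_def] D_def[abs_def] by (auto intro!: derivative_eq_intros)
      show "- 4 * D t * (x * (1 - x)) < 0" if "t < 1" for t
        using mult_pos_pos[OF D_pos[OF that] x] by (simp add: mult_ac)
      have "\<phi> x 1 = - (((ka + kb) * x - ka)\<^sup>2)"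
        by (simp add: \<phi>_def D_def power2_eq_square algebra_simps)
      then show "\<phi> x 1 \<le> 0" by simp
      show "\<phi> x \<in> borel_measurable borel" unfolding \<phi>_def by measurable
      show "arcsine_density (diag t) (offdiag t) x = 1 / (2 * pi * (x * (1 - x))) *
         (if \<phi> x t > 0 then - (- 4 * D t * (x * (1 - x))) / (2 * sqrt (\<phi> x t)) else 0)" if "t < 1" for t
      proof -
        have "sqrt (\<phi> x t / (D t)\<^sup>2) = sqrt (\<phi> x t) / D t" "D t > 0"
          using D_pos[OF that] by (simp_all add: real_sqrt_divide)
        then show ?thesis
          unfolding arcsine_density_def discriminant[OF that] using x
          by (auto simp: zero_less_divide_iff field_simps)
      qed
    qed (use x in auto)
    also have "1 / (2 * pi * (x * (1 - x))) * sqrt (max 0 (\<phi> x 0)) =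
        (if \<phi> x 0 > 0 then (2 + ka + kb) / (2 * pi) * (sqrt ((x - edge_lo) * (edge_hi - x)) / (x * (1 - x))) else 0)"
    proof (cases "\<phi> x 0 > 0")
      case True
      have "sqrt (\<phi> x 0) = n * sqrt ((x - edge_lo) * (edge_hi - x))"
        unfolding \<phi>0 using n by (simp add: real_sqrt_mult)
      with True show ?thesis by (simp add: n_def)
    qed simp
    finally show ?thesis unfolding mem .
  qed
qed measurable

end

section \<open>Moments of the limit laws at the corner\<close>

text \<open>The sequence \<open>sin ((i + 1) \<theta>)\<close> is an eigenvector of the half-line matrix for \<open>A + 2 B cos \<theta>\<close>,
because \<open>sin (0 \<theta>) = 0\<close> takes the place of the missing neighbour of row 0. These sequences are
orthogonal, so they diagonalise the matrix.\<close>

lemma half_line_jacobi_const_moment: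
  "(half_line_jacobi (\<lambda>_. A) (\<lambda>_. B) ^^ k) unit_seq i =
     2 * (\<integral>\<theta>. (A + 2 * B * cos \<theta>) ^ k * (sin \<theta> * sin (real (i + 1) * \<theta>)) \<partial>phase)"
proof (induction k arbitrary: i)
  case 0
  have "sin \<theta> * sin (real (i + 1) * \<theta>) = (cos (of_int (int i) * \<theta>) - cos (of_int (int i + 2) * \<theta>)) / 2" for \<theta> :: real
    using cos_add[of "real (i + 1) * \<theta>" \<theta>] cos_diff[of "real (i + 1) * \<theta>" \<theta>] by (simp add: algebra_simps)
  then have "(\<integral>\<theta>. sin \<theta> * sin (real (i + 1) * \<theta>) \<partial>phase)
      = (\<integral>\<theta>. (cos (of_int (int i) * \<theta>) - cos (of_int (int i + 2) * \<theta>)) / 2 \<partial>phase)"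
    by (simp only:)
  also have "\<dots> = ((\<integral>\<theta>. cos (of_int (int i) * \<theta>) \<partial>phase) - (\<integral>\<theta>. cos (of_int (int i + 2) * \<theta>) \<partial>phase)) / 2"
    unfolding integral_divide_zero
    by (subst Bochner_Integration.integral_diff) (auto intro!: integrable_phase continuous_intros)
  also have "\<dots> = unit_seq i / 2" unfolding integral_phase_cos by (auto simp: unit_seq_def)
  finally show ?case by simp
next
  case (Suc k)
  define m where "m j = (\<integral>\<theta>. (A + 2 * B * cos \<theta>) ^ k * (sin \<theta> * sin (real j * \<theta>)) \<partial>phase)" for j
  define f where "f = (half_line_jacobi (\<lambda>_. A) (\<lambda>_. B) ^^ k) unit_seq"
  have f: "f i = 2 * m (i + 1)" for i using Suc.IH[of i] by (simp add: f_def m_def)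
  have int: "integrable phase (\<lambda>\<theta>. c * ((A + 2 * B * cos \<theta>) ^ k * (sin \<theta> * sin (real j * \<theta>))))" for c j
    by (intro integrable_phase continuous_intros)
  have *: "2 * cos \<theta> * sin (real (i + 1) * \<theta>) = sin (real (i + 2) * \<theta>) + sin (real i * \<theta>)" for \<theta> :: real
    using sin_add[of "real (i + 1) * \<theta>" \<theta>] sin_diff[of "real (i + 1) * \<theta>" \<theta>] by (simp add: algebra_simps)
  have "(A + 2 * B * cos \<theta>) ^ Suc k * (sin \<theta> * sin (real (i + 1) * \<theta>)) =
      A * ((A + 2 * B * cos \<theta>) ^ k * (sin \<theta> * sin (real (i + 1) * \<theta>)))
      + B * ((A + 2 * B * cos \<theta>) ^ k * (sin \<theta> * sin (real (i + 2) * \<theta>)))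
      + B * ((A + 2 * B * cos \<theta>) ^ k * (sin \<theta> * sin (real i * \<theta>)))" for \<theta>
  proof -
    have "(A + 2 * B * cos \<theta>) ^ Suc k * (sin \<theta> * sin (real (i + 1) * \<theta>)) =
      (A + 2 * B * cos \<theta>) ^ k * sin \<theta> * (A * sin (real (i + 1) * \<theta>) + B * (2 * cos \<theta> * sin (real (i + 1) * \<theta>)))"
      by (simp add: algebra_simps)
    then show ?thesis unfolding * by (simp add: algebra_simps)
  qed
  then have "(\<integral>\<theta>. (A + 2 * B * cos \<theta>) ^ Suc k * (sin \<theta> * sin (real (i + 1) * \<theta>)) \<partial>phase)
      = A * m (i + 1) + B * m (i + 2) + B * m i"
    unfolding m_def
    by (simp only: Bochner_Integration.integral_add[OF int int] integral_mult_right_zero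
        Bochner_Integration.integral_add[OF Bochner_Integration.integrable_add[OF int int] int])
  moreover have "m 0 = 0" by (simp add: m_def)
  moreover have "half_line_jacobi (\<lambda>_. A) (\<lambda>_. B) f i = 2 * (A * m (i + 1) + B * m (i + 2) + B * m i)"
    using \<open>m 0 = 0\<close> by (cases i) (simp_all add: half_line_jacobi_def f algebra_simps)
  ultimately show ?case by (simp add: f_def)
qed

lemma phase_distr_eq_density:
  assumes B: "B > 0"
  shows "distr phase borel (\<lambda>\<theta>. A + 2 * B * cos \<theta>) = density lborel (\<lambda>x. ennreal (arcsine_density A B x))"
proof (rule measure_eqI)
  fix X assume "X \<in> sets (distr phase borel (\<lambda>\<theta>. A + 2 * B * cos \<theta>))"
  then have [measurable]: "X \<in> sets borel" by simp
  have "(\<integral>\<^sup>+x. indicator X x \<partial>distr phase borel (\<lambda>\<theta>. A + 2 * B * cos \<theta>))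
      = (\<integral>\<^sup>+\<theta>. indicator X (A + 2 * B * cos \<theta>) \<partial>phase)"
    by (rule nn_integral_distr) measurable
  also have "\<dots> = (\<integral>\<^sup>+x. indicator X x * ennreal (arcsine_density A B x) \<partial>lborel)"
    by (rule nn_integral_phase[OF B]) simp
  also have "\<dots> = emeasure (density lborel (\<lambda>x. ennreal (arcsine_density A B x))) X"
    by (simp add: emeasure_density mult.commute)
  finally show "emeasure (distr phase borel (\<lambda>\<theta>. A + 2 * B * cos \<theta>)) X
      = emeasure (density lborel (\<lambda>x. ennreal (arcsine_density A B x))) X" by simp
qed simp

text \<open>Each of the limit densities is \<open>sqrt (4 B\<^sup>2 - (x - A)\<^sup>2)\<close> divided by a polynomial. If \<open>p\<close> contains
that polynomial as a factor, then \<open>x = A + 2 B cos \<theta>\<close> turns the integral of \<open>p\<close> into one that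
\<open>half_line_jacobi_const_moment\<close> evaluates.\<close>

lemma integral_against_semicircle_shape:
  assumes B: "B > 0" and [measurable]: "h \<in> borel_measurable borel"
    and f: "\<And>x. f x * p x = h x * (if 4 * B\<^sup>2 - (x - A)\<^sup>2 > 0 then c * sqrt (4 * B\<^sup>2 - (x - A)\<^sup>2) else 0)"
    and f0: "\<And>x. f x \<ge> 0" and [measurable]: "f \<in> borel_measurable borel" "p \<in> borel_measurable borel"
  shows "(\<integral>x. p x \<partial>density lborel (\<lambda>x. ennreal (f x))) =
     4 * pi * c * B\<^sup>2 * (\<integral>\<theta>. h (A + 2 * B * cos \<theta>) * (sin \<theta> * sin \<theta>) \<partial>phase)"
proof -
  define R where "R x = 4 * B\<^sup>2 - (x - A)\<^sup>2" for x
  have [measurable]: "R \<in> borel_measurable borel" unfolding R_def by measurable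
  have "(\<integral>x. p x \<partial>density lborel (\<lambda>x. ennreal (f x))) = (\<integral>x. f x * p x \<partial>lborel)"
    by (subst integral_density) (auto simp: f0)
  also have "\<dots> = (\<integral>x. arcsine_density A B x * (pi * c * (h x * R x)) \<partial>lborel)"
  proof (rule Bochner_Integration.integral_cong[OF refl])
    fix x
    show "f x * p x = arcsine_density A B x * (pi * c * (h x * R x))"
    proof (cases "R x > 0")
      case True
      then have "1 / sqrt (R x) * R x = sqrt (R x)" by (simp add: real_div_sqrt)
      with True show ?thesis unfolding f arcsine_density_def R_def[symmetric]
        by (simp add: divide_simps)
    qed (simp add: f arcsine_density_def R_def[symmetric])
  qed
  also have "\<dots> = (\<integral>x. pi * c * (h x * R x) \<partial>density lborel (\<lambda>x. ennreal (arcsine_density A B x)))"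
    by (subst integral_density) (auto simp: arcsine_density_nonneg)
  also have "\<dots> = (\<integral>\<theta>. pi * c * (h (A + 2 * B * cos \<theta>) * R (A + 2 * B * cos \<theta>)) \<partial>phase)"
    unfolding phase_distr_eq_density[OF B, symmetric] by (subst integral_distr) auto
  also have "\<dots> = (\<integral>\<theta>. (4 * pi * c * B\<^sup>2) * (h (A + 2 * B * cos \<theta>) * (sin \<theta> * sin \<theta>)) \<partial>phase)"
  proof (rule Bochner_Integration.integral_cong[OF refl])
    fix \<theta>
    have "R (A + 2 * B * cos \<theta>) = 4 * B\<^sup>2 * (1 - (cos \<theta>)\<^sup>2)"
      by (simp add: R_def power_mult_distrib algebra_simps)
    also have "1 - (cos \<theta>)\<^sup>2 = sin \<theta> * sin \<theta>" using sin_cos_squared_add[of \<theta>] by (simp add: power2_eq_square algebra_simps)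
    finally show "pi * c * (h (A + 2 * B * cos \<theta>) * R (A + 2 * B * cos \<theta>))
        = (4 * pi * c * B\<^sup>2) * (h (A + 2 * B * cos \<theta>) * (sin \<theta> * sin \<theta>))" by simp
  qed
  finally show ?thesis by simp
qed

lemma semicircle_spectral_moments:
  "(\<integral>x. x ^ k \<partial>semicircle_distribution) = (half_line_jacobi (\<lambda>_. 0) (\<lambda>_. 1) ^^ k) unit_seq 0"
proof -
  have mem: "x \<in> {-2..2} \<longleftrightarrow> 4 - x\<^sup>2 \<ge> 0" for x :: real
  proof -
    have "x \<in> {-2..2} \<longleftrightarrow> x\<^sup>2 \<le> 2\<^sup>2" unfolding abs_le_square_iff[symmetric] by auto
    then show ?thesis by simp
  qed
  have "(\<integral>x. x ^ k \<partial>semicircle_distribution) =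
      4 * pi * (1 / (2 * pi)) * 1\<^sup>2 * (\<integral>\<theta>. (0 + 2 * 1 * cos \<theta>) ^ k * (sin \<theta> * sin \<theta>) \<partial>phase)"
    unfolding semicircle_distribution_def mem
    by (rule integral_against_semicircle_shape) auto
  then show ?thesis by (simp add: half_line_jacobi_const_moment)
qed

definition lower_bidiagonal :: "(nat \<Rightarrow> real) \<Rightarrow> (nat \<Rightarrow> real) \<Rightarrow> (nat \<Rightarrow> real) \<Rightarrow> nat \<Rightarrow> real" where
  "lower_bidiagonal d s f i = d i * f i + (if i > 0 then s (i - 1) * f (i - 1) else 0)"

definition upper_bidiagonal :: "(nat \<Rightarrow> real) \<Rightarrow> (nat \<Rightarrow> real) \<Rightarrow> (nat \<Rightarrow> real) \<Rightarrow> nat \<Rightarrow> real" where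
  "upper_bidiagonal d s f i = d i * f i + s i * f (i + 1)"

lemma lower_upper_bidiagonal:
  assumes "\<And>i. a (i + 1) = (d i)\<^sup>2 + (if i > 0 then (s (i - 1))\<^sup>2 else 0)" "\<And>i. b (i + 1) = d i * s i"
  shows "lower_bidiagonal d s (upper_bidiagonal d s f) = half_line_jacobi a b f"
proof
  fix i
  show "lower_bidiagonal d s (upper_bidiagonal d s f) i = half_line_jacobi a b f i"
    using assms(1)[of i] assms(2)[of i] assms(2)[of "i - 1"]
    by (cases i) (simp_all add: lower_bidiagonal_def upper_bidiagonal_def half_line_jacobi_def power2_eq_square algebra_simps)
qed

lemma upper_lower_bidiagonal:
  assumes "\<And>i. a (i + 1) = (d i)\<^sup>2 + (s i)\<^sup>2" "\<And>i. b (i + 1) = s i * d (i + 1)"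
  shows "upper_bidiagonal d s (lower_bidiagonal d s f) = half_line_jacobi a b f"
proof
  fix i
  show "upper_bidiagonal d s (lower_bidiagonal d s f) i = half_line_jacobi a b f i"
    using assms(1)[of i] assms(2)[of i] assms(2)[of "i - 1"]
    by (cases i) (simp_all add: lower_bidiagonal_def upper_bidiagonal_def half_line_jacobi_def power2_eq_square algebra_simps)
qed

lemma half_line_jacobi_pow_lincomb:
  "(half_line_jacobi a b ^^ k) (\<lambda>i. c * f i + e * g i) =
     (\<lambda>i. c * (half_line_jacobi a b ^^ k) f i + e * (half_line_jacobi a b ^^ k) g i)"
  by (induction k) (auto simp: half_line_jacobi_def algebra_simps)

text \<open>With \<open>L\<close> and \<open>U\<close> for the bidiagonal factors, \<open>(L U)\<^sup>k\<^sup>+\<^sup>1 = L (U L)\<^sup>k U\<close>, and \<open>U\<close> and \<open>L\<close> contribute one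
factor \<open>d 0\<close> each in the corner.\<close>

lemma bidiagonal_swap:
  assumes LU: "\<And>f. lower_bidiagonal d s (upper_bidiagonal d s f) = half_line_jacobi a b f"
    and UL: "\<And>f. upper_bidiagonal d s (lower_bidiagonal d s f) = half_line_jacobi a' b' f"
  shows "(half_line_jacobi a b ^^ Suc k) unit_seq 0 = (d 0)\<^sup>2 * (half_line_jacobi a' b' ^^ k) unit_seq 0"
proof -
  have "(half_line_jacobi a b ^^ Suc k) f = lower_bidiagonal d s ((half_line_jacobi a' b' ^^ k) (upper_bidiagonal d s f))" for f
  proof (induction k)
    case (Suc k)
    have "(half_line_jacobi a b ^^ Suc (Suc k)) f = half_line_jacobi a b ((half_line_jacobi a b ^^ Suc k) f)" by simp
    also have "\<dots> = lower_bidiagonal d s (half_line_jacobi a' b' ((half_line_jacobi a' b' ^^ k) (upper_bidiagonal d s f)))"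
      unfolding Suc.IH LU[symmetric] UL ..
    finally show ?case by simp
  qed (simp add: LU)
  moreover have "upper_bidiagonal d s unit_seq = (\<lambda>i. d 0 * unit_seq i + 0 * unit_seq i)"
    by (auto simp: upper_bidiagonal_def unit_seq_def)
  ultimately show ?thesis
    by (simp only: half_line_jacobi_pow_lincomb) (simp add: lower_bidiagonal_def power2_eq_square)
qed

text \<open>The exchange of factors for Jacobi matrices that are given by their coefficients.\<close>

lemma bidiagonal_swap_coefficients:
  assumes "\<And>i. a (i + 1) = (d i)\<^sup>2 + (if i > 0 then (s (i - 1))\<^sup>2 else 0)" "\<And>i. b (i + 1) = d i * s i"
    and "\<And>i. a' (i + 1) = (d i)\<^sup>2 + (s i)\<^sup>2" "\<And>i. b' (i + 1) = s i * d (i + 1)"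
  shows "(half_line_jacobi a b ^^ Suc k) unit_seq 0 = (d 0)\<^sup>2 * (half_line_jacobi a' b' ^^ k) unit_seq 0"
  using lower_upper_bidiagonal[of a d s b, OF assms(1,2)] upper_lower_bidiagonal[of a' d s b', OF assms(3,4)]
  by (rule bidiagonal_swap)

lemma wishart_profile_bounds:
  assumes g: "0 < g" "g < 1" and that: "0 < t" "t < 1"
  shows "\<bar>wishart_diag_profile g t\<bar> \<le> 2 \<and> \<bar>wishart_offdiag_profile g t\<bar> \<le> 2"
proof -
  have *: "0 \<le> g * t" "g * t \<le> 1" "0 \<le> g * (1 - t)" "g * (1 - t) \<le> 1"
    using that g mult_mono[of g 1 t 1] mult_mono[of g 1 "1 - t" 1] by auto
  moreover have "(1 - g * t) * (g * (1 - t)) \<le> 1 * 1"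
    using * mult_mono[of "1 - g * t" 1 "g * (1 - t)" 1] by simp
  moreover have "0 \<le> (1 - g * t) * (g * (1 - t))"
    using * mult_nonneg_nonneg[of "1 - g * t" "g * (1 - t)"] by simp
  moreover have "sqrt ((1 - g * t) * (g * (1 - t))) \<le> 2"
    using calculation(5) by (intro real_le_lsqrt) simp_all
  ultimately show ?thesis by (simp add: wishart_diag_profile_def wishart_offdiag_profile_def)
qed

text \<open>Exchanging the factors yields constant coefficients and lowers the exponent by one; the missing factor
\<open>x\<close> of the integrand is what cancels the denominator of the density. The total mass, which this does
not reach, is known because the law is a mixture of probability measures.\<close>

lemma marchenko_pastur_spectral_moments:
  assumes g: "0 < g" "g < 1"
  shows "(\<integral>x. x ^ k \<partial>marchenko_pastur_distribution g) =
     (half_line_jacobi (\<lambda>i. if i = 1 then 1 else 1 + g) (\<lambda>_. sqrt g) ^^ k) unit_seq 0"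
proof (cases k)
  case 0
  have "real_distribution (marchenko_pastur_distribution g)"
    unfolding marchenko_pastur_eq_arcsine_mixture[OF g]
    by (rule arcsine_mixture_moments(1)[OF _ _ wishart_profile_bounds[OF g]]) (auto simp: wishart_diag_profile_def wishart_offdiag_profile_def)
  then interpret real_distribution "marchenko_pastur_distribution g" .
  show ?thesis using prob_space[simplified] by (simp add: 0 unit_seq_def)
next
  case (Suc j)
  define f where "f x = (if x \<in> {(1 - sqrt g)\<^sup>2<..<(1 + sqrt g)\<^sup>2}
          then sqrt (((1 + sqrt g)\<^sup>2 - x) * (x - (1 - sqrt g)\<^sup>2)) / (2 * pi * g * x) else 0)" for x
  have R: "((1 + sqrt g)\<^sup>2 - x) * (x - (1 - sqrt g)\<^sup>2) = 4 * (sqrt g)\<^sup>2 - (x - (1 + g))\<^sup>2" for x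
    unfolding marchenko_pastur_discriminant[OF g(1)] using g by (simp add: power2_eq_square algebra_simps)
  have mem: "x \<in> {(1 - sqrt g)\<^sup>2<..<(1 + sqrt g)\<^sup>2} \<longleftrightarrow> 4 * (sqrt g)\<^sup>2 - (x - (1 + g))\<^sup>2 > 0" for x
    unfolding R[symmetric] by (rule mem_open_interval_iff) (use g in \<open>simp add: power2_eq_square algebra_simps\<close>)
  have "(\<integral>x. x ^ k \<partial>marchenko_pastur_distribution g) = (\<integral>x. x ^ k \<partial>density lborel (\<lambda>x. ennreal (f x)))"
    by (simp add: marchenko_pastur_distribution_def f_def Let_def)
  also have "\<dots> = 4 * pi * (1 / (2 * pi * g)) * (sqrt g)\<^sup>2 *
      (\<integral>\<theta>. ((1 + g) + 2 * sqrt g * cos \<theta>) ^ j * (sin \<theta> * sin \<theta>) \<partial>phase)"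
  proof (rule integral_against_semicircle_shape)
    fix x
    show "f x * x ^ k = x ^ j * (if 4 * (sqrt g)\<^sup>2 - (x - (1 + g))\<^sup>2 > 0
        then 1 / (2 * pi * g) * sqrt (4 * (sqrt g)\<^sup>2 - (x - (1 + g))\<^sup>2) else 0)"
    proof (cases "x \<in> {(1 - sqrt g)\<^sup>2<..<(1 + sqrt g)\<^sup>2}")
      case True
      moreover have "x > 0" using True by (metis greaterThanLessThan_iff le_less_trans zero_le_power2)
      moreover have "((1 + sqrt g)\<^sup>2 - x) * (x - (1 - sqrt g)\<^sup>2) > 0"
        using True mem[of x] R[of x] by simp
      ultimately show ?thesis unfolding f_def R[symmetric] Suc
        by (simp only: if_True True) (simp add: mult_ac)
    next
      case False
      then show ?thesis unfolding f_def mem[symmetric]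
        by (simp only: if_False mult_zero_left mult_zero_right)
    qed
    show "f x \<ge> 0"
    proof (cases "x \<in> {(1 - sqrt g)\<^sup>2<..<(1 + sqrt g)\<^sup>2}")
      case True
      moreover have "x > 0" using True by (metis greaterThanLessThan_iff le_less_trans zero_le_power2)
      ultimately show ?thesis unfolding f_def using g by simp
    next
      case False
      then show ?thesis unfolding f_def by (simp only: if_False order_refl)
    qed
    show "f \<in> borel_measurable borel" unfolding f_def by measurable
  qed (use g in auto)
  also have "\<dots> = (half_line_jacobi (\<lambda>_. 1 + g) (\<lambda>_. sqrt g) ^^ j) unit_seq 0"
    using g by (simp add: half_line_jacobi_const_moment)
  also have "\<dots> = (half_line_jacobi (\<lambda>i. if i = 1 then 1 else 1 + g) (\<lambda>_. sqrt g) ^^ k) unit_seq 0"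
    unfolding Suc
    by (subst bidiagonal_swap_coefficients[where d = "\<lambda>_. 1" and s = "\<lambda>_. sqrt g" and a' = "\<lambda>_. 1 + g" and b' = "\<lambda>_. sqrt g"])
       (use g in auto)
  finally show ?thesis .
qed

context manova_parameters
begin

lemma q_r_0: "0 < q 0" "q 0 < 1" "0 < r 0" "r 0 < 1" "(2 + ka + kb) * r 0 = 1"
  using ka kb by (auto simp: q_def r_def D_def)

lemma diag_eq: "t < 1 \<Longrightarrow> diag t = ((D t)\<^sup>2 + ka\<^sup>2 - kb\<^sup>2) / (2 * (D t)\<^sup>2)"
proof -
  assume t: "t < 1"
  define s d where "s = 1 - t" and "d = D t"
  have d: "d > 0" "d = 2 * s + ka + kb" using D_pos[OF t] by (auto simp: s_def d_def D_def)
  have "diag t = ((s + ka) * (s + ka + kb) + s * (s + kb)) / d\<^sup>2"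
    unfolding diag_def complements[OF t] by (simp add: q_def r_def s_def d_def power2_eq_square flip: add_divide_distrib)
  also have "(s + ka) * (s + ka + kb) + s * (s + kb) = (d\<^sup>2 + ka\<^sup>2 - kb\<^sup>2) / 2"
    by (simp add: d(2) power2_eq_square algebra_simps)
  finally show ?thesis by (simp add: d_def)
qed

lemma profile_bounds:
  assumes "0 < t" "t < 1"
  shows "\<bar>diag t\<bar> \<le> 2 \<and> \<bar>offdiag t\<bar> \<le> 2"
proof -
  have q: "0 \<le> q t" "0 \<le> 1 - q t" and r: "0 \<le> r t" "0 \<le> 1 - r t"
    using D_pos[OF assms(2)] ka kb assms(2) unfolding complements[OF assms(2)]
    by (simp_all add: q_def r_def)
  then have "0 \<le> q t * (1 - r t)" "q t * (1 - r t) \<le> 1" "0 \<le> r t * (1 - q t)" "r t * (1 - q t) \<le> 1"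
    using mult_mono[of "q t" 1 "1 - r t" 1] mult_mono[of "r t" 1 "1 - q t" 1] by auto
  moreover from this have "q t * (1 - r t) * (r t * (1 - q t)) \<le> 1"
    using mult_mono[of "q t * (1 - r t)" 1 "r t * (1 - q t)" 1] by simp
  then have "offdiag t \<le> 2" unfolding offdiag_def by (intro real_le_lsqrt) simp_all
  moreover have "offdiag t > 0" using offdiag_square_pos[OF assms(2)] by (simp add: offdiag_def)
  ultimately show ?thesis by (auto simp: diag_def)
qed

lemmas kesten_mckey_moments = arcsine_mixture_moments[OF measurable_profiles(2,3) profile_bounds,
  folded kesten_mckey_eq_arcsine_mixture]

text \<open>An antiderivative of \<open>diag\<close> is \<open>t / 2 + (ka\<^sup>2 - kb\<^sup>2) / (4 D t)\<close>. It is singular at \<open>t = 1\<close> if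
\<open>ka = kb = 0\<close>, but then \<open>diag\<close> is constantly \<open>1 / 2\<close>.\<close>

lemma integral_diag: "(\<integral>t. diag t \<partial>position) = q 0"
proof -
  have eq: "(\<integral>t. diag t \<partial>position) = (\<integral>t. ((D t)\<^sup>2 + ka\<^sup>2 - kb\<^sup>2) / (2 * (D t)\<^sup>2) * indicator {0..1} t \<partial>lborel)"
  proof -
    have "(\<integral>t. diag t \<partial>position) = (\<integral>t. indicator {0<..<1} t * diag t \<partial>lborel)"
      unfolding position_def by (subst integral_uniform_interval) auto
    also have "\<dots> = (\<integral>t. ((D t)\<^sup>2 + ka\<^sup>2 - kb\<^sup>2) / (2 * (D t)\<^sup>2) * indicator {0..1} t \<partial>lborel)"
    proof (rule integral_cong_AE)
      have "AE t in lborel. t \<noteq> 0 \<and> t \<noteq> (1 :: real)" using AE_lborel_singleton by auto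
      then show "AE t in lborel. indicator {0<..<1} t * diag t = ((D t)\<^sup>2 + ka\<^sup>2 - kb\<^sup>2) / (2 * (D t)\<^sup>2) * indicator {0..1} t"
        by eventually_elim (auto simp: indicator_def diag_eq)
    qed measurable
    finally show ?thesis .
  qed
  show ?thesis
  proof (cases "ka + kb = 0")
    case True
    then have k: "ka = 0" "kb = 0" using ka kb by auto
    have "(\<integral>t. diag t \<partial>position) = (\<integral>t. 1/2 * indicator {0..1::real} t \<partial>lborel)"
      unfolding eq
    proof (rule integral_cong_AE)
      have "AE t in lborel. t \<noteq> (1 :: real)" using AE_lborel_singleton by auto
      then show "AE t in lborel. ((D t)\<^sup>2 + ka\<^sup>2 - kb\<^sup>2) / (2 * (D t)\<^sup>2) * indicator {0..1} t = 1/2 * indicator {0..1} t"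
      proof eventually_elim
        case (elim t)
        then show ?case using D_pos[of t] by (auto simp: indicator_def k)
      qed
    qed measurable
    then have "(\<integral>t. diag t \<partial>position) = 1 / 2" by simp
    also have "\<dots> = q 0" unfolding q_def D_def unfolding k by simp
    finally show ?thesis .
  next
    case False
    then have k: "ka + kb > 0" using ka kb by auto
    then have D: "D t > 0" if "t \<le> 1" for t using that by (simp add: D_def)
    define F where "F = (\<lambda>t. t / 2 + (ka\<^sup>2 - kb\<^sup>2) / (4 * D t))"
    have "(\<integral>t. diag t \<partial>position) = F 1 - F 0"
      unfolding eq
    proof (rule integral_FTC_Icc_real)
      show "isCont (\<lambda>t. ((D t)\<^sup>2 + ka\<^sup>2 - kb\<^sup>2) / (2 * (D t)\<^sup>2)) t" if "0 \<le> t" "t \<le> 1" for t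
        using D[OF that(2)] unfolding D_def by (auto intro!: continuous_intros)
      have D': "(D has_real_derivative -2) (at t)" for t
        unfolding D_def[abs_def] by (auto intro!: derivative_eq_intros)
      show "(F has_real_derivative ((D t)\<^sup>2 + ka\<^sup>2 - kb\<^sup>2) / (2 * (D t)\<^sup>2)) (at t)" if "0 \<le> t" "t \<le> 1" for t
        using D[OF that(2)] unfolding F_def
        by (auto intro!: derivative_eq_intros D' simp: field_simps power2_eq_square)
    qed simp
    also have "(ka\<^sup>2 - kb\<^sup>2) / (4 * D 1) = (ka - kb) / 4"
      using k by (simp add: D_def power2_eq_square field_simps)
    then have "F 1 = 1 / 2 + (ka - kb) / 4" by (simp add: F_def)
    also have "1 / 2 + (ka - kb) / 4 - F 0 = q 0"
      using ka kb by (simp add: F_def q_def D_def power2_eq_square divide_simps) (simp add: algebra_simps)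
    finally show ?thesis .
  qed
qed

lemma kesten_mckey_first_moment: "(\<integral>x. x \<partial>kesten_mckey_distribution ka kb) = q 0"
  using kesten_mckey_moments(4)[of 1] bulk_moment_Suc[of _ _ 0 0]
  by (simp add: bulk_moment_0 integral_diag)

text \<open>The factor \<open>x (1 - x)\<close> removes the denominator of the density, so this is a semicircle integral.
Reflection to \<open>1 - x\<close> replaces the coefficients \<open>A\<close>, \<open>B\<close> by \<open>1 - A\<close>, \<open>- B\<close>.\<close>

lemma kesten_mckey_weighted_moments:
  "(\<integral>x. x * (1 - x) * (1 - x) ^ j \<partial>kesten_mckey_distribution ka kb) =
     q 0 * ((1 - q 0) * (1 - r 0) * (half_line_jacobi (\<lambda>_. 1 - diag 0) (\<lambda>_. - offdiag 0) ^^ j) unit_seq 0)"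
proof -
  define n where "n = 2 + ka + kb"
  have n: "n > 0" using ka kb by (simp add: n_def)
  have n0: "D 0 = n" by (simp add: D_def n_def)
  define f where "f x = (if x \<in> {edge_lo<..<edge_hi} then n / (2 * pi) * (sqrt ((x - edge_lo) * (edge_hi - x)) / (x * (1 - x))) else 0)" for x
  have R: "(x - edge_lo) * (edge_hi - x) = 4 * (offdiag 0)\<^sup>2 - (x - diag 0)\<^sup>2" for x
  proof -
    have "4 * (offdiag 0)\<^sup>2 - (x - diag 0)\<^sup>2 = \<phi> x 0 / n\<^sup>2" using discriminant[of 0 x] n0 by simp
    also have "\<phi> x 0 = n\<^sup>2 * ((x - edge_lo) * (edge_hi - x))" using edges_discriminant[of x] by (simp add: n_def)
    finally show ?thesis using n by simp
  qed
  have mem: "x \<in> {edge_lo<..<edge_hi} \<longleftrightarrow> 4 * (offdiag 0)\<^sup>2 - (x - diag 0)\<^sup>2 > 0" for x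
    unfolding R[symmetric] mem_open_interval_iff[OF edges_le] by (simp add: mult.commute)
  have x: "x * (1 - x) > 0" if "x \<in> {edge_lo<..<edge_hi}" for x
  proof (rule ccontr)
    assume "\<not> x * (1 - x) > 0"
    then have "x \<le> 0 \<or> 1 \<le> x" by (metis diff_gt_0_iff_gt mult_pos_pos not_le)
    from \<phi>_nonpos_outside[OF this, of 0] have "n\<^sup>2 * ((x - edge_lo) * (edge_hi - x)) \<le> 0"
      by (simp add: edges_discriminant[symmetric] n_def)
    then show False using that n by (simp add: mult_le_0_iff)
  qed
  have B: "offdiag 0 > 0" using offdiag_square_pos[of 0] by (simp add: offdiag_def)
  have "(\<integral>x. x * (1 - x) * (1 - x) ^ j \<partial>kesten_mckey_distribution ka kb)
      = (\<integral>x. x * (1 - x) * (1 - x) ^ j \<partial>density lborel (\<lambda>x. ennreal (f x)))"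
    unfolding kesten_mckey_distribution_def f_def Let_def edge_lo_def[symmetric] edge_hi_def[symmetric] n_def ..
  also have "\<dots> = 4 * pi * (n / (2 * pi)) * (offdiag 0)\<^sup>2 *
      (\<integral>\<theta>. (1 - (diag 0 + 2 * offdiag 0 * cos \<theta>)) ^ j * (sin \<theta> * sin \<theta>) \<partial>phase)"
  proof (rule integral_against_semicircle_shape[OF B])
    fix x
    show "f x * (x * (1 - x) * (1 - x) ^ j) = (1 - x) ^ j * (if 4 * (offdiag 0)\<^sup>2 - (x - diag 0)\<^sup>2 > 0
        then n / (2 * pi) * sqrt (4 * (offdiag 0)\<^sup>2 - (x - diag 0)\<^sup>2) else 0)"
    proof (cases "x \<in> {edge_lo<..<edge_hi}")
      case True
      moreover have "x \<noteq> 0" "x \<noteq> 1" using x[OF True] by auto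
      ultimately show ?thesis unfolding f_def mem[symmetric] unfolding R[symmetric]
        by (simp only: if_True True) simp
    next
      case False
      then show ?thesis unfolding f_def mem[symmetric] by (simp only: if_False mult_zero_left mult_zero_right)
    qed
    show "f x \<ge> 0"
    proof (cases "x \<in> {edge_lo<..<edge_hi}")
      case True
      then show ?thesis using x[OF True] n by (simp add: f_def del: zero_le_divide_iff)
    next
      case False
      then show ?thesis unfolding f_def by (simp only: if_False order_refl)
    qed
    show "f \<in> borel_measurable borel" unfolding f_def by measurable
  qed measurable
  also have "\<dots> = n * (offdiag 0)\<^sup>2 * (half_line_jacobi (\<lambda>_. 1 - diag 0) (\<lambda>_. - offdiag 0) ^^ j) unit_seq 0"
    by (simp add: half_line_jacobi_const_moment algebra_simps)
  also have "n * (offdiag 0)\<^sup>2 = (n * r 0) * (q 0 * ((1 - q 0) * (1 - r 0)))"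
    using offdiag_square_pos[of 0] by (simp add: offdiag_def)
  also have "n * r 0 = 1" using q_r_0(5) by (simp add: n_def)
  finally show ?thesis by simp
qed

text \<open>A first exchange of factors takes out one \<open>x\<close> and leads to a matrix \<open>C\<close> that has constant coefficients
except in the corner. A second exchange, applied to \<open>E = 1 - C\<close>, takes out one \<open>1 - x\<close> and leads to
constant coefficients. The corner entries \<open>m k j\<close> of \<open>C\<^sup>k E\<^sup>j\<close> and the integrals of
\<open>x\<^sup>k\<^sup>+\<^sup>1 (1 - x)\<^sup>j\<close> satisfy the same recursion
\<open>m (k + 1) j = m k j - m k (j + 1)\<close>. Hence only \<open>k = 0\<close> has to be compared, which is
\<open>kesten_mckey_weighted_moments\<close> for \<open>j > 0\<close> and the first moment for \<open>j = 0\<close>.\<close>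

lemma kesten_mckey_spectral_moments:
  "(\<integral>x. x ^ k \<partial>kesten_mckey_distribution ka kb) =
     (half_line_jacobi (\<lambda>i. if i = 1 then q 0 else diag 0)
        (\<lambda>i. if i = 1 then sqrt (q 0 * (r 0 * (1 - q 0))) else offdiag 0) ^^ k) unit_seq 0"
proof (cases k)
  case 0
  interpret real_distribution "kesten_mckey_distribution ka kb" by (rule kesten_mckey_moments(1))
  show ?thesis using prob_space[simplified] by (simp add: 0 unit_seq_def)
next
  case (Suc k')
  interpret real_distribution "kesten_mckey_distribution ka kb" by (rule kesten_mckey_moments(1))
  let ?\<mu> = "kesten_mckey_distribution ka kb"
  define a where "a i = (if i = 1 then q 0 + r 0 * (1 - q 0) else diag 0)" for i :: nat
  define C where "C = half_line_jacobi a (\<lambda>_. offdiag 0)"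
  define E where "E = half_line_jacobi (\<lambda>i. 1 - a i) (\<lambda>_. - offdiag 0)"
  have CE: "C g = (\<lambda>i. 1 * g i + (-1) * E g i)" for g
    by (auto simp: C_def E_def half_line_jacobi_def algebra_simps)
  define m where "m k j = (C ^^ k) ((E ^^ j) unit_seq) 0" for k j
  have m_step: "m (Suc k) j = m k j - m k (Suc j)" for k j
  proof -
    have "(C ^^ Suc k) g = (\<lambda>i. 1 * (C ^^ k) g i + (-1) * (C ^^ k) (E g) i)" for g
      unfolding funpow_Suc_right o_apply CE[of g] unfolding C_def half_line_jacobi_pow_lincomb ..
    then show ?thesis by (simp add: m_def del: funpow.simps(2)) simp
  qed
  have m_E: "m 0 (Suc j) = (1 - q 0) * (1 - r 0) * (half_line_jacobi (\<lambda>_. 1 - diag 0) (\<lambda>_. - offdiag 0) ^^ j) unit_seq 0" for j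
  proof -
    define Q P where "Q = (1 - q 0) * (1 - r 0)" and "P = q 0 * r 0"
    have QP: "Q \<ge> 0" "P \<ge> 0" "1 - (q 0 + r 0 * (1 - q 0)) = Q" "1 - diag 0 = Q + P"
      using q_r_0 by (simp_all add: Q_def P_def) (simp_all add: diag_def algebra_simps)
    have off: "offdiag 0 = sqrt Q * sqrt P"
      by (simp add: offdiag_def Q_def P_def real_sqrt_mult[symmetric] mult_ac)
    have "m 0 (Suc j) = (sqrt ((1 - q 0) * (1 - r 0)))\<^sup>2 * (half_line_jacobi (\<lambda>_. 1 - diag 0) (\<lambda>_. - offdiag 0) ^^ j) unit_seq 0"
      unfolding m_def E_def funpow_0 Q_def[symmetric]
      by (rule bidiagonal_swap_coefficients[where d = "\<lambda>_. sqrt Q" and s = "\<lambda>_. - sqrt P"])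
         (use QP in \<open>auto simp: a_def off\<close>)
    then show ?thesis using q_r_0 by simp
  qed
  have bd: "AE x in ?\<mu>. \<bar>x\<bar> \<le> 6" using kesten_mckey_moments(2)[of] by simp
  have int: "integrable ?\<mu> (\<lambda>x. x * x ^ k * (1 - x) ^ j)" for k j
  proof (rule integrable_const_bound[where B = "6 * 6 ^ k * 7 ^ j"])
    show "AE x in ?\<mu>. norm (x * x ^ k * (1 - x) ^ j) \<le> 6 * 6 ^ k * 7 ^ j"
      using bd by eventually_elim (auto simp: abs_mult power_abs intro!: mult_mono power_mono)
  qed measurable
  have "(\<integral>x. x * x ^ k * (1 - x) ^ j \<partial>?\<mu>) = q 0 * m k j" for k j
  proof (induction k arbitrary: j)
    case 0
    show ?case
    proof (cases j)
      case 0
      then show ?thesis using kesten_mckey_first_moment by (simp add: m_def unit_seq_def)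
    next
      case (Suc j')
      then show ?thesis using kesten_mckey_weighted_moments[of j'] by (simp add: m_E mult.assoc)
    qed
  next
    case (Suc k)
    have "x * x ^ Suc k * (1 - x) ^ j = x * x ^ k * (1 - x) ^ j - x * x ^ k * (1 - x) ^ Suc j" for x :: real
      by (simp add: algebra_simps)
    then have "(\<integral>x. x * x ^ Suc k * (1 - x) ^ j \<partial>?\<mu>)
        = (\<integral>x. x * x ^ k * (1 - x) ^ j \<partial>?\<mu>) - (\<integral>x. x * x ^ k * (1 - x) ^ Suc j \<partial>?\<mu>)"
      by (simp only: Bochner_Integration.integral_diff[OF int int])
    then show ?case unfolding Suc.IH m_step by (simp add: algebra_simps)
  qed
  from this[of k' 0] have "(\<integral>x. x ^ k \<partial>?\<mu>) = q 0 * m k' 0" by (simp add: Suc)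
  also have "\<dots> = (sqrt (q 0))\<^sup>2 * (C ^^ k') unit_seq 0" using q_r_0 by (simp add: m_def)
  also have "\<dots> = (half_line_jacobi (\<lambda>i. if i = 1 then q 0 else diag 0)
        (\<lambda>i. if i = 1 then sqrt (q 0 * (r 0 * (1 - q 0))) else offdiag 0) ^^ k) unit_seq 0"
    unfolding C_def Suc
    by (subst bidiagonal_swap_coefficients[where d = "\<lambda>i. if i = 0 then sqrt (q 0) else sqrt (q 0 * (1 - r 0))"
          and s = "\<lambda>_. sqrt (r 0 * (1 - q 0))" and a' = a and b' = "\<lambda>_. offdiag 0"])
       (use q_r_0 in \<open>auto simp: a_def diag_def offdiag_def
          real_sqrt_mult[of "q 0" "r 0 * (1 - q 0)"] real_sqrt_mult[of "q 0 * (1 - r 0)" "r 0 * (1 - q 0)"]\<close>)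
  finally show ?thesis .
qed

end

section \<open>Concentration of chi, normal and beta variables\<close>

context prob_space
begin

lemma exponential_markov:
  assumes [measurable]: "Y \<in> borel_measurable M" and E: "(\<integral>\<^sup>+\<omega>. ennreal (exp (Y \<omega>)) \<partial>M) \<le> ennreal e" "e \<ge> 0"
  shows "prob {\<omega>\<in>space M. y \<le> Y \<omega>} \<le> exp (- y) * e"
proof -
  have "emeasure M {\<omega>\<in>space M. 1 \<le> ennreal (exp (-y)) * ennreal (exp (Y \<omega>))}
      \<le> ennreal (exp (-y)) * (\<integral>\<^sup>+\<omega>. ennreal (exp (Y \<omega>)) * indicator (space M) \<omega> \<partial>M)"
    by (rule nn_integral_Markov_inequality) auto
  also have "(\<integral>\<^sup>+\<omega>. ennreal (exp (Y \<omega>)) * indicator (space M) \<omega> \<partial>M) = (\<integral>\<^sup>+\<omega>. ennreal (exp (Y \<omega>)) \<partial>M)"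
    by (rule nn_integral_cong) auto
  also have "ennreal (exp (-y)) * (\<integral>\<^sup>+\<omega>. ennreal (exp (Y \<omega>)) \<partial>M) \<le> ennreal (exp (-y)) * ennreal e"
    by (rule mult_left_mono[OF E(1)]) simp
  also have "\<dots> = ennreal (exp (- y) * e)" by (simp add: ennreal_mult')
  also have "{\<omega>\<in>space M. 1 \<le> ennreal (exp (-y)) * ennreal (exp (Y \<omega>))} = {\<omega>\<in>space M. y \<le> Y \<omega>}"
    by (auto simp: ennreal_mult'[symmetric] exp_add[symmetric])
  finally show ?thesis using E(2) by (simp add: emeasure_eq_measure)
qed

lemma nn_integral_density_eq_1:
  assumes "distributed M lborel X f"
  shows "(\<integral>\<^sup>+x. f x \<partial>lborel) = 1"
  using distributed_nn_integral[OF assms, of "\<lambda>_. 1"] by (simp add: emeasure_space_1)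

text \<open>The factor \<open>exp ((1 - c\<^sup>2) x\<^sup>2 / 2)\<close> turns the density at \<open>x\<close> into a multiple of the density at
\<open>c x\<close>. So the moment follows from the total mass, without any integral of a Gamma type.\<close>

lemma chi_exponential_moment:
  assumes X: "distributed M lborel X (chi_density k)" and c: "c > 0"
  shows "(\<integral>\<^sup>+\<omega>. ennreal (exp ((1 - c\<^sup>2) / 2 * (X \<omega>)\<^sup>2)) \<partial>M) = ennreal (c powr (- k))"
proof -
  have meas[measurable]: "chi_density k \<in> borel_measurable borel"
    unfolding chi_density_def by measurable
  have scale: "chi_density k x * exp ((1 - c\<^sup>2) / 2 * x\<^sup>2) = c powr (1 - k) * chi_density k (c * x)" for x
  proof (cases "x > 0")
    case True
    have "exp (- x\<^sup>2 / 2) * exp ((1 - c\<^sup>2) / 2 * x\<^sup>2) = exp (- (c * x)\<^sup>2 / 2)"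
      by (simp add: exp_add[symmetric] power_mult_distrib field_simps)
    moreover have "c powr (1 - k) * (c * x) powr (k - 1) = x powr (k - 1)"
      using c True by (simp add: powr_mult powr_add[symmetric] mult.assoc[symmetric])
    ultimately show ?thesis using True c
      by (simp add: chi_density_def divide_simps)
  qed (use c in \<open>auto simp: chi_density_def zero_less_mult_iff\<close>)
  have "(\<integral>\<^sup>+\<omega>. ennreal (exp ((1 - c\<^sup>2) / 2 * (X \<omega>)\<^sup>2)) \<partial>M)
      = (\<integral>\<^sup>+x. ennreal (chi_density k x) * ennreal (exp ((1 - c\<^sup>2) / 2 * x\<^sup>2)) \<partial>lborel)"
    by (rule distributed_nn_integral[OF X, symmetric]) simp
  also have "\<dots> = (\<integral>\<^sup>+x. ennreal (c powr (1 - k)) * ennreal (chi_density k (0 + c * x)) \<partial>lborel)"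
  proof (rule nn_integral_cong)
    fix x :: real
    have "ennreal (chi_density k x) * ennreal (exp ((1 - c\<^sup>2) / 2 * x\<^sup>2))
        = ennreal (chi_density k x * exp ((1 - c\<^sup>2) / 2 * x\<^sup>2))"
      by (simp only: ennreal_mult'' exp_ge_zero)
    also have "\<dots> = ennreal (c powr (1 - k)) * ennreal (chi_density k (0 + c * x))"
      by (simp only: scale ennreal_mult' powr_ge_zero add_0)
    finally show "ennreal (chi_density k x) * ennreal (exp ((1 - c\<^sup>2) / 2 * x\<^sup>2))
        = ennreal (c powr (1 - k)) * ennreal (chi_density k (0 + c * x))" .
  qed
  also have "\<dots> = ennreal (c powr (1 - k)) * (\<integral>\<^sup>+x. ennreal (chi_density k (0 + c * x)) \<partial>lborel)"
    by (rule nn_integral_cmult) measurable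
  also have "(\<integral>\<^sup>+x. ennreal (chi_density k (0 + c * x)) \<partial>lborel) = ennreal (1 / c)"
  proof -
    have "1 = ennreal \<bar>c\<bar> * (\<integral>\<^sup>+x. ennreal (chi_density k (0 + c * x)) \<partial>lborel)"
      using nn_integral_real_affine[of "\<lambda>x. ennreal (chi_density k x)" c 0] c nn_integral_density_eq_1[OF X] by simp
    then have "ennreal (1 / c) * 1 = (ennreal (1 / c) * ennreal c) * (\<integral>\<^sup>+x. ennreal (chi_density k (0 + c * x)) \<partial>lborel)"
      using c by (simp add: mult.assoc)
    also have "ennreal (1 / c) * ennreal c = 1" using c by (simp add: ennreal_mult'[symmetric])
    finally show ?thesis by simp
  qed
  also have "ennreal (c powr (1 - k)) * ennreal (1 / c) = ennreal (c powr (1 - k) / c)"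
    by (simp add: ennreal_mult'[symmetric])
  also have "c powr (1 - k) / c = c powr (- k)"
    using c by (simp add: powr_diff powr_minus field_simps)
  finally show ?thesis .
qed

text \<open>Chernoff's bound. It is uniform in \<open>k \<le> L\<close>, including small \<open>k\<close>, where the variable is not close to its
mean on its own scale but is so on the scale \<open>L\<close>.\<close>

lemma chi_square_concentration:
  assumes X: "distributed M lborel X (chi_density k)" and k: "0 \<le> k" "k \<le> L" and e: "0 < e" "e \<le> 2"
  shows "prob {\<omega>\<in>space M. e * L \<le> \<bar>(X \<omega>)\<^sup>2 - k\<bar>} \<le> 2 * exp (- e\<^sup>2 / 16 * L)"
proof -
  have [measurable]: "X \<in> borel_measurable M" using distributed_measurable[OF X] by simp
  \<comment> \<open>The exponent \<open>e / 8\<close> minimises \<open>4 * l\<^sup>2 - e * l\<close>.\<close>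
  define l where "l = e / 8"
  have tail: "prob {\<omega>\<in>space M. s * k + l * e * L \<le> s * (X \<omega>)\<^sup>2} \<le> exp (- e\<^sup>2 / 16 * L)"
    if s: "\<bar>s\<bar> = l" for s
  proof -
    have s4: "\<bar>s\<bar> \<le> 1 / 4" using s e by (simp add: l_def)
    then have "1 - 2 * s > 0" by (auto simp: abs_if split: if_splits)
    then have c: "sqrt (1 - 2 * s) > 0" "(sqrt (1 - 2 * s))\<^sup>2 = 1 - 2 * s" by auto
    have "(\<integral>\<^sup>+\<omega>. ennreal (exp (s * (X \<omega>)\<^sup>2)) \<partial>M) = ennreal (sqrt (1 - 2 * s) powr (- k))"
      using chi_exponential_moment[OF X c(1)] unfolding c(2) by simp
    also have "sqrt (1 - 2 * s) powr (- k) = exp (k * (- ln (1 - 2 * s) / 2))"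
      using c \<open>1 - 2 * s > 0\<close> by (simp add: powr_def ln_sqrt)
    finally have E: "(\<integral>\<^sup>+\<omega>. ennreal (exp (s * (X \<omega>)\<^sup>2)) \<partial>M) = ennreal (exp (k * (- ln (1 - 2 * s) / 2)))" .
    have "\<bar>ln (1 + (- 2 * s)) - (- 2 * s)\<bar> \<le> 2 * (- 2 * s)\<^sup>2"
      using s4 by (intro abs_ln_one_plus_x_minus_x_bound) (auto simp: abs_mult)
    then have "- ln (1 - 2 * s) / 2 \<le> s + 4 * s\<^sup>2" by (simp add: power_mult_distrib abs_if split: if_splits)
    then have "k * (- ln (1 - 2 * s) / 2) \<le> k * (s + 4 * s\<^sup>2)" using k by (intro mult_left_mono) auto
    moreover have "k * (4 * s\<^sup>2) \<le> L * (4 * l\<^sup>2)" using k s by (intro mult_mono) (auto simp: power2_abs[symmetric, of s] simp del: power2_abs)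
    ultimately have "- (s * k + l * e * L) + k * (- ln (1 - 2 * s) / 2) \<le> L * (4 * l\<^sup>2) - l * e * L"
      by (simp add: algebra_simps)
    also have "\<dots> = - e\<^sup>2 / 16 * L" by (simp add: l_def power2_eq_square field_simps)
    finally have le: "exp (- (s * k + l * e * L)) * exp (k * (- ln (1 - 2 * s) / 2)) \<le> exp (- e\<^sup>2 / 16 * L)"
      by (simp add: exp_add[symmetric])
    have "prob {\<omega>\<in>space M. s * k + l * e * L \<le> s * (X \<omega>)\<^sup>2}
        \<le> exp (- (s * k + l * e * L)) * exp (k * (- ln (1 - 2 * s) / 2))"
      by (rule exponential_markov) (simp_all add: E)
    with le show ?thesis by linarith
  qed
  have l: "l > 0" using e by (simp add: l_def)
  have "prob {\<omega>\<in>space M. e * L \<le> \<bar>(X \<omega>)\<^sup>2 - k\<bar>}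
      \<le> prob ({\<omega>\<in>space M. l * k + l * e * L \<le> l * (X \<omega>)\<^sup>2} \<union> {\<omega>\<in>space M. (- l) * k + l * e * L \<le> (- l) * (X \<omega>)\<^sup>2})"
  proof (rule finite_measure_mono)
    show "{\<omega>\<in>space M. e * L \<le> \<bar>(X \<omega>)\<^sup>2 - k\<bar>}
      \<subseteq> {\<omega>\<in>space M. l * k + l * e * L \<le> l * (X \<omega>)\<^sup>2} \<union> {\<omega>\<in>space M. (- l) * k + l * e * L \<le> (- l) * (X \<omega>)\<^sup>2}"
    proof
      fix \<omega> assume w: "\<omega> \<in> {\<omega>\<in>space M. e * L \<le> \<bar>(X \<omega>)\<^sup>2 - k\<bar>}"
      then consider "k + e * L \<le> (X \<omega>)\<^sup>2" | "e * L + (X \<omega>)\<^sup>2 \<le> k" by fastforce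
      then show "\<omega> \<in> {\<omega>\<in>space M. l * k + l * e * L \<le> l * (X \<omega>)\<^sup>2} \<union> {\<omega>\<in>space M. (- l) * k + l * e * L \<le> (- l) * (X \<omega>)\<^sup>2}"
      proof cases
        case 1
        from mult_left_mono[OF this, of l] show ?thesis using w l by (simp add: algebra_simps)
      next
        case 2
        from mult_left_mono[OF this, of l] show ?thesis using w l by (simp add: algebra_simps)
      qed
    qed
  qed measurable
  also have "\<dots> \<le> prob {\<omega>\<in>space M. l * k + l * e * L \<le> l * (X \<omega>)\<^sup>2} + prob {\<omega>\<in>space M. (- l) * k + l * e * L \<le> (- l) * (X \<omega>)\<^sup>2}"
    by (rule measure_Un_le) measurable
  also have "\<dots> \<le> exp (- e\<^sup>2 / 16 * L) + exp (- e\<^sup>2 / 16 * L)"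
    using l by (intro add_mono tail) auto
  finally show ?thesis by simp
qed

text \<open>Markov's inequality for \<open>exp (X\<^sup>2 / 8)\<close>, whose integral compares the density of variance 2 with that of
variance 4.\<close>

lemma normal_tail:
  assumes X: "distributed M lborel X (normal_density 0 (sqrt 2))" and u: "u \<ge> 0"
  shows "prob {\<omega>\<in>space M. u \<le> \<bar>X \<omega>\<bar>} \<le> 2 * exp (- u\<^sup>2 / 8)"
proof -
  have [measurable]: "X \<in> borel_measurable M" using distributed_measurable[OF X] by simp
  have "(\<integral>\<^sup>+\<omega>. ennreal (exp ((X \<omega>)\<^sup>2 / 8)) \<partial>M)
      = (\<integral>\<^sup>+x. ennreal (normal_density 0 (sqrt 2) x) * ennreal (exp (x\<^sup>2 / 8)) \<partial>lborel)"
    by (rule distributed_nn_integral[OF X, symmetric]) simp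
  also have "\<dots> = (\<integral>\<^sup>+x. ennreal (sqrt 2) * ennreal (normal_density 0 2 x) \<partial>lborel)"
  proof (rule nn_integral_cong)
    fix x :: real
    have "exp (- x\<^sup>2 / 4) * exp (x\<^sup>2 / 8) = exp (- x\<^sup>2 / 8)" by (simp add: exp_add[symmetric])
    moreover have "sqrt (8 * pi) = sqrt 2 * sqrt (4 * pi)" using real_sqrt_mult[of 2 "4 * pi"] by simp
    ultimately have "normal_density 0 (sqrt 2) x * exp (x\<^sup>2 / 8) = sqrt 2 * normal_density 0 2 x"
      unfolding normal_density_def by simp
    then show "ennreal (normal_density 0 (sqrt 2) x) * ennreal (exp (x\<^sup>2 / 8)) = ennreal (sqrt 2) * ennreal (normal_density 0 2 x)"
      by (simp add: ennreal_mult'[symmetric])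
  qed
  also have "\<dots> = ennreal (sqrt 2) * (\<integral>\<^sup>+x. ennreal (normal_density 0 2 x) \<partial>lborel)"
    by (rule nn_integral_cmult) simp
  also have "(\<integral>\<^sup>+x. ennreal (normal_density 0 2 x) \<partial>lborel) = 1"
    using prob_space.emeasure_space_1[OF prob_space_normal_density[of 2 0]] by (simp add: emeasure_density)
  finally have "prob {\<omega>\<in>space M. u\<^sup>2 / 8 \<le> (X \<omega>)\<^sup>2 / 8} \<le> exp (- (u\<^sup>2 / 8)) * sqrt 2"
    by (intro exponential_markov) simp_all
  also have "{\<omega>\<in>space M. u\<^sup>2 / 8 \<le> (X \<omega>)\<^sup>2 / 8} = {\<omega>\<in>space M. u \<le> \<bar>X \<omega>\<bar>}"
    using u by (auto simp: abs_le_square_iff[symmetric])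
  also have "exp (- (u\<^sup>2 / 8)) * sqrt 2 \<le> exp (- (u\<^sup>2 / 8)) * 2"
    by (intro mult_left_mono real_le_lsqrt) auto
  finally show ?thesis by (simp add: mult.commute)
qed

end

lemma beta_density_measurable [measurable]: "beta_density r s \<in> borel_measurable borel"
  unfolding beta_density_def by measurable

lemma beta_density_nonneg: "r > 0 \<Longrightarrow> s > 0 \<Longrightarrow> beta_density r s x \<ge> 0"
  by (simp add: beta_density_def Beta_def)

lemma nn_integral_beta_density:
  assumes r: "r > 0" and s: "s > 0"
  shows "(\<integral>\<^sup>+x. ennreal (beta_density r s x) \<partial>lborel) = 1"
proof -
  have B: "Beta r s > 0" using r s by (simp add: Beta_def)
  have "((\<lambda>t. t powr (r - 1) * (1 - t) powr (s - 1) / Beta r s) has_integral (Beta r s / Beta r s)) {0<..<1}"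
    using has_integral_Beta_real[OF r s] by (intro has_integral_divide) (simp add: has_integral_Icc_iff_Ioo)
  then have "((\<lambda>t. if t \<in> {0<..<1} then t powr (r - 1) * (1 - t) powr (s - 1) / Beta r s else 0) has_integral 1) UNIV"
    using B by (simp only: has_integral_restrict_UNIV) simp
  then have "(beta_density r s has_integral 1) UNIV"
    by (simp add: beta_density_def[abs_def] conj_commute)
  from nn_integral_has_integral_lborel[OF _ _ this] show ?thesis using r s by (simp add: beta_density_nonneg)
qed

text \<open>Multiplication by \<open>x\<close> turns the density with parameters \<open>r\<close>, \<open>s\<close> into \<open>r / (r + s)\<close> times the
one with parameters \<open>r + 1\<close>, \<open>s\<close>. So the moment is a product of \<open>h\<close> factors
\<open>(r + i) / (r + s + i)\<close> with \<open>i < h\<close>, which increase with \<open>i\<close>.\<close>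

lemma beta_moment_bound:
  assumes r: "r > 0" and s: "s > 0"
  shows "(\<integral>\<^sup>+x. ennreal (beta_density r s x) * ennreal (x ^ h) \<partial>lborel) \<le> ennreal (((r + h) / (r + s + h)) ^ h)"
  using r
proof (induction h arbitrary: r)
  case 0
  then show ?case using s by (simp add: nn_integral_beta_density)
next
  case (Suc h)
  have step: "beta_density r s x * x = r / (r + s) * beta_density (r + 1) s x" for x
  proof (cases "0 < x \<and> x < 1")
    case True
    have B: "Beta (r + 1) s = r / (r + s) * Beta r s"
      using Beta_plus1_left[of r s] Suc.prems s by (simp add: field_simps nonpos_Ints_def)
    have "beta_density (r + 1) s x = x powr r * (1 - x) powr (s - 1) / (r / (r + s) * Beta r s)"
      using True by (simp add: beta_density_def B)
    moreover have "beta_density r s x * x = x powr r * (1 - x) powr (s - 1) / Beta r s"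
      using True by (simp add: beta_density_def powr_diff)
    moreover have "Beta r s > 0" using Suc.prems s by (simp add: Beta_def)
    ultimately show ?thesis using Suc.prems s by simp
  qed (auto simp: beta_density_def)
  have "(\<integral>\<^sup>+x. ennreal (beta_density r s x) * ennreal (x ^ Suc h) \<partial>lborel)
      = (\<integral>\<^sup>+x. ennreal (r / (r + s)) * (ennreal (beta_density (r + 1) s x) * ennreal (x ^ h)) \<partial>lborel)"
  proof (rule nn_integral_cong)
    fix x :: real
    show "ennreal (beta_density r s x) * ennreal (x ^ Suc h) = ennreal (r / (r + s)) * (ennreal (beta_density (r + 1) s x) * ennreal (x ^ h))"
    proof (cases "0 < x \<and> x < 1")
      case True
      have "beta_density r s x * x ^ Suc h = r / (r + s) * (beta_density (r + 1) s x * x ^ h)"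
        using step[of x] by (simp add: mult.assoc[symmetric])
      then show ?thesis using True Suc.prems s
        by (simp add: ennreal_mult''[symmetric] ennreal_mult'[symmetric] beta_density_nonneg)
    qed (auto simp: beta_density_def)
  qed
  also have "\<dots> = ennreal (r / (r + s)) * (\<integral>\<^sup>+x. ennreal (beta_density (r + 1) s x) * ennreal (x ^ h) \<partial>lborel)"
    by (rule nn_integral_cmult) measurable
  also have "\<dots> \<le> ennreal (r / (r + s)) * ennreal (((r + 1 + h) / (r + 1 + s + h)) ^ h)"
    using Suc.IH[of "r + 1"] Suc.prems by (intro mult_left_mono) auto
  also have "\<dots> = ennreal (r / (r + s) * ((r + 1 + h) / (r + 1 + s + h)) ^ h)"
    using Suc.prems s by (simp add: ennreal_mult'[symmetric])
  also have "\<dots> \<le> ennreal (((r + Suc h) / (r + s + Suc h)) ^ Suc h)"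
  proof (rule ennreal_leI)
    define y where "y = (r + Suc h) / (r + s + Suc h)"
    have y: "(r + 1 + h) / (r + 1 + s + h) = y" by (simp add: y_def algebra_simps)
    have "r / (r + s) \<le> y" "y \<ge> 0"
      using Suc.prems s by (simp_all add: y_def field_simps)
    then show "r / (r + s) * ((r + 1 + h) / (r + 1 + s + h)) ^ h \<le> ((r + Suc h) / (r + s + Suc h)) ^ Suc h"
      unfolding y y_def[symmetric] power_Suc by (intro mult_right_mono) auto
  qed
  finally show ?case .
qed

lemma beta_moment_bound_reflected:
  assumes r: "r > 0" and s: "s > 0"
  shows "(\<integral>\<^sup>+x. ennreal (beta_density r s x) * ennreal ((1 - x) ^ h) \<partial>lborel) \<le> ennreal (((s + h) / (s + r + h)) ^ h)"
proof -
  have "beta_density r s (1 - x) = beta_density s r x" for x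
    by (simp add: beta_density_def Beta_commute mult.commute conj_commute)
  then have "(\<integral>\<^sup>+x. ennreal (beta_density r s x) * ennreal ((1 - x) ^ h) \<partial>lborel)
      = (\<integral>\<^sup>+x. ennreal (beta_density s r x) * ennreal (x ^ h) \<partial>lborel)"
    by (subst nn_integral_real_affine[where c = "-1" and t = 1]) auto
  then show ?thesis using beta_moment_bound[OF s r] by simp
qed

definition uniformly_small :: "(nat \<Rightarrow> 'i set) \<Rightarrow> (nat \<Rightarrow> 'i \<Rightarrow> real) \<Rightarrow> bool" where
  "uniformly_small I z \<longleftrightarrow> (\<forall>e>0. \<forall>\<^sub>F n in sequentially. \<forall>i\<in>I n. \<bar>z n i\<bar> < e)"

context prob_space
begin

text \<open>A substitute for Chernoff's bound with a power instead of the exponential function. An exponent \<open>h\<close> of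
order \<open>e (r + s)\<close> is large enough for decay and small enough for the bound on the \<open>h\<close>-th moment to stay
close to the \<open>h\<close>-th power of the mean.\<close>

lemma beta_upper_tail:
  assumes [measurable]: "Y \<in> borel_measurable M"
    and E: "(\<integral>\<^sup>+\<omega>. ennreal (Y \<omega> ^ h) \<partial>M) \<le> ennreal (((r + h) / (r + s + h)) ^ h)"
    and r: "r > 0" and s: "s > 0" and e: "0 < e" "e \<le> 1" and h: "h = nat \<lfloor>e * (r + s) / 2\<rfloor>"
  shows "prob {\<omega>\<in>space M. r / (r + s) + e \<le> Y \<omega>} \<le> 2 * exp (- e\<^sup>2 / 8 * (r + s))"
proof -
  define \<mu> where "\<mu> = r / (r + s)"
  have \<mu>: "0 \<le> \<mu>" "\<mu> \<le> 1" using r s by (auto simp: \<mu>_def)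
  define x0 where "x0 = \<mu> + e"
  have x0: "0 < x0" "x0 \<le> 2" using \<mu> e by (auto simp: x0_def)
  have h': "real h \<le> e * (r + s) / 2" "e * (r + s) / 2 - 1 \<le> real h" 
  proof -
    have "0 \<le> e * (r + s) / 2" using r s e by simp
    then have "real h = of_int \<lfloor>e * (r + s) / 2\<rfloor>" unfolding h by (simp only: of_nat_nat zero_le_floor)
    then show "real h \<le> e * (r + s) / 2" "e * (r + s) / 2 - 1 \<le> real h" by linarith+
  qed
  \<comment> \<open>Adding \<open>h\<close> to the parameter moves the mean by at most \<open>e / 2\<close>, that is, half of the way to the
    threshold \<open>x0\<close>. As \<open>x0 \<le> 2\<close>, this leaves the factor \<open>1 - e / 4\<close>.\<close>
  have ratio: "(r + h) / (r + s + h) \<le> x0 * (1 - e / 4)"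
  proof -
    have "(r + h) / (r + s + h) \<le> (r + h) / (r + s)" using r s by (intro divide_left_mono) auto
    also have "\<dots> = \<mu> + h / (r + s)" by (simp add: \<mu>_def add_divide_distrib)
    also have "h / (r + s) \<le> e / 2" using h'(1) r s by (simp add: field_simps)
    also have "\<mu> + e / 2 = x0 - e / 2" by (simp add: x0_def)
    also have "x0 * (e / 4) \<le> 2 * (e / 4)" using x0 e by (intro mult_right_mono) auto
    then have "x0 - e / 2 \<le> x0 * (1 - e / 4)" by (simp add: algebra_simps)
    finally show ?thesis by simp
  qed
  have "emeasure M {\<omega>\<in>space M. 1 \<le> ennreal (1 / x0 ^ h) * ennreal (Y \<omega> ^ h)}
      \<le> ennreal (1 / x0 ^ h) * (\<integral>\<^sup>+\<omega>. ennreal (Y \<omega> ^ h) * indicator (space M) \<omega> \<partial>M)"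
    by (rule nn_integral_Markov_inequality) auto
  also have "(\<integral>\<^sup>+\<omega>. ennreal (Y \<omega> ^ h) * indicator (space M) \<omega> \<partial>M) = (\<integral>\<^sup>+\<omega>. ennreal (Y \<omega> ^ h) \<partial>M)"
    by (rule nn_integral_cong) auto
  also have "ennreal (1 / x0 ^ h) * \<dots> \<le> ennreal (1 / x0 ^ h) * ennreal (((r + h) / (r + s + h)) ^ h)"
    by (rule mult_left_mono[OF E]) simp
  also have "\<dots> \<le> ennreal (1 / x0 ^ h) * ennreal ((x0 * (1 - e / 4)) ^ h)"
    using ratio r s by (intro mult_left_mono ennreal_leI power_mono) auto
  also have "\<dots> = ennreal ((1 - e / 4) ^ h)"
    using x0 e by (simp add: ennreal_mult'[symmetric] power_mult_distrib)
  finally have le: "emeasure M {\<omega>\<in>space M. 1 \<le> ennreal (1 / x0 ^ h) * ennreal (Y \<omega> ^ h)} \<le> ennreal ((1 - e / 4) ^ h)" .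
  have "{\<omega>\<in>space M. r / (r + s) + e \<le> Y \<omega>} \<subseteq> {\<omega>\<in>space M. 1 \<le> ennreal (1 / x0 ^ h) * ennreal (Y \<omega> ^ h)}"
  proof
    fix \<omega> assume w: "\<omega> \<in> {\<omega>\<in>space M. r / (r + s) + e \<le> Y \<omega>}"
    then have "x0 ^ h \<le> Y \<omega> ^ h" using x0 by (intro power_mono) (auto simp: x0_def \<mu>_def)
    then have "1 \<le> 1 / x0 ^ h * Y \<omega> ^ h" using x0 by (simp add: field_simps)
    then show "\<omega> \<in> {\<omega>\<in>space M. 1 \<le> ennreal (1 / x0 ^ h) * ennreal (Y \<omega> ^ h)}"
      using w x0 by (simp add: ennreal_mult'[symmetric])
  qed
  then have "emeasure M {\<omega>\<in>space M. r / (r + s) + e \<le> Y \<omega>} \<le> ennreal ((1 - e / 4) ^ h)"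
    by (intro order_trans[OF emeasure_mono le]) measurable
  then have "prob {\<omega>\<in>space M. r / (r + s) + e \<le> Y \<omega>} \<le> (1 - e / 4) ^ h"
    using e by (simp add: emeasure_eq_measure)
  also have "\<dots> \<le> exp (- e / 4) ^ h"
    using e exp_ge_add_one_self[of "- e / 4"] by (intro power_mono) auto
  also have "\<dots> = exp (- e / 4 * h)" by (simp add: exp_of_nat_mult[symmetric] mult.commute)
  also have "\<dots> \<le> exp (- e / 4 * (e * (r + s) / 2 - 1))"
    using h'(2) e by simp
  also have "\<dots> = exp (e / 4) * exp (- e\<^sup>2 / 8 * (r + s))"
    by (simp add: exp_add[symmetric] power2_eq_square field_simps)
  also have "\<dots> \<le> 2 * exp (- e\<^sup>2 / 8 * (r + s))"
  proof (rule mult_right_mono)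
    have "exp (e / 4) \<le> 1 + (e / 4) + (e / 4)\<^sup>2" using e by (intro exp_bound) auto
    also have "(e / 4)\<^sup>2 \<le> (1 / 4)\<^sup>2" using e by (intro power_mono) auto
    finally show "exp (e / 4) \<le> 2" using e by (simp add: power2_eq_square)
  qed simp
  finally show ?thesis .
qed

lemma beta_concentration:
  assumes X: "distributed M lborel X (beta_density r s)" and r: "r > 0" and s: "s > 0" and e: "0 < e" "e \<le> 1"
  shows "prob {\<omega>\<in>space M. e \<le> \<bar>X \<omega> - r / (r + s)\<bar>} \<le> 4 * exp (- e\<^sup>2 / 8 * (r + s))"
proof -
  have [measurable]: "X \<in> borel_measurable M" using distributed_measurable[OF X] by simp
  define h where "h = nat \<lfloor>e * (r + s) / 2\<rfloor>"
  have "(\<integral>\<^sup>+\<omega>. ennreal (X \<omega> ^ h) \<partial>M) \<le> ennreal (((r + h) / (r + s + h)) ^ h)"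
    using beta_moment_bound[OF r s, of h] distributed_nn_integral[OF X, of "\<lambda>x. ennreal (x ^ h)"] by simp
  then have up: "prob {\<omega>\<in>space M. r / (r + s) + e \<le> X \<omega>} \<le> 2 * exp (- e\<^sup>2 / 8 * (r + s))"
    by (intro beta_upper_tail[OF _ _ r s e h_def]) auto
  have "(\<integral>\<^sup>+\<omega>. ennreal ((1 - X \<omega>) ^ h) \<partial>M) \<le> ennreal (((s + h) / (s + r + h)) ^ h)"
    using beta_moment_bound_reflected[OF r s, of h] distributed_nn_integral[OF X, of "\<lambda>x. ennreal ((1 - x) ^ h)"] by simp
  then have lo: "prob {\<omega>\<in>space M. s / (s + r) + e \<le> 1 - X \<omega>} \<le> 2 * exp (- e\<^sup>2 / 8 * (s + r))"
    by (intro beta_upper_tail[OF _ _ s r e]) (auto simp: h_def add.commute)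
  have sr: "s / (s + r) = 1 - r / (r + s)" using r s by (simp add: field_simps)
  have "prob {\<omega>\<in>space M. e \<le> \<bar>X \<omega> - r / (r + s)\<bar>}
      \<le> prob ({\<omega>\<in>space M. r / (r + s) + e \<le> X \<omega>} \<union> {\<omega>\<in>space M. s / (s + r) + e \<le> 1 - X \<omega>})"
    unfolding sr by (rule finite_measure_mono) (auto simp: abs_if split: if_splits)
  also have "\<dots> \<le> prob {\<omega>\<in>space M. r / (r + s) + e \<le> X \<omega>} + prob {\<omega>\<in>space M. s / (s + r) + e \<le> 1 - X \<omega>}"
    by (rule measure_Un_le) measurable
  finally show ?thesis using up lo by (simp add: add.commute)
qed

lemma AE_beta_range:
  assumes X: "distributed M lborel X (beta_density r s)"
  shows "AE \<omega> in M. 0 < X \<omega> \<and> X \<omega> < 1"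
  by (rule distributed_AE2[OF X, THEN iffD2]) (auto simp: beta_density_def)

lemma AE_chi_pos:
  assumes X: "distributed M lborel X (chi_density k)"
  shows "AE \<omega> in M. 0 < X \<omega>"
  by (rule distributed_AE2[OF X, THEN iffD2]) (auto simp: chi_density_def)

text \<open>A union bound and the Borel-Cantelli lemma: the exponential tail pays for the number of variables.\<close>

lemma AE_uniformly_small:
  fixes Z :: "nat \<Rightarrow> 'i \<Rightarrow> 'a \<Rightarrow> real"
  assumes card: "\<And>n. finite (I n)" "\<And>n. card (I n) \<le> 2 * n"
    and rv: "\<And>n i. i \<in> I n \<Longrightarrow> Z n i \<in> borel_measurable M"
    and c: "\<And>e. 0 < e \<Longrightarrow> 0 < c e"
    and tail: "\<And>e n i. 0 < e \<Longrightarrow> e \<le> 1 \<Longrightarrow> N \<le> n \<Longrightarrow> i \<in> I n \<Longrightarrow>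
      prob {\<omega>\<in>space M. e \<le> \<bar>Z n i \<omega>\<bar>} \<le> 4 * exp (- c e * real n)"
  shows "AE \<omega> in M. uniformly_small I (\<lambda>n i. Z n i \<omega>)"
proof -
  have one: "AE \<omega> in M. \<forall>\<^sub>F n in sequentially. \<forall>i\<in>I n. \<bar>Z n i \<omega>\<bar> < e" if e: "0 < e" "e \<le> 1" for e
  proof -
    define A where "A n = (\<Union>i\<in>I n. {\<omega>\<in>space M. e \<le> \<bar>Z n i \<omega>\<bar>})" for n
    have meas: "{\<omega>\<in>space M. e \<le> \<bar>Z n i \<omega>\<bar>} \<in> sets M" if "i \<in> I n" for n i
      using rv[OF that] by measurable
    have "A n \<in> sets M" for n unfolding A_def using card meas by (intro sets.finite_UN) auto
    moreover have "summable (\<lambda>n. prob (A n))"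
    proof (rule summable_comparison_test_ev)
      show "\<forall>\<^sub>F n in sequentially. norm (prob (A n)) \<le> 8 * (real n * exp (- c e * real n))"
        using eventually_ge_at_top[of N]
      proof eventually_elim
        case (elim n)
        have "prob (A n) \<le> (\<Sum>i\<in>I n. prob {\<omega>\<in>space M. e \<le> \<bar>Z n i \<omega>\<bar>})"
          unfolding A_def using card meas by (intro finite_measure_subadditive_finite) auto
        also have "\<dots> \<le> (\<Sum>i\<in>I n. 4 * exp (- c e * real n))" by (intro sum_mono tail e elim)
        also have "\<dots> \<le> (2 * real n) * (4 * exp (- c e * real n))"
          using card(2)[of n] by simp
        finally show ?case by simp
      qed
      have "(\<lambda>n. real n * exp (- c e * real n)) \<in> O(\<lambda>n. 1 / real n ^ 2)" using c[OF e(1)] by real_asymp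
      then have "summable (\<lambda>n. real n * exp (- c e * real n))"
        by (rule summable_comparison_test_bigo[rotated])
           (use inverse_power_summable[of 2, where 'a = real] in \<open>simp add: inverse_eq_divide\<close>)
      then show "summable (\<lambda>n. 8 * (real n * exp (- c e * real n)))" by (rule summable_mult)
    qed
    ultimately have "AE \<omega> in M. \<forall>\<^sub>F n in sequentially. \<omega> \<in> space M - A n"
      by (intro borel_cantelli_AE1) (auto simp: emeasure_eq_measure)
    then show ?thesis
      by eventually_elim (auto simp: A_def not_le elim!: eventually_mono)
  qed
  have "AE \<omega> in M. \<forall>j. \<forall>\<^sub>F n in sequentially. \<forall>i\<in>I n. \<bar>Z n i \<omega>\<bar> < 1 / real (Suc j)"
    unfolding AE_all_countable by (intro allI one) auto
  then show ?thesis
  proof eventually_elim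
    case (elim \<omega>)
    show ?case
      unfolding uniformly_small_def
    proof (intro allI impI)
      fix e :: real assume "e > 0"
      then obtain j where j: "1 / real (Suc j) < e" using nat_approx_posE by blast
      from elim[rule_format, of j] show "\<forall>\<^sub>F n in sequentially. \<forall>i\<in>I n. \<bar>Z n i \<omega>\<bar> < e"
        by eventually_elim (use j in force)
    qed
  qed
qed

end

section \<open>Limits of Jacobi matrices with regular coefficients\<close>

text \<open>The deterministic core. The profiles \<open>A\<close>, \<open>B\<close> govern the eigenvalues and the limits \<open>\<alpha>\<close>, \<open>\<beta>\<close> of
the first rows govern the spectral measure; the hypotheses on \<open>\<mu>\<close> say that both lead to the same law.\<close>

theorem jacobi_weak_limits:
  assumes prof: "follows_profile a A" "follows_profile b B"
    and meas: "A \<in> borel_measurable borel" "B \<in> borel_measurable borel"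
    and C: "\<And>t. 0 < t \<Longrightarrow> t < 1 \<Longrightarrow> \<bar>A t\<bar> \<le> C \<and> \<bar>B t\<bar> \<le> C"
    and K: "\<forall>\<^sub>F n in sequentially. (\<forall>i\<in>{1..n}. \<bar>a n i\<bar> \<le> K) \<and> (\<forall>i\<in>{1..<n}. \<bar>b n i\<bar> \<le> K)"
    and edge: "\<And>i. i \<ge> 1 \<Longrightarrow> (\<lambda>n. a n i) \<longlonglongrightarrow> \<alpha> i" "\<And>i. i \<ge> 1 \<Longrightarrow> (\<lambda>n. b n i) \<longlonglongrightarrow> \<beta> i"
    and \<mu>: "\<mu> = arcsine_mixture A B"
    and spec: "\<And>k. (\<integral>x. x ^ k \<partial>\<mu>) = (half_line_jacobi \<alpha> \<beta> ^^ k) unit_seq 0"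
  shows "converges_weakly (\<lambda>n. empirical_measure (jacobi_matrix n (a n) (b n))) \<mu>"
    and "converges_weakly (\<lambda>n. spectral_measure (jacobi_matrix n (a n) (b n))) \<mu>"
proof -
  have mix: "real_distribution \<mu>" "AE x in \<mu>. \<bar>x\<bar> \<le> 3 * C"
    "(\<lambda>t. bulk_moment (A t) (B t) k 0) \<in> borel_measurable borel"
    "(\<integral>x. x ^ k \<partial>\<mu>) = (\<integral>t. bulk_moment (A t) (B t) k 0 \<partial>position)" for k
    unfolding \<mu> by (rule arcsine_mixture_moments[OF meas C]; assumption)+
  note emp = empirical_measure_moments[OF jacobi_matrix_carrier jacobi_matrix_symmetric]
  note spm = spectral_measure_moments[OF jacobi_matrix_carrier jacobi_matrix_symmetric]
  show "converges_weakly (\<lambda>n. empirical_measure (jacobi_matrix n (a n) (b n))) \<mu>"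
  proof (rule moments_imp_weak_convergence[OF emp(1) mix(1,2) emp(2)])
    fix k
    show "(\<lambda>n. \<integral>x. x ^ k \<partial>empirical_measure (jacobi_matrix n (a n) (b n))) \<longlonglongrightarrow> (\<integral>x. x ^ k \<partial>\<mu>)"
      unfolding mix(4)
      by (rule Lim_transform_eventually[OF trace_average_limit[OF prof K mix(3)]])
         (use eventually_gt_at_top[of 0] in \<open>eventually_elim, simp add: emp(3)\<close>)
  qed
  show "converges_weakly (\<lambda>n. spectral_measure (jacobi_matrix n (a n) (b n))) \<mu>"
  proof (rule moments_imp_weak_convergence[OF spm(1) mix(1,2) spm(2)])
    fix k
    have "(\<lambda>n. (jacobi_matrix n (a n) (b n) ^\<^sub>m k) $$ (0, 0)) \<longlonglongrightarrow> (\<integral>x. x ^ k \<partial>\<mu>)"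
      unfolding spec by (rule jacobi_pow_edge_limit[OF edge])
    then show "(\<lambda>n. \<integral>x. x ^ k \<partial>spectral_measure (jacobi_matrix n (a n) (b n))) \<longlonglongrightarrow> (\<integral>x. x ^ k \<partial>\<mu>)"
      by (rule Lim_transform_eventually)
         (use eventually_gt_at_top[of 0] in \<open>eventually_elim, simp add: spm(3)\<close>)
  qed
qed

lemma uniformly_small_subset:
  assumes "uniformly_small I z" "\<And>n. J n \<subseteq> I n"
  shows "uniformly_small J z"
  unfolding uniformly_small_def
proof (intro allI impI)
  fix e :: real assume "e > 0"
  with assms(1) have "\<forall>\<^sub>F n in sequentially. \<forall>i\<in>I n. \<bar>z n i\<bar> < e" by (simp add: uniformly_small_def)
  then show "\<forall>\<^sub>F n in sequentially. \<forall>i\<in>J n. \<bar>z n i\<bar> < e" by eventually_elim (use assms(2) in blast)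
qed

lemma tendsto_of_uniformly_small:
  assumes small: "uniformly_small I (\<lambda>n i. x n i - m n i)"
    and i: "\<forall>\<^sub>F n in sequentially. i n \<in> I n" and m: "(\<lambda>n. m n (i n)) \<longlonglongrightarrow> l"
  shows "(\<lambda>n. x n (i n)) \<longlonglongrightarrow> l"
proof -
  have "(\<lambda>n. x n (i n) - m n (i n)) \<longlonglongrightarrow> 0"
  proof (rule tendstoI)
    fix e :: real assume "e > 0"
    with small have "\<forall>\<^sub>F n in sequentially. \<forall>i\<in>I n. \<bar>x n i - m n i\<bar> < e"
      by (simp add: uniformly_small_def)
    with i show "\<forall>\<^sub>F n in sequentially. dist (x n (i n) - m n (i n)) 0 < e"
      by eventually_elim (simp add: dist_real_def)
  qed
  from tendsto_add[OF this m] show ?thesis by simp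
qed

lemma uniformly_small_eventually_bounded:
  assumes small: "uniformly_small I (\<lambda>n i. x n i - m n i)"
    and m: "\<forall>\<^sub>F n in sequentially. \<forall>i\<in>I n. m n i \<le> 1"
  shows "\<forall>\<^sub>F n in sequentially. \<forall>i\<in>I n. x n i \<le> 2"
proof -
  have "\<forall>\<^sub>F n in sequentially. \<forall>i\<in>I n. \<bar>x n i - m n i\<bar> < 1"
    using small by (simp add: uniformly_small_def)
  with m show ?thesis by eventually_elim force
qed

lemma eventually_interior_index:
  assumes "(\<lambda>n. real (i n) / real n) \<longlonglongrightarrow> t" "0 < t" "t < 1"
  shows "\<forall>\<^sub>F n in sequentially. 1 < i n \<and> i n < n" "(\<lambda>n. real (i n - 1) / real n) \<longlonglongrightarrow> t"
proof -
  show "\<forall>\<^sub>F n in sequentially. 1 < i n \<and> i n < n"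
    using shifted_ratio(2)[OF assms, of 0] shifted_ratio(2)[OF assms, of "-1"] by eventually_elim auto
  have "nat (int (i n) + - 1) = i n - 1" for n by simp
  then show "(\<lambda>n. real (i n - 1) / real n) \<longlonglongrightarrow> t" using shifted_ratio(1)[OF assms, of "-1"] by simp
qed

lemma weakly_converges_almost_surelyI:
  assumes "AE \<omega> in M. Q \<omega>" and Q: "\<And>\<omega>. Q \<omega> \<Longrightarrow> converges_weakly (\<lambda>n. \<nu> n \<omega>) \<mu>"
  shows "weakly_converges_almost_surely M \<nu> \<mu>"
  unfolding weakly_converges_almost_surely_def
proof (intro allI impI)
  fix f :: "real \<Rightarrow> real" assume f: "continuous_on UNIV f \<and> bounded (range f)"
  show "AE \<omega> in M. (\<lambda>n. \<integral>x. f x \<partial>\<nu> n \<omega>) \<longlonglongrightarrow> (\<integral>x. f x \<partial>\<mu>)"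
    using assms(1) by eventually_elim (use f Q in \<open>auto simp: converges_weakly_def\<close>)
qed

lemma distributed_scaledD:
  assumes "distributed M lborel (\<lambda>\<omega>. c * X \<omega>) f" "c \<noteq> (0 :: real)"
  shows "X \<in> borel_measurable M"
proof -
  have "(\<lambda>\<omega>. c * X \<omega>) \<in> borel_measurable M" using distributed_measurable[OF assms(1)] by simp
  then have "(\<lambda>\<omega>. (c * X \<omega>) / c) \<in> borel_measurable M" by measurable
  then show ?thesis using assms(2) by simp
qed

lemma (in prob_space) scaled_chi_square_concentration:
  assumes X: "distributed M lborel (\<lambda>\<omega>. sqrt L * X \<omega>) (chi_density k)"
    and k: "0 \<le> k" "k \<le> L" and L: "L > 0" and e: "0 < e" "e \<le> 1"
  shows "prob {\<omega>\<in>space M. e \<le> \<bar>(X \<omega>)\<^sup>2 - k / L\<bar>} \<le> 2 * exp (- e\<^sup>2 / 16 * L)"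
proof -
  have "e * L \<le> \<bar>(sqrt L * X \<omega>)\<^sup>2 - k\<bar> \<longleftrightarrow> e \<le> \<bar>(X \<omega>)\<^sup>2 - k / L\<bar>" for \<omega>
  proof -
    have "(sqrt L * X \<omega>)\<^sup>2 - k = L * ((X \<omega>)\<^sup>2 - k / L)"
      using L by (simp add: power_mult_distrib field_simps)
    then show ?thesis using L by (simp add: abs_mult mult.commute)
  qed
  then show ?thesis using chi_square_concentration[OF X k, of e] e by simp
qed

lemma AE_scaled_chi_pos:
  assumes "distributed M lborel (\<lambda>\<omega>. sqrt L * X \<omega>) (chi_density k)" "L > 0" "prob_space M"
  shows "AE \<omega> in M. 0 < X \<omega>"
  using prob_space.AE_chi_pos[OF assms(3,1)]
  by eventually_elim (use assms(2) in \<open>simp add: zero_less_mult_iff\<close>)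

section \<open>Gaussian ensembles\<close>

definition gaussian_regular :: "(nat \<Rightarrow> nat \<Rightarrow> real) \<Rightarrow> (nat \<Rightarrow> nat \<Rightarrow> real) \<Rightarrow> bool" where
  "gaussian_regular a b \<longleftrightarrow> uniformly_small (\<lambda>n. {1..n}) (\<lambda>n i. a n i - 0)
     \<and> uniformly_small (\<lambda>n. {1..<n}) (\<lambda>n i. (b n i)\<^sup>2 - (real n - real i) / real n)
     \<and> (\<forall>n. \<forall>i\<in>{1..<n}. b n i > 0)"

lemma AE_gaussian_regular:
  assumes \<beta>: "\<beta> > 0" and G: "gaussian_beta_entries M \<beta> a b"
  shows "AE \<omega> in M. gaussian_regular (\<lambda>n i. a n i \<omega>) (\<lambda>n i. b n i \<omega>)"
proof -
  interpret prob_space M using G by (simp add: gaussian_beta_entries_def)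
  have a: "distributed M lborel (\<lambda>\<omega>. sqrt (real n * \<beta>) * a n i \<omega>) (normal_density 0 (sqrt 2))" if "i \<in> {1..n}" for n i
    using G that by (auto simp: gaussian_beta_entries_def)
  have b: "distributed M lborel (\<lambda>\<omega>. sqrt (real n * \<beta>) * b n i \<omega>) (chi_density ((real n - real i) * \<beta>))" if "i \<in> {1..<n}" for n i
    using G that by (auto simp: gaussian_beta_entries_def)
  have n0: "sqrt (real n * \<beta>) > 0" if "n > 0" for n using that \<beta> by simp
  have "AE \<omega> in M. uniformly_small (\<lambda>n. {1..n}) (\<lambda>n i. a n i \<omega> - 0)"
  proof (rule AE_uniformly_small[where c = "\<lambda>e. e\<^sup>2 * \<beta> / 8" and N = 0])
    show "(\<lambda>\<omega>. a n i \<omega> - 0) \<in> borel_measurable M" if "i \<in> {1..n}" for n i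
      using distributed_scaledD[OF a[OF that]] n0[of n] that \<beta> by simp
    fix e :: real and n i :: nat assume e: "0 < e" "e \<le> 1" and i: "i \<in> {1..n}"
    then have "n > 0" by simp
    have "prob {\<omega>\<in>space M. e * sqrt (real n * \<beta>) \<le> \<bar>sqrt (real n * \<beta>) * a n i \<omega>\<bar>} \<le> 2 * exp (- (e * sqrt (real n * \<beta>))\<^sup>2 / 8)"
      using e n0[OF \<open>n > 0\<close>] by (intro normal_tail[OF a[OF i]]) simp
    also have "{\<omega>\<in>space M. e * sqrt (real n * \<beta>) \<le> \<bar>sqrt (real n * \<beta>) * a n i \<omega>\<bar>} = {\<omega>\<in>space M. e \<le> \<bar>a n i \<omega> - 0\<bar>}"
      using n0[OF \<open>n > 0\<close>] by (auto simp: abs_mult mult.commute)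
    also have "(e * sqrt (real n * \<beta>))\<^sup>2 = e\<^sup>2 * \<beta> * real n" using \<beta> by (simp add: power_mult_distrib)
    finally show "prob {\<omega>\<in>space M. e \<le> \<bar>a n i \<omega> - 0\<bar>} \<le> 4 * exp (- (e\<^sup>2 * \<beta> / 8) * real n)"
      by (rule order_trans) simp
  qed (use \<beta> in auto)
  moreover have "AE \<omega> in M. uniformly_small (\<lambda>n. {1..<n}) (\<lambda>n i. (b n i \<omega>)\<^sup>2 - (real n - real i) / real n)"
  proof (rule AE_uniformly_small[where c = "\<lambda>e. e\<^sup>2 * \<beta> / 16" and N = 0])
    show "(\<lambda>\<omega>. (b n i \<omega>)\<^sup>2 - (real n - real i) / real n) \<in> borel_measurable M" if "i \<in> {1..<n}" for n i
      using distributed_scaledD[OF b[OF that]] n0[of n] that \<beta> by simp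
    fix e :: real and n i :: nat assume e: "0 < e" "e \<le> 1" and i: "i \<in> {1..<n}"
    have "prob {\<omega>\<in>space M. e \<le> \<bar>(b n i \<omega>)\<^sup>2 - (real n - real i) * \<beta> / (real n * \<beta>)\<bar>} \<le> 2 * exp (- e\<^sup>2 / 16 * (real n * \<beta>))"
      using e i \<beta> by (intro scaled_chi_square_concentration[OF b[OF i]]) auto
    also have "\<dots> \<le> 4 * exp (- (e\<^sup>2 * \<beta> / 16) * real n)" by (simp add: mult_ac)
    finally show "prob {\<omega>\<in>space M. e \<le> \<bar>(b n i \<omega>)\<^sup>2 - (real n - real i) / real n\<bar>} \<le> 4 * exp (- (e\<^sup>2 * \<beta> / 16) * real n)"
      using \<beta> by simp
  qed (use \<beta> in auto)
  moreover have "AE \<omega> in M. \<forall>n. \<forall>i\<in>{1..<n}. b n i \<omega> > 0"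
    unfolding AE_all_countable
    by (intro allI AE_finite_allI AE_scaled_chi_pos[OF b]) (use \<beta> in \<open>auto intro: prob_space_axioms\<close>)
  ultimately show ?thesis unfolding gaussian_regular_def by eventually_elim blast
qed

lemma gaussian_limits:
  assumes "gaussian_regular a b"
  shows "converges_weakly (\<lambda>n. empirical_measure (jacobi_matrix n (a n) (b n))) semicircle_distribution"
    and "converges_weakly (\<lambda>n. spectral_measure (jacobi_matrix n (a n) (b n))) semicircle_distribution"
proof -
  have a: "uniformly_small (\<lambda>n. {1..n}) (\<lambda>n i. a n i - 0)"
    and b: "uniformly_small (\<lambda>n. {1..<n}) (\<lambda>n i. (b n i)\<^sup>2 - (real n - real i) / real n)"
    and pos: "\<And>n i. i \<in> {1..<n} \<Longrightarrow> b n i > 0"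
    using assms by (auto simp: gaussian_regular_def)
  have b_lim: "(\<lambda>n. b n (i n)) \<longlonglongrightarrow> sqrt l"
    if i: "\<forall>\<^sub>F n in sequentially. i n \<in> {1..<n}" and l: "(\<lambda>n. (real n - real (i n)) / real n) \<longlonglongrightarrow> l" for i l
  proof (rule Lim_transform_eventually)
    show "(\<lambda>n. sqrt ((b n (i n))\<^sup>2)) \<longlonglongrightarrow> sqrt l"
      by (rule tendsto_real_sqrt[OF tendsto_of_uniformly_small[OF b i l]])
    show "\<forall>\<^sub>F n in sequentially. sqrt ((b n (i n))\<^sup>2) = b n (i n)"
      using i by eventually_elim (use pos in \<open>force intro: less_imp_le\<close>)
  qed
  have a_lim: "(\<lambda>n. a n (i n)) \<longlonglongrightarrow> 0" if "\<forall>\<^sub>F n in sequentially. i n \<in> {1..n}" for i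
    by (rule tendsto_of_uniformly_small[OF a that tendsto_const])
  have "follows_profile a (\<lambda>_. 0)"
    unfolding follows_profile_def
    by (auto intro!: a_lim eventually_mono[OF eventually_interior_index(1)])
  moreover have "follows_profile b (\<lambda>t. sqrt (1 - t))"
    unfolding follows_profile_def
  proof (intro ballI allI impI b_lim)
    fix t i assume t: "t \<in> {0<..<1}" "(\<lambda>n. real (i n) / real n) \<longlonglongrightarrow> (t :: real)"
    then show "\<forall>\<^sub>F n in sequentially. i n \<in> {1..<n}"
      by (auto intro!: eventually_mono[OF eventually_interior_index(1)[of i t]])
    have "(\<lambda>n. 1 - real (i n) / real n) \<longlonglongrightarrow> 1 - t" by (intro tendsto_intros t)
    then show "(\<lambda>n. (real n - real (i n)) / real n) \<longlonglongrightarrow> 1 - t"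
      by (rule Lim_transform_eventually)
         (use eventually_gt_at_top[of 0] in \<open>eventually_elim, simp add: diff_divide_distrib\<close>)
  qed
  moreover have "\<forall>\<^sub>F n in sequentially. (\<forall>i\<in>{1..n}. \<bar>a n i\<bar> \<le> 2) \<and> (\<forall>i\<in>{1..<n}. \<bar>b n i\<bar> \<le> 2)"
  proof -
    have "\<forall>\<^sub>F n in sequentially. \<forall>i\<in>{1..n}. \<bar>a n i - 0\<bar> < 1"
      using a by (simp add: uniformly_small_def)
    moreover have "\<forall>\<^sub>F n in sequentially. \<forall>i\<in>{1..<n}. (b n i)\<^sup>2 \<le> 2"
      by (rule uniformly_small_eventually_bounded[OF b]) (auto simp: field_simps)
    ultimately show ?thesis
    proof eventually_elim
      case (elim n)
      have "\<bar>b n i\<bar> \<le> 2" if "i \<in> {1..<n}" for i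
      proof -
        have "(b n i)\<^sup>2 \<le> 2\<^sup>2" using elim that by fastforce
        then show ?thesis by (simp only: abs_le_square_iff[symmetric] abs_numeral)
      qed
      then show ?case using elim by force
    qed
  qed
  moreover have "(\<lambda>n. a n i) \<longlonglongrightarrow> 0" if "i \<ge> 1" for i
    using that by (intro a_lim) (use eventually_ge_at_top[of i] in \<open>auto elim!: eventually_mono\<close>)
  moreover have "(\<lambda>n. b n i) \<longlonglongrightarrow> 1" if "i \<ge> 1" for i
  proof -
    have "(\<lambda>n. (real n - real i) / real n) \<longlonglongrightarrow> 1" by real_asymp
    from b_lim[OF _ this] show ?thesis
      using that eventually_gt_at_top[of i] by (auto elim!: eventually_mono)
  qed
  moreover have "\<bar>0 :: real\<bar> \<le> 1 \<and> \<bar>sqrt (1 - t)\<bar> \<le> 1" if "0 < t" "t < 1" for t :: real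
    using that by simp
  ultimately show "converges_weakly (\<lambda>n. empirical_measure (jacobi_matrix n (a n) (b n))) semicircle_distribution"
    "converges_weakly (\<lambda>n. spectral_measure (jacobi_matrix n (a n) (b n))) semicircle_distribution"
    using jacobi_weak_limits[where a = a and b = b and A = "\<lambda>_. 0" and B = "\<lambda>t. sqrt (1 - t)" and K = 2 and C = 1,
        OF _ _ _ _ _ _ _ _ semicircle_eq_arcsine_mixture semicircle_spectral_moments] by auto
qed

theorem gaussian_beta_weak_limits:
  assumes "\<beta> > 0" "gaussian_beta_entries M \<beta> a b"
  shows "weakly_converges_almost_surely M
          (\<lambda>n \<omega>. empirical_measure (jacobi_matrix n (\<lambda>i. a n i \<omega>) (\<lambda>i. b n i \<omega>))) semicircle_distribution"
    and "weakly_converges_almost_surely M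
          (\<lambda>n \<omega>. spectral_measure (jacobi_matrix n (\<lambda>i. a n i \<omega>) (\<lambda>i. b n i \<omega>))) semicircle_distribution"
  by (rule weakly_converges_almost_surelyI[OF AE_gaussian_regular[OF assms]], erule gaussian_limits)+

section \<open>Wishart ensembles\<close>

definition wishart_diag :: "(nat \<Rightarrow> real) \<Rightarrow> (nat \<Rightarrow> real) \<Rightarrow> nat \<Rightarrow> real" where
  "wishart_diag d s i = (d i)\<^sup>2 + (if i > 1 then (s (i - 1))\<^sup>2 else 0)"

lemma wishart_matrix_eq_jacobi_matrix:
  "wishart_matrix n d s = jacobi_matrix n (wishart_diag d s) (\<lambda>i. d i * s i)" (is "_ = ?J")
proof (rule eq_matI)
  fix i j assume "i < dim_row ?J" "j < dim_col ?J"
  then have ij: "i < n" "j < n" by auto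
  define B where "B i k = (if i = k then d (i + 1) else if i = k + 1 then s (k + 1) else 0)" for i k
  have "wishart_matrix n d s $$ (i, j) = (\<Sum>k<n. B i k * B j k)"
    using ij by (simp add: wishart_matrix_def lower_bidiagonal_matrix_def scalar_prod_def lessThan_atLeast0 B_def)
  also have "\<dots> = (\<Sum>k<n. (if k = i then d (i + 1) * B j i else 0) + (if i > 0 \<and> k = i - 1 then s i * B j (i - 1) else 0))"
    by (rule sum.cong) (auto simp: B_def)
  also have "\<dots> = d (i + 1) * B j i + (if i > 0 then s i * B j (i - 1) else 0)"
    using ij by (cases "i = 0") (simp_all add: sum.distrib)
  also have "\<dots> = ?J $$ (i, j)"
  proof -
    consider "i = j" | "j = i + 1" | "i = j + 1" | "i \<noteq> j" "j \<noteq> i + 1" "i \<noteq> j + 1" by blast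
    then show ?thesis
    proof cases
      case 1
      then show ?thesis
        using ij unfolding 1 by (cases j) (simp_all add: jacobi_matrix_def wishart_diag_def B_def power2_eq_square)
    next
      case 2
      then show ?thesis using ij by (cases i) (simp_all add: jacobi_matrix_def B_def)
    next
      case 3
      then show ?thesis using ij by (simp add: jacobi_matrix_def B_def)
    next
      case 4
      then show ?thesis using ij by (cases i) (auto simp: jacobi_matrix_def B_def)
    qed
  qed
  finally show "wishart_matrix n d s $$ (i, j) = ?J $$ (i, j)" .
qed (auto simp: wishart_matrix_def lower_bidiagonal_matrix_def)

definition wishart_regular :: "(nat \<Rightarrow> real) \<Rightarrow> (nat \<Rightarrow> nat \<Rightarrow> real) \<Rightarrow> (nat \<Rightarrow> nat \<Rightarrow> real) \<Rightarrow> bool" where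
  "wishart_regular m d s \<longleftrightarrow>
     uniformly_small (\<lambda>n. {1..n}) (\<lambda>n i. (d n i)\<^sup>2 - (m n - real i + 1) / m n)
     \<and> uniformly_small (\<lambda>n. {1..<n}) (\<lambda>n i. (s n i)\<^sup>2 - (real n - real i) / m n)
     \<and> (\<forall>n. \<forall>i\<in>{1..n}. d n i > 0) \<and> (\<forall>n. \<forall>i\<in>{1..<n}. s n i > 0)"

lemma AE_wishart_regular:
  assumes \<beta>: "\<beta> > 0" and m: "\<forall>n\<ge>1. m n > real n - 1" and W: "wishart_beta_entries M \<beta> m d s"
  shows "AE \<omega> in M. wishart_regular m (\<lambda>n i. d n i \<omega>) (\<lambda>n i. s n i \<omega>)"
proof -
  interpret prob_space M using W by (simp add: wishart_beta_entries_def)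
  have d: "distributed M lborel (\<lambda>\<omega>. sqrt (m n * \<beta>) * d n i \<omega>) (chi_density (\<beta> * (m n - real i + 1)))" if "i \<in> {1..n}" for n i
    using W that by (auto simp: wishart_beta_entries_def)
  have s: "distributed M lborel (\<lambda>\<omega>. sqrt (m n * \<beta>) * s n i \<omega>) (chi_density (\<beta> * (real n - real i)))" if "i \<in> {1..<n}" for n i
    using W that by (auto simp: wishart_beta_entries_def)
  have m0: "m n > 0" "m n > real n - 1" if "i \<in> {1..n}" for n i
    using m[rule_format, of n] that by auto
  have mb: "m n * \<beta> > 0" if "n \<ge> 1" for n using m0(1)[of 1 n] that \<beta> by simp
  \<comment> \<open>Since \<open>m > n - 1 \<ge> n / 2\<close>, exponential decay in \<open>m\<close> is exponential decay in \<open>n\<close>.\<close>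
  have decay: "x \<le> 4 * exp (- (e\<^sup>2 * \<beta> / 32) * real n)"
    if x: "x \<le> 2 * exp (- e\<^sup>2 / 16 * (m n * \<beta>))" and n: "n \<ge> 2" for x e n
  proof -
    have "real n / 2 \<le> m n" using m[rule_format, of n] n by auto
    then have "e\<^sup>2 * \<beta> / 16 * (real n / 2) \<le> e\<^sup>2 * \<beta> / 16 * m n" using \<beta> by (intro mult_left_mono) auto
    then have "exp (- e\<^sup>2 / 16 * (m n * \<beta>)) \<le> exp (- (e\<^sup>2 * \<beta> / 32) * real n)" by (simp add: mult_ac)
    moreover have "0 \<le> exp (- (e\<^sup>2 * \<beta> / 32) * real n)" by simp
    ultimately show ?thesis using x by linarith
  qed
  have cancel: "\<beta> * x / (m n * \<beta>) = x / m n" for x n using \<beta> by simp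
  have "AE \<omega> in M. uniformly_small (\<lambda>n. {1..n}) (\<lambda>n i. (d n i \<omega>)\<^sup>2 - (m n - real i + 1) / m n)"
  proof (rule AE_uniformly_small[where c = "\<lambda>e. e\<^sup>2 * \<beta> / 32" and N = 2])
    show "(\<lambda>\<omega>. (d n i \<omega>)\<^sup>2 - (m n - real i + 1) / m n) \<in> borel_measurable M" if "i \<in> {1..n}" for n i
      using distributed_scaledD[OF d[OF that]] m0(1)[OF that] \<beta> by simp
    fix e :: real and n i :: nat assume e: "0 < e" "e \<le> 1" and n: "2 \<le> n" and i: "i \<in> {1..n}"
    show "prob {\<omega>\<in>space M. e \<le> \<bar>(d n i \<omega>)\<^sup>2 - (m n - real i + 1) / m n\<bar>} \<le> 4 * exp (- (e\<^sup>2 * \<beta> / 32) * real n)"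
    proof (rule decay[OF scaled_chi_square_concentration[OF d[OF i], unfolded cancel] n])
      have "real i \<le> real n" "1 \<le> real i" using i by auto
      then have "0 \<le> m n - real i + 1" "m n - real i + 1 \<le> m n" using m0(2)[OF i] by linarith+
      then show "0 \<le> \<beta> * (m n - real i + 1)" "\<beta> * (m n - real i + 1) \<le> m n * \<beta>"
        using \<beta> by (simp_all add: mult.commute mult_left_mono)
    qed (use e \<beta> m0[OF i] in auto)
  qed (use \<beta> in auto)
  moreover have "AE \<omega> in M. uniformly_small (\<lambda>n. {1..<n}) (\<lambda>n i. (s n i \<omega>)\<^sup>2 - (real n - real i) / m n)"
  proof (rule AE_uniformly_small[where c = "\<lambda>e. e\<^sup>2 * \<beta> / 32" and N = 2])
    show "(\<lambda>\<omega>. (s n i \<omega>)\<^sup>2 - (real n - real i) / m n) \<in> borel_measurable M" if "i \<in> {1..<n}" for n i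
      using distributed_scaledD[OF s[OF that]] m0(1)[of i n] that \<beta> by simp
    fix e :: real and n i :: nat assume e: "0 < e" "e \<le> 1" and n: "2 \<le> n" and i: "i \<in> {1..<n}"
    show "prob {\<omega>\<in>space M. e \<le> \<bar>(s n i \<omega>)\<^sup>2 - (real n - real i) / m n\<bar>} \<le> 4 * exp (- (e\<^sup>2 * \<beta> / 32) * real n)"
    proof (rule decay[OF scaled_chi_square_concentration[OF s[OF i], unfolded cancel] n])
      have "0 \<le> real n - real i" "real n - real i \<le> m n" using m0(2)[of i n] i by auto
      then show "0 \<le> \<beta> * (real n - real i)" "\<beta> * (real n - real i) \<le> m n * \<beta>"
        using \<beta> by (simp_all add: mult.commute mult_left_mono)
    qed (use e \<beta> m0[of i n] i in auto)
  qed (use \<beta> in auto)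
  moreover have "AE \<omega> in M. \<forall>n. \<forall>i\<in>{1..n}. d n i \<omega> > 0"
    unfolding AE_all_countable
    by (intro allI AE_finite_allI AE_scaled_chi_pos[OF d]) (auto intro!: prob_space_axioms mb)
  moreover have "AE \<omega> in M. \<forall>n. \<forall>i\<in>{1..<n}. s n i \<omega> > 0"
    unfolding AE_all_countable
    by (intro allI AE_finite_allI AE_scaled_chi_pos[OF s]) (auto intro!: prob_space_axioms mb)
  ultimately show ?thesis unfolding wishart_regular_def by eventually_elim blast
qed

lemma wishart_limits:
  assumes reg: "wishart_regular m d s"
    and m: "\<forall>n\<ge>1. m n > real n - 1" and g: "(\<lambda>n. real n / m n) \<longlonglongrightarrow> g" "0 < g" "g < 1"
  shows "converges_weakly (\<lambda>n. empirical_measure (wishart_matrix n (d n) (s n))) (marchenko_pastur_distribution g)"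
    and "converges_weakly (\<lambda>n. spectral_measure (wishart_matrix n (d n) (s n))) (marchenko_pastur_distribution g)"
proof -
  have d: "uniformly_small (\<lambda>n. {1..n}) (\<lambda>n i. (d n i)\<^sup>2 - (m n - real i + 1) / m n)"
    and s: "uniformly_small (\<lambda>n. {1..<n}) (\<lambda>n i. (s n i)\<^sup>2 - (real n - real i) / m n)"
    and pos: "\<And>n i. i \<in> {1..n} \<Longrightarrow> d n i > 0" "\<And>n i. i \<in> {1..<n} \<Longrightarrow> s n i > 0"
    using reg by (auto simp: wishart_regular_def)
  define a where "a n = wishart_diag (d n) (s n)" for n
  define b where "b n i = d n i * s n i" for n i
  have m_pos: "\<forall>\<^sub>F n in sequentially. m n > 0 \<and> m n > real n - 1"
    using eventually_ge_at_top[of 1]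
  proof eventually_elim
    case (elim n)
    then show ?case using m[rule_format, of n] by auto
  qed
  have i_m: "(\<lambda>n. real (i n) / m n) \<longlonglongrightarrow> g * t" if "(\<lambda>n. real (i n) / real n) \<longlonglongrightarrow> t" for i t
    using tendsto_mult[OF g(1) that]
    by (rule Lim_transform_eventually) (use eventually_gt_at_top[of 0] in \<open>eventually_elim, simp\<close>)
  have one_m: "(\<lambda>n. 1 / m n) \<longlonglongrightarrow> 0"
  proof -
    have "(\<lambda>n. real 1 / real n) \<longlonglongrightarrow> 0" by real_asymp
    from i_m[OF this] show ?thesis by simp
  qed
  have d_lim: "(\<lambda>n. (d n (i n))\<^sup>2) \<longlonglongrightarrow> 1 - g * t"
    if i: "\<forall>\<^sub>F n in sequentially. i n \<in> {1..n}" and t: "(\<lambda>n. real (i n) / real n) \<longlonglongrightarrow> t" for i t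
  proof (rule tendsto_of_uniformly_small[OF d i])
    have "(\<lambda>n. 1 - real (i n) / m n + 1 / m n) \<longlonglongrightarrow> 1 - g * t + 0" by (intro tendsto_intros i_m t one_m)
    then have "(\<lambda>n. 1 - real (i n) / m n + 1 / m n) \<longlonglongrightarrow> 1 - g * t" by simp
    then show "(\<lambda>n. (m n - real (i n) + 1) / m n) \<longlonglongrightarrow> 1 - g * t"
      by (rule Lim_transform_eventually)
         (use m_pos in \<open>eventually_elim, simp add: add_divide_distrib diff_divide_distrib\<close>)
  qed
  have s_lim: "(\<lambda>n. (s n (i n))\<^sup>2) \<longlonglongrightarrow> g * (1 - t)"
    if i: "\<forall>\<^sub>F n in sequentially. i n \<in> {1..<n}" and t: "(\<lambda>n. real (i n) / real n) \<longlonglongrightarrow> t" for i t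
  proof (rule tendsto_of_uniformly_small[OF s i])
    have "(\<lambda>n. real n / m n - real (i n) / m n) \<longlonglongrightarrow> g - g * t" by (intro tendsto_intros i_m t g(1))
    then show "(\<lambda>n. (real n - real (i n)) / m n) \<longlonglongrightarrow> g * (1 - t)"
      by (simp add: diff_divide_distrib right_diff_distrib)
  qed
  have b_lim: "(\<lambda>n. b n (i n)) \<longlonglongrightarrow> sqrt ((1 - g * t) * (g * (1 - t)))"
    if i: "\<forall>\<^sub>F n in sequentially. i n \<in> {1..<n}" and t: "(\<lambda>n. real (i n) / real n) \<longlonglongrightarrow> t" for i t
  proof -
    have i': "\<forall>\<^sub>F n in sequentially. i n \<in> {1..n}" using i by (auto elim!: eventually_mono)
    have "\<forall>\<^sub>F n in sequentially. sqrt ((d n (i n))\<^sup>2 * (s n (i n))\<^sup>2) = b n (i n)"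
      using i i'
    proof eventually_elim
      case (elim n)
      then have "d n (i n) > 0" "s n (i n) > 0" using pos by blast+
      then show ?case by (simp add: b_def real_sqrt_mult)
    qed
    then show ?thesis
      by (rule Lim_transform_eventually[OF tendsto_real_sqrt[OF tendsto_mult[OF d_lim[OF i' t] s_lim[OF i t]]]])
  qed
  have "follows_profile a (wishart_diag_profile g)"
    unfolding follows_profile_def
  proof (intro ballI allI impI)
    fix t i assume t: "t \<in> {0<..<1}" "(\<lambda>n. real (i n) / real n) \<longlonglongrightarrow> (t :: real)"
    note int = eventually_interior_index[of i t, OF t(2)]
    have "(\<lambda>n. (d n (i n))\<^sup>2 + (s n (i n - 1))\<^sup>2) \<longlonglongrightarrow> (1 - g * t) + g * (1 - t)"
      using int t by (intro tendsto_add d_lim s_lim) (auto elim!: eventually_mono)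
    moreover have "\<forall>\<^sub>F n in sequentially. (d n (i n))\<^sup>2 + (s n (i n - 1))\<^sup>2 = a n (i n)"
      using int t by (auto simp: a_def wishart_diag_def elim!: eventually_mono)
    ultimately show "(\<lambda>n. a n (i n)) \<longlonglongrightarrow> wishart_diag_profile g t"
      unfolding wishart_diag_profile_def by (rule Lim_transform_eventually)
  qed
  moreover have "follows_profile b (wishart_offdiag_profile g)"
    unfolding follows_profile_def wishart_offdiag_profile_def
    by (auto intro!: b_lim eventually_mono[OF eventually_interior_index(1)])
  moreover have "\<forall>\<^sub>F n in sequentially. (\<forall>i\<in>{1..n}. \<bar>a n i\<bar> \<le> 4) \<and> (\<forall>i\<in>{1..<n}. \<bar>b n i\<bar> \<le> 4)"
  proof -
    have "\<forall>\<^sub>F n in sequentially. \<forall>i\<in>{1..n}. (d n i)\<^sup>2 \<le> 2"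
      by (rule uniformly_small_eventually_bounded[OF d])
         (use m_pos in \<open>eventually_elim, auto simp: divide_le_eq\<close>)
    moreover have "\<forall>\<^sub>F n in sequentially. \<forall>i\<in>{1..<n}. (s n i)\<^sup>2 \<le> 2"
      by (rule uniformly_small_eventually_bounded[OF s])
         (use m_pos in \<open>eventually_elim, auto simp: divide_le_eq\<close>)
    ultimately show ?thesis
    proof eventually_elim
      case (elim n)
      have "\<bar>a n i\<bar> \<le> 4" if i: "i \<in> {1..n}" for i
      proof (cases "i > 1")
        case True
        then have "i - 1 \<in> {1..<n}" using i by auto
        with elim i have "(d n i)\<^sup>2 \<le> 2" "(s n (i - 1))\<^sup>2 \<le> 2" by blast+
        then show ?thesis using True by (simp add: a_def wishart_diag_def)
      next
        case False
        have "(d n i)\<^sup>2 \<le> 2" using elim i by blast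
        then show ?thesis using False by (simp add: a_def wishart_diag_def)
      qed
      moreover have "\<bar>b n i\<bar> \<le> 4" if i: "i \<in> {1..<n}" for i
      proof -
        have "(d n i)\<^sup>2 \<le> 2" "(s n i)\<^sup>2 \<le> 2" using elim i by auto
        then have "(b n i)\<^sup>2 \<le> 2 * 2" unfolding b_def power_mult_distrib by (intro mult_mono) auto
        then have "(b n i)\<^sup>2 \<le> 4\<^sup>2" by simp
        then show ?thesis by (simp only: abs_le_square_iff[symmetric] abs_numeral)
      qed
      ultimately show ?case by blast
    qed
  qed
  moreover have fixed: "(\<lambda>n. real i / real n) \<longlonglongrightarrow> 0" for i by real_asymp
  have fixed_mem: "\<forall>\<^sub>F n in sequentially. i \<in> {1..<n}" "\<forall>\<^sub>F n in sequentially. i \<in> {1..n}" if "i \<ge> 1" for i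
    using that eventually_gt_at_top[of i] by (auto elim!: eventually_mono)
  have "(\<lambda>n. a n i) \<longlonglongrightarrow> (if i = 1 then 1 else 1 + g)" if "i \<ge> 1" for i
  proof -
    have "(\<lambda>n. (d n i)\<^sup>2) \<longlonglongrightarrow> 1" using d_lim[OF fixed_mem(2)[OF that] fixed] by simp
    moreover have "(\<lambda>n. (s n (i - 1))\<^sup>2) \<longlonglongrightarrow> g" if "i > 1"
      using s_lim[OF fixed_mem(1)[of "i - 1"] fixed] that by simp
    ultimately show ?thesis
      using that tendsto_add[of "\<lambda>n. (d n i)\<^sup>2" 1 sequentially "\<lambda>n. (s n (i - 1))\<^sup>2" g]
      by (cases "i = 1") (simp_all add: a_def wishart_diag_def)
  qed
  moreover have "(\<lambda>n. b n i) \<longlonglongrightarrow> sqrt g" if "i \<ge> 1" for i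
    using b_lim[OF fixed_mem(1)[OF that] fixed] by simp
  moreover have "wishart_diag_profile g \<in> borel_measurable borel" "wishart_offdiag_profile g \<in> borel_measurable borel"
    unfolding wishart_diag_profile_def wishart_offdiag_profile_def by measurable
  ultimately show "converges_weakly (\<lambda>n. empirical_measure (wishart_matrix n (d n) (s n))) (marchenko_pastur_distribution g)"
    "converges_weakly (\<lambda>n. spectral_measure (wishart_matrix n (d n) (s n))) (marchenko_pastur_distribution g)"
    unfolding wishart_matrix_eq_jacobi_matrix a_def[symmetric] b_def[symmetric]
    using jacobi_weak_limits[where a = a and b = b and A = "wishart_diag_profile g" and B = "wishart_offdiag_profile g" and K = 4 and C = 2,
        OF _ _ _ _ _ _ _ _ marchenko_pastur_eq_arcsine_mixture[OF g(2,3)] marchenko_pastur_spectral_moments[OF g(2,3)]]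
      wishart_profile_bounds[OF g(2,3)] by blast+
qed

theorem wishart_beta_weak_limits:
  assumes "\<beta> > 0" "\<forall>n\<ge>1. m n > real n - 1" "(\<lambda>n. real n / m n) \<longlonglongrightarrow> g" "0 < g" "g < 1"
    "wishart_beta_entries M \<beta> m d s"
  shows "weakly_converges_almost_surely M
          (\<lambda>n \<omega>. empirical_measure (wishart_matrix n (\<lambda>i. d n i \<omega>) (\<lambda>i. s n i \<omega>))) (marchenko_pastur_distribution g)"
    and "weakly_converges_almost_surely M
          (\<lambda>n \<omega>. spectral_measure (wishart_matrix n (\<lambda>i. d n i \<omega>) (\<lambda>i. s n i \<omega>))) (marchenko_pastur_distribution g)"
  by (rule weakly_converges_almost_surelyI[OF AE_wishart_regular[OF assms(1,2,6)]],
      erule wishart_limits[OF _ assms(2-5)])+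

section \<open>MANOVA ensembles\<close>

lemma tendsto_over_scale:
  fixes x :: "nat \<Rightarrow> real"
  assumes \<beta>: "\<beta> > 0" and x: "(\<lambda>n. x n - real n * \<beta> / 2 * k) \<in> o(\<lambda>n. (real n * \<beta>) powr (1 / 2))"
  shows "(\<lambda>n. x n / (real n * \<beta>)) \<longlonglongrightarrow> k / 2"
proof -
  have "(\<lambda>n. (real n * \<beta>) powr (1 / 2)) \<in> O(\<lambda>n. real n * \<beta>)" using \<beta> by real_asymp
  from landau_o.small_big_trans[OF x this]
  have "(\<lambda>n. (x n - real n * \<beta> / 2 * k) / (real n * \<beta>)) \<longlonglongrightarrow> 0" by (rule smalloD_tendsto)
  then have "(\<lambda>n. (x n - real n * \<beta> / 2 * k) / (real n * \<beta>) + k / 2) \<longlonglongrightarrow> 0 + k / 2" by (intro tendsto_intros)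
  then have lim: "(\<lambda>n. (x n - real n * \<beta> / 2 * k) / (real n * \<beta>) + k / 2) \<longlonglongrightarrow> k / 2" by simp
  have "\<forall>\<^sub>F n in sequentially. (x n - real n * \<beta> / 2 * k) / (real n * \<beta>) + k / 2 = x n / (real n * \<beta>)"
    using eventually_gt_at_top[of 0] by eventually_elim (use \<beta> in \<open>simp add: field_simps\<close>)
  with lim show ?thesis by (rule Lim_transform_eventually)
qed

definition manova_shape1 :: "real \<Rightarrow> real \<Rightarrow> real \<Rightarrow> nat \<Rightarrow> int \<Rightarrow> real" where
  "manova_shape1 \<beta> a b n k = (if even k then (2 * real n - of_int k) / 4 * \<beta>
     else (2 * real n - of_int k - 1) / 4 * \<beta> + a + 1)"

definition manova_shape2 :: "real \<Rightarrow> real \<Rightarrow> real \<Rightarrow> nat \<Rightarrow> int \<Rightarrow> real" where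
  "manova_shape2 \<beta> a b n k = (if even k then (2 * real n - of_int k - 2) / 4 * \<beta> + a + b + 2
     else (2 * real n - of_int k - 1) / 4 * \<beta> + b + 1)"

definition manova_mean :: "real \<Rightarrow> real \<Rightarrow> real \<Rightarrow> nat \<Rightarrow> int \<Rightarrow> real" where
  "manova_mean \<beta> a b n k = manova_shape1 \<beta> a b n k / (manova_shape1 \<beta> a b n k + manova_shape2 \<beta> a b n k)"

lemma manova_shape_sum:
  "manova_shape1 \<beta> a b n k + manova_shape2 \<beta> a b n k = (2 * real n - of_int k - 1) / 2 * \<beta> + a + b + 2"
  by (simp add: manova_shape1_def manova_shape2_def field_simps)

lemma manova_shape_pos:
  assumes "\<beta> > 0" "a > -1" "b > -1" "k \<in> {1..2 * int n - 1}"
  shows "manova_shape1 \<beta> a b n k > 0" "manova_shape2 \<beta> a b n k > 0"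
proof -
  have k: "real_of_int k \<le> 2 * real n - 1" using assms(4) by simp
  show "manova_shape1 \<beta> a b n k > 0"
  proof (cases "even k")
    case True
    then show ?thesis using k assms by (simp add: manova_shape1_def)
  next
    case False
    have "0 \<le> (2 * real n - of_int k - 1) / 4 * \<beta>" using k assms by simp
    moreover have "manova_shape1 \<beta> a b n k = (2 * real n - of_int k - 1) / 4 * \<beta> + a + 1"
      by (simp only: manova_shape1_def False if_False)
    ultimately show ?thesis using assms by linarith
  qed
  show "manova_shape2 \<beta> a b n k > 0"
  proof (cases "even k")
    case True
    then have "k \<noteq> 2 * int n - 1" by auto
    then have "real_of_int k \<le> 2 * real n - 2" using assms(4) by simp
    then have "0 \<le> (2 * real n - of_int k - 2) / 4 * \<beta>" using assms by simp
    moreover have "manova_shape2 \<beta> a b n k = (2 * real n - of_int k - 2) / 4 * \<beta> + a + b + 2"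
      by (simp only: manova_shape2_def True if_True)
    ultimately show ?thesis using assms by linarith
  next
    case False
    have "0 \<le> (2 * real n - of_int k - 1) / 4 * \<beta>" using k assms by simp
    moreover have "manova_shape2 \<beta> a b n k = (2 * real n - of_int k - 1) / 4 * \<beta> + b + 1"
      by (simp only: manova_shape2_def False if_False)
    ultimately show ?thesis using assms by linarith
  qed
qed

definition manova_bulk :: "real \<Rightarrow> nat \<Rightarrow> int set" where
  "manova_bulk \<delta> n = {k\<in>{1..2 * int n - 1}. of_int k \<le> 2 * (1 - \<delta>) * real n}"

definition manova_regular :: "real \<Rightarrow> (nat \<Rightarrow> real) \<Rightarrow> (nat \<Rightarrow> real) \<Rightarrow> (nat \<Rightarrow> int \<Rightarrow> real) \<Rightarrow> bool" where
  "manova_regular \<beta> a b p \<longleftrightarrow>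
     (\<forall>\<delta>\<in>{0<..<1}. uniformly_small (manova_bulk \<delta>) (\<lambda>n k. p n k - manova_mean \<beta> (a n) (b n) n k))
     \<and> (\<forall>n. \<forall>k\<in>{1..2 * int n - 1}. 0 < p n k \<and> p n k < 1) \<and> (\<forall>n\<ge>1. p n (-1) = 0 \<and> p n 0 = 0)"

text \<open>The parameters of the \<open>k\<close>-th beta variable add up to a quantity of order \<open>2 n - k\<close>, so there is
concentration as long as \<open>k\<close> stays below \<open>2 (1 - \<delta>) n\<close>. The variables beyond that may fluctuate, but they
are bounded, and \<open>\<delta>\<close> is arbitrary.\<close>

lemma AE_manova_regular:
  assumes \<beta>: "\<beta> > 0" and ab: "\<forall>n\<ge>1. a n > -1 \<and> b n > -1" and V: "manova_beta_variables M \<beta> a b p"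
  shows "AE \<omega> in M. manova_regular \<beta> a b (\<lambda>n k. p n k \<omega>)"
proof -
  interpret prob_space M using V by (simp add: manova_beta_variables_def)
  define S1 where "S1 n = manova_shape1 \<beta> (a n) (b n) n" for n
  define S2 where "S2 n = manova_shape2 \<beta> (a n) (b n) n" for n
  have p: "distributed M lborel (p n k) (beta_density (S1 n k) (S2 n k))" if "k \<in> {1..2 * int n - 1}" for n k
  proof -
    have "n \<ge> 1" using that by auto
    then have E: "distributed M lborel (p n k)
        (if even k
         then beta_density ((2 * real n - of_int k) / 4 * \<beta>) ((2 * real n - of_int k - 2) / 4 * \<beta> + a n + b n + 2)
         else beta_density ((2 * real n - of_int k - 1) / 4 * \<beta> + a n + 1) ((2 * real n - of_int k - 1) / 4 * \<beta> + b n + 1))"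
      using V that unfolding manova_beta_variables_def by blast
    show ?thesis
    proof (cases "even k")
      case True
      from E show ?thesis unfolding S1_def S2_def manova_shape1_def manova_shape2_def by (simp only: True if_True)
    next
      case False
      from E show ?thesis unfolding S1_def S2_def manova_shape1_def manova_shape2_def by (simp only: False if_False)
    qed
  qed
  have pos: "S1 n k > 0" "S2 n k > 0" if "k \<in> {1..2 * int n - 1}" for n k
    unfolding S1_def S2_def using manova_shape_pos[OF \<beta>, of "a n" "b n" k n] ab[rule_format, of n] that by auto
  have one: "AE \<omega> in M. uniformly_small (manova_bulk \<delta>) (\<lambda>n k. p n k \<omega> - manova_mean \<beta> (a n) (b n) n k)"
    if \<delta>: "0 < \<delta>" for \<delta>
  proof (rule AE_uniformly_small[where c = "\<lambda>e. e\<^sup>2 / 16 * \<delta> * \<beta>" and N = "max 1 (nat \<lceil>1 / \<delta>\<rceil>)"])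
    show "finite (manova_bulk \<delta> n)" for n
      unfolding manova_bulk_def by (rule finite_subset[of _ "{1..2 * int n - 1}"]) auto
    have "manova_bulk \<delta> n \<subseteq> {1..2 * int n}" for n unfolding manova_bulk_def by auto
    from card_mono[OF _ this] show "card (manova_bulk \<delta> n) \<le> 2 * n" for n by (simp add: nat_mult_distrib)
    show "(\<lambda>\<omega>. p n k \<omega> - manova_mean \<beta> (a n) (b n) n k) \<in> borel_measurable M" if "k \<in> manova_bulk \<delta> n" for n k
      using distributed_measurable[OF p[of k n]] that by (simp add: manova_bulk_def)
    show "e\<^sup>2 / 16 * \<delta> * \<beta> > 0" if "e > 0" for e :: real using that \<delta> \<beta> by simp
    fix e :: real and n k
    assume e: "0 < e" "e \<le> 1" and n: "max 1 (nat \<lceil>1 / \<delta>\<rceil>) \<le> n" and k: "k \<in> manova_bulk \<delta> n"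
    then have k': "k \<in> {1..2 * int n - 1}" "real_of_int k + 2 * (\<delta> * real n) \<le> 2 * real n"
      by (simp_all add: manova_bulk_def algebra_simps)
    have "1 / \<delta> \<le> real n" using n by linarith
    then have "1 \<le> \<delta> * real n" using \<delta> by (simp add: field_simps)
    with k'(2) have "\<delta> * real n / 2 \<le> (2 * real n - of_int k - 1) / 2" by (simp add: field_simps)
    from mult_right_mono[OF this, of \<beta>]
    have N: "\<delta> * real n / 2 * \<beta> \<le> S1 n k + S2 n k"
      unfolding S1_def S2_def manova_shape_sum using \<beta> ab[rule_format, of n] n by linarith
    have "prob {\<omega>\<in>space M. e \<le> \<bar>p n k \<omega> - manova_mean \<beta> (a n) (b n) n k\<bar>}
        \<le> 4 * exp (- e\<^sup>2 / 8 * (S1 n k + S2 n k))"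
      unfolding manova_mean_def S1_def[symmetric] S2_def[symmetric]
      by (rule beta_concentration[OF p[OF k'(1)] pos[OF k'(1)] e])
    also have "\<dots> \<le> 4 * exp (- e\<^sup>2 / 8 * (\<delta> * real n / 2 * \<beta>))"
      using mult_left_mono[OF N, of "e\<^sup>2 / 8"] by simp
    also have "- e\<^sup>2 / 8 * (\<delta> * real n / 2 * \<beta>) = - (e\<^sup>2 / 16 * \<delta> * \<beta>) * real n" by simp
    finally show "prob {\<omega>\<in>space M. e \<le> \<bar>p n k \<omega> - manova_mean \<beta> (a n) (b n) n k\<bar>}
        \<le> 4 * exp (- (e\<^sup>2 / 16 * \<delta> * \<beta>) * real n)" .
  qed
  have "AE \<omega> in M. \<forall>j :: nat. uniformly_small (manova_bulk (1 / real (Suc j)))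
      (\<lambda>n k. p n k \<omega> - manova_mean \<beta> (a n) (b n) n k)"
    unfolding AE_all_countable by (intro allI one) simp
  moreover have "AE \<omega> in M. \<forall>n. \<forall>k\<in>{1..2 * int n - 1}. 0 < p n k \<omega> \<and> p n k \<omega> < 1"
    unfolding AE_all_countable by (intro allI AE_finite_allI AE_beta_range[OF p]) auto
  ultimately show ?thesis
  proof eventually_elim
    case (elim \<omega>)
    have "uniformly_small (manova_bulk \<delta>) (\<lambda>n k. p n k \<omega> - manova_mean \<beta> (a n) (b n) n k)" if \<delta>: "\<delta> \<in> {0<..<1}" for \<delta>
    proof -
      obtain j where j: "1 / real (Suc j) < \<delta>" using \<delta> nat_approx_posE by (metis greaterThanLessThan_iff)
      have "2 * (1 - \<delta>) * real n \<le> 2 * (1 - 1 / real (Suc j)) * real n" for n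
        using j by (intro mult_right_mono) auto
      then have "manova_bulk \<delta> n \<subseteq> manova_bulk (1 / real (Suc j)) n" for n
        unfolding manova_bulk_def by (auto intro: order_trans)
      with elim(1)[rule_format, of j] show ?thesis by (rule uniformly_small_subset)
    qed
    moreover have "\<forall>n\<ge>1. p n (-1) \<omega> = 0 \<and> p n 0 \<omega> = 0" using V by (simp add: manova_beta_variables_def)
    ultimately show ?case using elim(2) unfolding manova_regular_def by blast
  qed
qed

context manova_parameters
begin

lemma manova_mean_limit:
  fixes a b :: "nat \<Rightarrow> real" and k :: "nat \<Rightarrow> int"
  assumes \<beta>: "\<beta> > 0"
    and a: "(\<lambda>n. a n / (real n * \<beta>)) \<longlonglongrightarrow> ka / 2" and b: "(\<lambda>n. b n / (real n * \<beta>)) \<longlonglongrightarrow> kb / 2"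
    and k: "(\<lambda>n. of_int (k n) / real n) \<longlonglongrightarrow> 2 * t" and t: "t < 1"
  shows "\<forall>\<^sub>F n in sequentially. even (k n) \<Longrightarrow> (\<lambda>n. manova_mean \<beta> (a n) (b n) n (k n)) \<longlonglongrightarrow> r t"
    and "\<forall>\<^sub>F n in sequentially. odd (k n) \<Longrightarrow> (\<lambda>n. manova_mean \<beta> (a n) (b n) n (k n)) \<longlonglongrightarrow> q t"
proof -
  define S where "S n = real n * \<beta>" for n
  have S: "\<forall>\<^sub>F n in sequentially. S n > 0"
    using eventually_gt_at_top[of 0] by eventually_elim (use \<beta> in \<open>simp add: S_def\<close>)
  have inv: "(\<lambda>n. 1 / S n) \<longlonglongrightarrow> 0" "(\<lambda>n. 1 / real n) \<longlonglongrightarrow> 0" unfolding S_def using \<beta> by real_asymp+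
  have D: "D t > 0" using D_pos[OF t] .
  have sum: "(\<lambda>n. (manova_shape1 \<beta> (a n) (b n) n (k n) + manova_shape2 \<beta> (a n) (b n) n (k n)) / S n) \<longlonglongrightarrow> D t / 2"
  proof -
    have "(\<lambda>n. (2 - of_int (k n) / real n - 1 / real n) / 2 + a n / S n + b n / S n + 2 * (1 / S n))
        \<longlonglongrightarrow> (2 - 2 * t - 0) / 2 + ka / 2 + kb / 2 + 2 * 0"
      unfolding S_def by (intro tendsto_intros k a b inv(1)[unfolded S_def] inv(2)) auto
    also have "(2 - 2 * t - 0) / 2 + ka / 2 + kb / 2 + 2 * 0 = D t / 2" by (simp add: D_def field_simps)
    finally have lim: "(\<lambda>n. (2 - of_int (k n) / real n - 1 / real n) / 2 + a n / S n + b n / S n + 2 * (1 / S n)) \<longlonglongrightarrow> D t / 2" .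
    have "\<forall>\<^sub>F n in sequentially. (2 - of_int (k n) / real n - 1 / real n) / 2 + a n / S n + b n / S n + 2 * (1 / S n)
        = (manova_shape1 \<beta> (a n) (b n) n (k n) + manova_shape2 \<beta> (a n) (b n) n (k n)) / S n"
      using eventually_gt_at_top[of 0]
    proof eventually_elim
      case (elim n)
      have "(2 * real n - of_int (k n) - 1) / 2 * \<beta> / S n = (2 - of_int (k n) / real n - 1 / real n) / 2"
        using elim \<beta> by (simp add: S_def field_simps)
      then show ?case by (simp add: manova_shape_sum add_divide_distrib)
    qed
    with lim show ?thesis by (rule Lim_transform_eventually)
  qed
  have ratio: "(\<lambda>n. manova_mean \<beta> (a n) (b n) n (k n)) \<longlonglongrightarrow> l / (D t / 2)"
    if "(\<lambda>n. manova_shape1 \<beta> (a n) (b n) n (k n) / S n) \<longlonglongrightarrow> l" for l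
  proof (rule Lim_transform_eventually[OF tendsto_divide[OF that sum]])
    show "\<forall>\<^sub>F n in sequentially. manova_shape1 \<beta> (a n) (b n) n (k n) / S n /
        ((manova_shape1 \<beta> (a n) (b n) n (k n) + manova_shape2 \<beta> (a n) (b n) n (k n)) / S n) = manova_mean \<beta> (a n) (b n) n (k n)"
      using S by eventually_elim (simp add: manova_mean_def)
  qed (use D in simp)
  show "(\<lambda>n. manova_mean \<beta> (a n) (b n) n (k n)) \<longlonglongrightarrow> r t" if ev: "\<forall>\<^sub>F n in sequentially. even (k n)"
  proof -
    have "(\<lambda>n. (2 - of_int (k n) / real n) / 4) \<longlonglongrightarrow> (2 - 2 * t) / 4"
      by (intro tendsto_intros k) auto
    moreover have "\<forall>\<^sub>F n in sequentially. (2 - of_int (k n) / real n) / 4 = manova_shape1 \<beta> (a n) (b n) n (k n) / S n"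
      using ev eventually_gt_at_top[of 0]
      by eventually_elim (use \<beta> in \<open>simp add: manova_shape1_def S_def field_simps\<close>)
    ultimately have "(\<lambda>n. manova_shape1 \<beta> (a n) (b n) n (k n) / S n) \<longlonglongrightarrow> (2 - 2 * t) / 4"
      by (rule Lim_transform_eventually)
    note lim = ratio[OF this]
    have "(2 - 2 * t) / 4 / (D t / 2) = r t" using D by (simp add: r_def field_simps)
    with lim show ?thesis by (simp only:)
  qed
  show "(\<lambda>n. manova_mean \<beta> (a n) (b n) n (k n)) \<longlonglongrightarrow> q t" if od: "\<forall>\<^sub>F n in sequentially. odd (k n)"
  proof -
    have "(\<lambda>n. (2 - of_int (k n) / real n - 1 / real n) / 4 + a n / S n + 1 / S n) \<longlonglongrightarrow> (2 - 2 * t - 0) / 4 + ka / 2 + 0"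
      unfolding S_def by (intro tendsto_intros k a inv(1)[unfolded S_def] inv(2)) auto
    moreover have "\<forall>\<^sub>F n in sequentially. (2 - of_int (k n) / real n - 1 / real n) / 4 + a n / S n + 1 / S n
        = manova_shape1 \<beta> (a n) (b n) n (k n) / S n"
      using od eventually_gt_at_top[of 0]
    proof eventually_elim
      case (elim n)
      have "(2 * real n - of_int (k n) - 1) / 4 * \<beta> / S n = (2 - of_int (k n) / real n - 1 / real n) / 4"
        using elim \<beta> by (simp add: S_def field_simps)
      then show ?case using elim by (simp add: manova_shape1_def add_divide_distrib)
    qed
    ultimately have "(\<lambda>n. manova_shape1 \<beta> (a n) (b n) n (k n) / S n) \<longlonglongrightarrow> (2 - 2 * t - 0) / 4 + ka / 2 + 0"
      by (rule Lim_transform_eventually)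
    note lim = ratio[OF this]
    have "((2 - 2 * t - 0) / 4 + ka / 2 + 0) / (D t / 2) = q t" using D by (simp add: q_def field_simps)
    with lim show ?thesis by (simp only:)
  qed
qed

text \<open>Row \<open>i\<close> involves the variables with index \<open>2 i - 3\<close> to \<open>2 i\<close>. In the first row two of them are the
conventional zeros, which is why the corner of the limit is different.\<close>

lemma manova_limits:
  assumes reg: "manova_regular \<beta> a b p" and \<beta>: "\<beta> > 0"
    and a: "(\<lambda>n. a n / (real n * \<beta>)) \<longlonglongrightarrow> ka / 2" and b: "(\<lambda>n. b n / (real n * \<beta>)) \<longlonglongrightarrow> kb / 2"
  shows "converges_weakly (\<lambda>n. empirical_measure (manova_matrix n (p n))) (kesten_mckey_distribution ka kb)"
    and "converges_weakly (\<lambda>n. spectral_measure (manova_matrix n (p n))) (kesten_mckey_distribution ka kb)"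
proof -
  have small: "\<And>\<delta>. \<delta> \<in> {0<..<1} \<Longrightarrow> uniformly_small (manova_bulk \<delta>) (\<lambda>n k. p n k - manova_mean \<beta> (a n) (b n) n k)"
    and range: "\<And>n k. k \<in> {1..2 * int n - 1} \<Longrightarrow> 0 < p n k \<and> p n k < 1"
    and zero: "\<forall>n\<ge>1. p n (-1) = 0 \<and> p n 0 = 0"
    using reg by (simp_all add: manova_regular_def)
  have p_lim: "(\<lambda>n. p n (k n)) \<longlonglongrightarrow> l"
    if k: "\<forall>\<^sub>F n in sequentially. 1 \<le> k n" "(\<lambda>n. of_int (k n) / real n) \<longlonglongrightarrow> 2 * t" and t: "0 \<le> t" "t < 1"
      and l: "(\<lambda>n. manova_mean \<beta> (a n) (b n) n (k n)) \<longlonglongrightarrow> l" for k t l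
  proof -
    \<comment> \<open>Then \<open>1 - \<delta>\<close> lies halfway between \<open>t\<close> and 1.\<close>
    define \<delta> where "\<delta> = (1 - t) / 2"
    have \<delta>: "\<delta> \<in> {0<..<1}" "2 * t < 2 * (1 - \<delta>)" using t by (auto simp: \<delta>_def field_simps)
    have "\<forall>\<^sub>F n in sequentially. of_int (k n) / real n < 2 * (1 - \<delta>)"
      using order_tendstoD(2)[OF k(2) \<delta>(2)] .
    moreover have "\<forall>\<^sub>F n in sequentially. of_int (k n) / real n < 2 - \<delta>"
      using \<delta> by (intro order_tendstoD(2)[OF k(2)]) auto
    moreover have "\<forall>\<^sub>F n in sequentially. 1 < \<delta> * real n" using \<delta> by real_asymp
    ultimately have "\<forall>\<^sub>F n in sequentially. k n \<in> manova_bulk \<delta> n"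
      using k(1) eventually_gt_at_top[of 0]
    proof eventually_elim
      case (elim n)
      have "of_int (k n) < 2 * (1 - \<delta>) * real n" "of_int (k n) < (2 - \<delta>) * real n"
        using elim by (simp_all add: divide_less_eq)
      moreover from this(2) elim(3) have "real_of_int (k n) < 2 * real n - 1" by (simp add: algebra_simps)
      ultimately show ?case using elim(4) by (auto simp: manova_bulk_def)
    qed
    then show ?thesis by (rule tendsto_of_uniformly_small[OF small[OF \<delta>(1)] _ l])
  qed
  have p_odd: "(\<lambda>n. p n (2 * int (i n) - c)) \<longlonglongrightarrow> q t"
    if "\<forall>\<^sub>F n in sequentially. 1 \<le> 2 * int (i n) - c" "(\<lambda>n. real (i n) / real n) \<longlonglongrightarrow> t" "0 \<le> t" "t < 1" "odd c" for i c t
  proof -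
    have "(\<lambda>n. real_of_int c / real n) \<longlonglongrightarrow> 0" by real_asymp
    from tendsto_diff[OF tendsto_mult[OF tendsto_const[of 2] that(2)] this]
    have k: "(\<lambda>n. of_int (2 * int (i n) - c) / real n) \<longlonglongrightarrow> 2 * t" by (simp add: diff_divide_distrib)
    show ?thesis
      using that by (intro p_lim[OF _ k] manova_mean_limit(2)[OF \<beta> a b k]) auto
  qed
  have p_even: "(\<lambda>n. p n (2 * int (i n) - c)) \<longlonglongrightarrow> r t"
    if "\<forall>\<^sub>F n in sequentially. 1 \<le> 2 * int (i n) - c" "(\<lambda>n. real (i n) / real n) \<longlonglongrightarrow> t" "0 \<le> t" "t < 1" "even c" for i c t
  proof -
    have "(\<lambda>n. real_of_int c / real n) \<longlonglongrightarrow> 0" by real_asymp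
    from tendsto_diff[OF tendsto_mult[OF tendsto_const[of 2] that(2)] this]
    have k: "(\<lambda>n. of_int (2 * int (i n) - c) / real n) \<longlonglongrightarrow> 2 * t" by (simp add: diff_divide_distrib)
    show ?thesis
      using that by (intro p_lim[OF _ k] manova_mean_limit(1)[OF \<beta> a b k]) auto
  qed
  define A where "A n i = manova_diag (p n) i" for n i
  define B where "B n i = manova_offdiag (p n) i" for n i
  have J: "manova_matrix n (p n) = jacobi_matrix n (A n) (B n)" for n
    by (simp add: manova_matrix_def A_def[abs_def] B_def[abs_def])
  have A: "A n i = p n (2 * int i - 2) * (1 - p n (2 * int i - 3)) + p n (2 * int i - 1) * (1 - p n (2 * int i - 2))" for n i
    by (simp add: A_def manova_diag_def Let_def)
  have B: "B n i = sqrt (p n (2 * int i - 1) * (1 - p n (2 * int i - 2)) * p n (2 * int i - 0) * (1 - p n (2 * int i - 1)))" for n i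
    by (simp add: B_def manova_offdiag_def Let_def)
  have interior: "(\<lambda>n. A n (i n)) \<longlonglongrightarrow> diag t" "(\<lambda>n. B n (i n)) \<longlonglongrightarrow> offdiag t"
    if i: "\<forall>\<^sub>F n in sequentially. 1 < i n" "(\<lambda>n. real (i n) / real n) \<longlonglongrightarrow> t" and t: "0 \<le> t" "t < 1" for i t
  proof -
    have ev: "\<forall>\<^sub>F n in sequentially. 1 \<le> 2 * int (i n) - c" if "c \<le> 3" for c
      using i(1) by eventually_elim (use that in auto)
    note lims = p_odd[OF ev i(2) t] p_even[OF ev i(2) t]
    have "(\<lambda>n. A n (i n)) \<longlonglongrightarrow> r t * (1 - q t) + q t * (1 - r t)"
      unfolding A by (intro tendsto_intros lims) auto
    then show "(\<lambda>n. A n (i n)) \<longlonglongrightarrow> diag t" by (simp add: diag_def add.commute)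
    have "(\<lambda>n. B n (i n)) \<longlonglongrightarrow> sqrt (q t * (1 - r t) * r t * (1 - q t))"
      unfolding B by (intro tendsto_intros lims) auto
    then show "(\<lambda>n. B n (i n)) \<longlonglongrightarrow> offdiag t" by (simp add: offdiag_def mult.assoc)
  qed
  have "follows_profile A diag" "follows_profile B offdiag"
    unfolding follows_profile_def
    by (auto intro!: interior eventually_mono[OF eventually_interior_index(1)])
  moreover have "\<forall>\<^sub>F n in sequentially. (\<forall>i\<in>{1..n}. \<bar>A n i\<bar> \<le> 2) \<and> (\<forall>i\<in>{1..<n}. \<bar>B n i\<bar> \<le> 2)"
    using eventually_ge_at_top[of 1]
  proof eventually_elim
    case (elim n)
    have u: "0 \<le> p n k \<and> p n k \<le> 1" if "k \<in> {-1..2 * int n - 1}" for k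
    proof -
      consider "k = -1" | "k = 0" | "k \<in> {1..2 * int n - 1}" using \<open>k \<in> {-1..2 * int n - 1}\<close> by force
      then show ?thesis using zero elim range by cases (auto intro: less_imp_le)
    qed
    have prod: "0 \<le> x * y \<and> x * y \<le> 1" if "0 \<le> x \<and> x \<le> 1" "0 \<le> y \<and> y \<le> 1" for x y :: real
      using that mult_mono[of x 1 y 1] by auto
    have compl: "0 \<le> 1 - p n k \<and> 1 - p n k \<le> 1" if "k \<in> {-1..2 * int n - 1}" for k using u[OF that] by auto
    have "\<bar>A n i\<bar> \<le> 2" if i: "i \<in> {1..n}" for i
    proof -
      have "2 * int i - 1 \<in> {-1..2 * int n - 1}" "2 * int i - 2 \<in> {-1..2 * int n - 1}" "2 * int i - 3 \<in> {-1..2 * int n - 1}"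
        using i by auto
      note idx = this
      from prod[OF u[OF idx(2)] compl[OF idx(3)]] prod[OF u[OF idx(1)] compl[OF idx(2)]]
      show ?thesis unfolding A by linarith
    qed
    moreover have "\<bar>B n i\<bar> \<le> 2" if i: "i \<in> {1..<n}" for i
    proof -
      have "2 * int i - 1 \<in> {-1..2 * int n - 1}" "2 * int i - 2 \<in> {-1..2 * int n - 1}" "2 * int i - 0 \<in> {-1..2 * int n - 1}"
        using i by auto
      then have P: "0 \<le> p n (2 * int i - 1) * (1 - p n (2 * int i - 2)) * p n (2 * int i - 0) * (1 - p n (2 * int i - 1)) \<and>
        p n (2 * int i - 1) * (1 - p n (2 * int i - 2)) * p n (2 * int i - 0) * (1 - p n (2 * int i - 1)) \<le> 1"
        by (intro prod u compl)
      then have "0 \<le> B n i" "B n i \<le> 2" unfolding B by (auto intro!: real_le_lsqrt)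
      then show ?thesis by simp
    qed
    ultimately show ?case by blast
  qed
  moreover have fixed: "(\<lambda>n. real i / real n) \<longlonglongrightarrow> 0" for i by real_asymp
  have p_edge: "(\<lambda>n. p n 1) \<longlonglongrightarrow> q 0" "(\<lambda>n. p n 2) \<longlonglongrightarrow> r 0"
    using p_odd[of "\<lambda>_. 1" 1, OF _ fixed] p_even[of "\<lambda>_. 1" 0, OF _ fixed] by simp_all
  have p_zero: "\<forall>\<^sub>F n in sequentially. p n 0 = 0 \<and> p n (-1) = 0"
    using eventually_ge_at_top[of 1] by eventually_elim (use zero in auto)
  have "(\<lambda>n. A n i) \<longlonglongrightarrow> (if i = 1 then q 0 else diag 0)" if "i \<ge> 1" for i
  proof (cases "i = 1")
    case True
    have "(\<lambda>n. p n 1) \<longlonglongrightarrow> (if i = 1 then q 0 else diag 0)" using p_edge True by simp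
    then show ?thesis
      by (rule Lim_transform_eventually) (use p_zero in \<open>eventually_elim, simp add: A True\<close>)
  next
    case False
    then show ?thesis using that interior(1)[of "\<lambda>_. i", OF _ fixed] by simp
  qed
  moreover have "(\<lambda>n. B n i) \<longlonglongrightarrow> (if i = 1 then sqrt (q 0 * (r 0 * (1 - q 0))) else offdiag 0)" if "i \<ge> 1" for i
  proof (cases "i = 1")
    case True
    have "(\<lambda>n. sqrt (p n 1 * (p n 2 * (1 - p n 1)))) \<longlonglongrightarrow> sqrt (q 0 * (r 0 * (1 - q 0)))"
      by (intro tendsto_intros p_edge)
    then have "(\<lambda>n. sqrt (p n 1 * (p n 2 * (1 - p n 1)))) \<longlonglongrightarrow> (if i = 1 then sqrt (q 0 * (r 0 * (1 - q 0))) else offdiag 0)"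
      using True by simp
    then show ?thesis
      by (rule Lim_transform_eventually) (use p_zero in \<open>eventually_elim, simp add: B True mult.assoc\<close>)
  next
    case False
    then show ?thesis using that interior(2)[of "\<lambda>_. i", OF _ fixed] by simp
  qed
  ultimately show "converges_weakly (\<lambda>n. empirical_measure (manova_matrix n (p n))) (kesten_mckey_distribution ka kb)"
    "converges_weakly (\<lambda>n. spectral_measure (manova_matrix n (p n))) (kesten_mckey_distribution ka kb)"
    unfolding J
    using jacobi_weak_limits[where a = A and b = B and A = diag and B = offdiag and K = 2 and C = 2,
        OF _ _ measurable_profiles(2,3) profile_bounds _ _ _ kesten_mckey_eq_arcsine_mixture kesten_mckey_spectral_moments]
    by blast+
qed

end

theorem manova_beta_weak_limits:
  assumes \<beta>: "\<beta> > 0" and ab: "\<forall>n\<ge>1. a n > -1 \<and> b n > -1" and k: "0 \<le> \<kappa>a" "0 \<le> \<kappa>b"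
    and a: "(\<lambda>n. a n - real n * \<beta> / 2 * \<kappa>a) \<in> o(\<lambda>n. (real n * \<beta>) powr (1 / 2))"
    and b: "(\<lambda>n. b n - real n * \<beta> / 2 * \<kappa>b) \<in> o(\<lambda>n. (real n * \<beta>) powr (1 / 2))"
    and V: "manova_beta_variables M \<beta> a b p"
  shows "weakly_converges_almost_surely M
          (\<lambda>n \<omega>. empirical_measure (manova_matrix n (\<lambda>k. p n k \<omega>))) (kesten_mckey_distribution \<kappa>a \<kappa>b)"
    and "weakly_converges_almost_surely M
          (\<lambda>n \<omega>. spectral_measure (manova_matrix n (\<lambda>k. p n k \<omega>))) (kesten_mckey_distribution \<kappa>a \<kappa>b)"
proof -
  interpret manova_parameters \<kappa>a \<kappa>b by unfold_locales (rule k)+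
  show "weakly_converges_almost_surely M
          (\<lambda>n \<omega>. empirical_measure (manova_matrix n (\<lambda>k. p n k \<omega>))) (kesten_mckey_distribution \<kappa>a \<kappa>b)"
    "weakly_converges_almost_surely M
          (\<lambda>n \<omega>. spectral_measure (manova_matrix n (\<lambda>k. p n k \<omega>))) (kesten_mckey_distribution \<kappa>a \<kappa>b)"
    by (rule weakly_converges_almost_surelyI[OF AE_manova_regular[OF \<beta> ab V]],
        erule manova_limits[OF _ \<beta> tendsto_over_scale[OF \<beta> a] tendsto_over_scale[OF \<beta> b]])+
qed

theorem corollary1p2:
  fixes \<beta> :: real
  assumes "\<beta> > 0"
  shows
    "(\<forall>(M :: 'g measure) a b.
        gaussian_beta_entries M \<beta> a b \<longrightarrow>
        weakly_converges_almost_surely M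
          (\<lambda>n \<omega>. empirical_measure (jacobi_matrix n (\<lambda>i. a n i \<omega>) (\<lambda>i. b n i \<omega>)))
          semicircle_distribution \<and>
        weakly_converges_almost_surely M
          (\<lambda>n \<omega>. spectral_measure (jacobi_matrix n (\<lambda>i. a n i \<omega>) (\<lambda>i. b n i \<omega>)))
          semicircle_distribution)
     \<and>
     (\<forall>(M :: 'w measure) (m :: nat \<Rightarrow> real) (\<gamma> :: real) d s.
        (\<forall>n\<ge>1. m n > real n - 1) \<longrightarrow>
        (\<lambda>n. real n / m n) \<longlonglongrightarrow> \<gamma> \<longrightarrow>
        0 < \<gamma> \<longrightarrow> \<gamma> < 1 \<longrightarrow>
        wishart_beta_entries M \<beta> m d s \<longrightarrow>
        weakly_converges_almost_surely M
          (\<lambda>n \<omega>. empirical_measure (wishart_matrix n (\<lambda>i. d n i \<omega>) (\<lambda>i. s n i \<omega>)))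
          (marchenko_pastur_distribution \<gamma>) \<and>
        weakly_converges_almost_surely M
          (\<lambda>n \<omega>. spectral_measure (wishart_matrix n (\<lambda>i. d n i \<omega>) (\<lambda>i. s n i \<omega>)))
          (marchenko_pastur_distribution \<gamma>))
     \<and>
     (\<forall>(M :: 'm measure) (a :: nat \<Rightarrow> real) (b :: nat \<Rightarrow> real) (\<kappa>a :: real) (\<kappa>b :: real) p.
        (\<forall>n\<ge>1. a n > -1 \<and> b n > -1) \<longrightarrow>
        0 \<le> \<kappa>a \<longrightarrow> 0 \<le> \<kappa>b \<longrightarrow>
        (\<lambda>n. a n - real n * \<beta> / 2 * \<kappa>a) \<in> o(\<lambda>n. (real n * \<beta>) powr (1 / 2)) \<longrightarrow>
        (\<lambda>n. b n - real n * \<beta> / 2 * \<kappa>b) \<in> o(\<lambda>n. (real n * \<beta>) powr (1 / 2)) \<longrightarrow>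
        manova_beta_variables M \<beta> a b p \<longrightarrow>
        weakly_converges_almost_surely M
          (\<lambda>n \<omega>. empirical_measure (manova_matrix n (\<lambda>k. p n k \<omega>)))
          (kesten_mckey_distribution \<kappa>a \<kappa>b) \<and>
        weakly_converges_almost_surely M
          (\<lambda>n \<omega>. spectral_measure (manova_matrix n (\<lambda>k. p n k \<omega>)))
          (kesten_mckey_distribution \<kappa>a \<kappa>b))"
  using gaussian_beta_weak_limits[OF assms] wishart_beta_weak_limits[OF assms]
    manova_beta_weak_limits[OF assms]
  by (intro conjI allI impI) blast+

end
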